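(* Let $P=M\otimes H$ be the tensor product bundle with calculus $\Omega^1(P)$ defined by $N_P=N_M\otimes H\otimes H+M\otimes M\otimes N_H+\Omega^1M\otimes\Omega^1H$. A connection $\omega:\Omega_0\to\Omega^1(P)$ on this bundle is equivalent to a linear map (gauge field) $$A:\Omega_0\to\Omega^1(M).$$ The connection and corresponding projection $\Pi_\omega$ resulting from $A$ are $$\omega(v)=\omega_0(v)+\pi_{N_P}\big((S\tilde v_{(1)})\cdot A(\pi_{\Omega_0}\tilde v_{(2)})\cdot\tilde v_{(3)}\big),$$ $$(\mathrm{id}-\Pi_\omega)\Big(\sum_i m_i\otimes n_i\otimes h_i\otimes g_i\Big)=\sum_i\Big(-m_in_iA(\pi_{\Omega_0}g_{i(1)})\otimes1\otimes h_ig_{i(2)}+m_i\,\mathrm dn_i\otimes1\otimes h_ig_i\Big)\in\Omega^1(M)P .$$ In particular, every connection is strong. Here $\tilde v\in\ker\epsilon$ and $\sum_im_i\otimes n_i\otimes h_i\otimes g_i\in\Omega^1P\subset M\otimes M\otimes H\otimes H$ are representatives of $v\in\Omega_0$ and of an element of $\Omega^1(P)$ respectively.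
   Context: Everything is over a field $k$; $H$ is a Hopf algebra with invertible antipode $S$, $M$ a unital algebra. $\Omega^1M=\ker(M\otimes M\to M)$, $\mathrm dm=1\otimes m-m\otimes1$, $\Omega^1(M)=\Omega^1M/N_M$ for a sub-bimodule $N_M$ (similarly for $H$, $P$). The calculus on $H$ is bicovariant: given by a right ideal $Q_H\subset\ker\epsilon$ stable under $\mathrm{Ad}(h)=h_{(2)}\otimes(Sh_{(1)})h_{(3)}$, with $N_H$ corresponding to $H\otimes Q_H$ under $h\otimes g\mapsto hg_{(1)}\otimes g_{(2)}$. $\Omega_0=\ker\epsilon/Q_H$ is a right $H$-comodule by the projected $\mathrm{Ad}$; $\pi_{\Omega_0}:\ker\epsilon\to\Omega_0$, $\pi_{N_P}:\Omega^1P\to\Omega^1(P)$, $\pi_{N_H}:\Omega^1H\to\Omega^1(H)$ are the canonical projections. $P=M\otimes H$ has coaction $\Delta_R=\mathrm{id}\otimes\Delta$, and $P\otimes P$ is identified with $M\otimes M\otimes H\otimes H$. In $\Omega^1(P)=\Omega^1P/N_P$, $\Omega^1(M)P=\Omega^1(M)\otimes1\otimes H$, and $\Omega^1(H)$ embeds as $1\otimes1\otimes\Omega^1(H)$. The map $\mathrm{ver}(p\otimes p')=p\Delta_R(p')$ on $\Omega^1P$ induces $\mathrm{ver}_{N_P}:\Omega^1(P)\to P\otimes\Omega_0$. A connection is a map $\omega:\Omega_0\to\Omega^1(P)$, equivariant under the right $H$-coactions ($\mathrm{Ad}$ on $\Omega_0$, and that induced by $\Delta_R$ on $\Omega^1(P)$),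 with $\mathrm{ver}_{N_P}\circ\omega=1\otimes\mathrm{id}$. Its projection is $\Pi_\omega=\cdot_P(\mathrm{id}\otimes\omega)\mathrm{ver}_{N_P}:\Omega^1(P)\to\Omega^1(P)$; $\omega$ is strong if $(\mathrm{id}-\Pi_\omega)\mathrm dP\subset\Omega^1(M)P$. The reference connection is $\omega_0(v)=1\otimes1\otimes\pi_{N_H}(S\tilde v_{(1)}\otimes\tilde v_{(2)})$. *)

theory Defs
  imports "HOL.Hull" "HOL-Algebra.Module" "HOL-Algebra.RingHom"
begin

section \<open>Linear algebra over a field K\<close>

text \<open>A vector space is a HOL-Algebra module over a field.  In the vector spaces built below that
  are not algebras, the multiplicative fields of the module record are left undefined.\<close>

definition linear_map ::
  "'k ring \<Rightarrow> ('k, 'a, 'x) module_scheme \<Rightarrow> ('k, 'b, 'y) module_scheme \<Rightarrow> ('a \<Rightarrow> 'b) \<Rightarrow> bool"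
  where "linear_map K V W f \<longleftrightarrow>
    f \<in> carrier V \<rightarrow> carrier W \<and>
    (\<forall>x\<in>carrier V. \<forall>y\<in>carrier V. f (x \<oplus>\<^bsub>V\<^esub> y) = f x \<oplus>\<^bsub>W\<^esub> f y) \<and>
    (\<forall>c\<in>carrier K. \<forall>x\<in>carrier V. f (c \<odot>\<^bsub>V\<^esub> x) = c \<odot>\<^bsub>W\<^esub> f x)"

definition lin_span :: "'k ring \<Rightarrow> ('k, 'a, 'x) module_scheme \<Rightarrow> 'a set \<Rightarrow> 'a set"
  where "lin_span K V X = (\<lambda>N. submodule N K V) hull X"

definition quotient_module ::
  "'k ring \<Rightarrow> ('k, 'a, 'x) module_scheme \<Rightarrow> 'a set \<Rightarrow> ('k, 'a set) module"
  where "quotient_module K V N =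
    \<lparr>carrier = a_rcosets\<^bsub>V\<^esub> N, mult = (\<lambda>_ _. undefined), one = undefined,
     zero = N, add = set_add V, smult = (\<lambda>c X. \<Union>x\<in>X. N +>\<^bsub>V\<^esub> (c \<odot>\<^bsub>V\<^esub> x))\<rparr>"

text \<open>The map on cosets induced by a map \<open>f\<close> that is constant on each coset.  As in the
  homomorphism theorem of HOL-Algebra, \<open>the_elem\<close> picks the common value on the coset.\<close>

definition induced :: "('a \<Rightarrow> 'b) \<Rightarrow> 'a set \<Rightarrow> 'b"
  where "induced f X = the_elem (f ` X)"

subsection \<open>Tensor products\<close>

definition free_module :: "'k ring \<Rightarrow> 'a set \<Rightarrow> ('k, 'a \<Rightarrow> 'k) module"
  where "free_module K X =
    \<lparr>carrier = {f. (\<forall>x\<in>X. f x \<in> carrier K) \<and> (\<forall>x. x \<notin> X \<longrightarrow> f x = \<zero>\<^bsub>K\<^esub>) \<and> finite {x. f x \<noteq> \<zero>\<^bsub>K\<^esub>}},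
     mult = (\<lambda>_ _. undefined), one = undefined,
     zero = (\<lambda>_. \<zero>\<^bsub>K\<^esub>), add = (\<lambda>f g x. f x \<oplus>\<^bsub>K\<^esub> g x), smult = (\<lambda>c f x. c \<otimes>\<^bsub>K\<^esub> f x)\<rparr>"

definition free_gen :: "'k ring \<Rightarrow> 'a \<Rightarrow> 'a \<Rightarrow> 'k"
  where "free_gen K x = (\<lambda>y. if y = x then \<one>\<^bsub>K\<^esub> else \<zero>\<^bsub>K\<^esub>)"

definition free_pairs ::
  "'k ring \<Rightarrow> ('k, 'a, 'x) module_scheme \<Rightarrow> ('k, 'b, 'y) module_scheme \<Rightarrow> ('k, 'a \<times> 'b \<Rightarrow> 'k) module"
  where "free_pairs K V W = free_module K (carrier V \<times> carrier W)"

definition bilinear_relations ::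
  "'k ring \<Rightarrow> ('k, 'a, 'x) module_scheme \<Rightarrow> ('k, 'b, 'y) module_scheme \<Rightarrow> ('a \<times> 'b \<Rightarrow> 'k) set"
  where "bilinear_relations K V W = (let F = free_pairs K V W; e = (\<lambda>v w. free_gen K (v, w)) in
      {e (v \<oplus>\<^bsub>V\<^esub> v') w \<ominus>\<^bsub>F\<^esub> (e v w \<oplus>\<^bsub>F\<^esub> e v' w) | v v' w.
        v \<in> carrier V \<and> v' \<in> carrier V \<and> w \<in> carrier W}
    \<union> {e v (w \<oplus>\<^bsub>W\<^esub> w') \<ominus>\<^bsub>F\<^esub> (e v w \<oplus>\<^bsub>F\<^esub> e v w') | v w w'.
        v \<in> carrier V \<and> w \<in> carrier W \<and> w' \<in> carrier W}
    \<union> {e (c \<odot>\<^bsub>V\<^esub> v) w \<ominus>\<^bsub>F\<^esub> (c \<odot>\<^bsub>F\<^esub> e v w) | c v w.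
        c \<in> carrier K \<and> v \<in> carrier V \<and> w \<in> carrier W}
    \<union> {e v (c \<odot>\<^bsub>W\<^esub> w) \<ominus>\<^bsub>F\<^esub> (c \<odot>\<^bsub>F\<^esub> e v w) | c v w.
        c \<in> carrier K \<and> v \<in> carrier V \<and> w \<in> carrier W})"

definition tensor_null ::
  "'k ring \<Rightarrow> ('k, 'a, 'x) module_scheme \<Rightarrow> ('k, 'b, 'y) module_scheme \<Rightarrow> ('a \<times> 'b \<Rightarrow> 'k) set"
  where "tensor_null K V W = lin_span K (free_pairs K V W) (bilinear_relations K V W)"

type_synonym ('k, 'a, 'b) tens = "('a \<times> 'b \<Rightarrow> 'k) set"

definition tensor_space ::
  "'k ring \<Rightarrow> ('k, 'a, 'x) module_scheme \<Rightarrow> ('k, 'b, 'y) module_scheme \<Rightarrow> ('k, ('k, 'a, 'b) tens) module"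
  where "tensor_space K V W = quotient_module K (free_pairs K V W) (tensor_null K V W)"

definition tens ::
  "'k ring \<Rightarrow> ('k, 'a, 'x) module_scheme \<Rightarrow> ('k, 'b, 'y) module_scheme \<Rightarrow> 'a \<Rightarrow> 'b \<Rightarrow> ('k, 'a, 'b) tens"
  where "tens K V W v w = tensor_null K V W +>\<^bsub>free_pairs K V W\<^esub> free_gen K (v, w)"

text \<open>For bilinear \<open>f\<close>, \<open>tlift K U f\<close> is the linear map into \<open>U\<close> with value \<open>f v w\<close> at the
  tensor product of \<open>v\<close> and \<open>w\<close>.\<close>

definition tlift ::
  "'k ring \<Rightarrow> ('k, 'c, 'z) module_scheme \<Rightarrow> ('a \<Rightarrow> 'b \<Rightarrow> 'c) \<Rightarrow> ('k, 'a, 'b) tens \<Rightarrow> 'c"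
  where "tlift K U f = induced (\<lambda>x. \<Oplus>\<^bsub>U\<^esub>p\<in>{p. x p \<noteq> \<zero>\<^bsub>K\<^esub>}. x p \<odot>\<^bsub>U\<^esub> f (fst p) (snd p))"

text \<open>For subspaces \<open>X\<close> of \<open>V\<close> and \<open>Y\<close> of \<open>W\<close>: their tensor product as a subspace of that of
  \<open>V\<close> and \<open>W\<close>.\<close>

definition sub_tensor ::
  "'k ring \<Rightarrow> ('k, 'a, 'x) module_scheme \<Rightarrow> ('k, 'b, 'y) module_scheme \<Rightarrow> 'a set \<Rightarrow> 'b set
    \<Rightarrow> ('k, 'a, 'b) tens set"
  where "sub_tensor K V W X Y = lin_span K (tensor_space K V W) {tens K V W x y | x y. x \<in> X \<and> y \<in> Y}"

section \<open>Algebras and first order differential calculi\<close>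

definition unital_algebra :: "'k ring \<Rightarrow> ('k, 'a, 'x) module_scheme \<Rightarrow> bool"
  where "unital_algebra K A \<longleftrightarrow> module K A \<and> ring A \<and>
    (\<forall>c\<in>carrier K. \<forall>x\<in>carrier A. \<forall>y\<in>carrier A.
      c \<odot>\<^bsub>A\<^esub> (x \<otimes>\<^bsub>A\<^esub> y) = (c \<odot>\<^bsub>A\<^esub> x) \<otimes>\<^bsub>A\<^esub> y \<and> c \<odot>\<^bsub>A\<^esub> (x \<otimes>\<^bsub>A\<^esub> y) = x \<otimes>\<^bsub>A\<^esub> (c \<odot>\<^bsub>A\<^esub> y))"

definition tensor_algebra ::
  "'k ring \<Rightarrow> ('k, 'a, 'x) module_scheme \<Rightarrow> ('k, 'b, 'y) module_scheme \<Rightarrow> ('k, ('k, 'a, 'b) tens) module"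
  where "tensor_algebra K A B = (tensor_space K A B)
    \<lparr>mult := (\<lambda>s t. tlift K (tensor_space K A B) (\<lambda>a b.
               tlift K (tensor_space K A B) (\<lambda>a' b'. tens K A B (a \<otimes>\<^bsub>A\<^esub> a') (b \<otimes>\<^bsub>B\<^esub> b')) t) s),
     one := tens K A B \<one>\<^bsub>A\<^esub> \<one>\<^bsub>B\<^esub>\<rparr>"

definition univ_forms :: "'k ring \<Rightarrow> ('k, 'a, 'x) module_scheme \<Rightarrow> ('k, ('k, 'a, 'a) tens) module"
  where "univ_forms K A = (tensor_space K A A)
    \<lparr>carrier := {x \<in> carrier (tensor_space K A A). tlift K A (\<lambda>a b. a \<otimes>\<^bsub>A\<^esub> b) x = \<zero>\<^bsub>A\<^esub>}\<rparr>"

definition univ_d :: "'k ring \<Rightarrow> ('k, 'a, 'x) module_scheme \<Rightarrow> 'a \<Rightarrow> ('k, 'a, 'a) tens"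
  where "univ_d K A a = tens K A A \<one>\<^bsub>A\<^esub> a \<ominus>\<^bsub>tensor_space K A A\<^esub> tens K A A a \<one>\<^bsub>A\<^esub>"

definition lact :: "'k ring \<Rightarrow> ('k, 'a, 'x) module_scheme \<Rightarrow> 'a \<Rightarrow> ('k, 'a, 'a) tens \<Rightarrow> ('k, 'a, 'a) tens"
  where "lact K A a = tlift K (tensor_space K A A) (\<lambda>b c. tens K A A (a \<otimes>\<^bsub>A\<^esub> b) c)"

definition ract :: "'k ring \<Rightarrow> ('k, 'a, 'x) module_scheme \<Rightarrow> ('k, 'a, 'a) tens \<Rightarrow> 'a \<Rightarrow> ('k, 'a, 'a) tens"
  where "ract K A x a = tlift K (tensor_space K A A) (\<lambda>b c. tens K A A b (c \<otimes>\<^bsub>A\<^esub> a)) x"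

definition sub_bimodule :: "'k ring \<Rightarrow> ('k, 'a, 'x) module_scheme \<Rightarrow> ('k, 'a, 'a) tens set \<Rightarrow> bool"
  where "sub_bimodule K A N \<longleftrightarrow> submodule N K (univ_forms K A) \<and>
    (\<forall>a\<in>carrier A. \<forall>x\<in>N. lact K A a x \<in> N \<and> ract K A x a \<in> N)"

definition forms ::
  "'k ring \<Rightarrow> ('k, 'a, 'x) module_scheme \<Rightarrow> ('k, 'a, 'a) tens set \<Rightarrow> ('k, ('k, 'a, 'a) tens set) module"
  where "forms K A N = quotient_module K (univ_forms K A) N"

definition form_proj ::
  "'k ring \<Rightarrow> ('k, 'a, 'x) module_scheme \<Rightarrow> ('k, 'a, 'a) tens set \<Rightarrow> ('k, 'a, 'a) tens
    \<Rightarrow> ('k, 'a, 'a) tens set"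
  where "form_proj K A N x = N +>\<^bsub>univ_forms K A\<^esub> x"

definition form_d ::
  "'k ring \<Rightarrow> ('k, 'a, 'x) module_scheme \<Rightarrow> ('k, 'a, 'a) tens set \<Rightarrow> 'a \<Rightarrow> ('k, 'a, 'a) tens set"
  where "form_d K A N a = form_proj K A N (univ_d K A a)"

definition form_lact ::
  "'k ring \<Rightarrow> ('k, 'a, 'x) module_scheme \<Rightarrow> ('k, 'a, 'a) tens set \<Rightarrow> 'a \<Rightarrow> ('k, 'a, 'a) tens set
    \<Rightarrow> ('k, 'a, 'a) tens set"
  where "form_lact K A N a = induced (\<lambda>x. form_proj K A N (lact K A a x))"

section \<open>Hopf algebras and bicovariant calculi\<close>

record ('k, 'h) hopf = "('k, 'h) module" +
  comult :: "'h \<Rightarrow> ('k, 'h, 'h) tens"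
  counit :: "'h \<Rightarrow> 'k"
  antipode :: "'h \<Rightarrow> 'h"

text \<open>Sweedler notation: \<open>sweedler2 K H U f h\<close> is \<open>f h\<^sub>(\<^sub>1\<^sub>) h\<^sub>(\<^sub>2\<^sub>)\<close>, and
  \<open>sweedler3 K H U f h\<close> is \<open>f h\<^sub>(\<^sub>1\<^sub>) h\<^sub>(\<^sub>2\<^sub>) h\<^sub>(\<^sub>3\<^sub>)\<close>, summation understood, for
  multilinear \<open>f\<close> with values in \<open>U\<close>.\<close>

definition sweedler2 ::
  "'k ring \<Rightarrow> ('k, 'h, 'z) hopf_scheme \<Rightarrow> ('k, 'c, 'y) module_scheme \<Rightarrow> ('h \<Rightarrow> 'h \<Rightarrow> 'c) \<Rightarrow> 'h \<Rightarrow> 'c"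
  where "sweedler2 K H U f h = tlift K U f (comult H h)"

definition sweedler3 ::
  "'k ring \<Rightarrow> ('k, 'h, 'z) hopf_scheme \<Rightarrow> ('k, 'c, 'y) module_scheme \<Rightarrow> ('h \<Rightarrow> 'h \<Rightarrow> 'h \<Rightarrow> 'c) \<Rightarrow> 'h \<Rightarrow> 'c"
  where "sweedler3 K H U f h = sweedler2 K H U (\<lambda>a x. sweedler2 K H U (\<lambda>b c. f a b c) x) h"

definition hopf_algebra :: "'k ring \<Rightarrow> ('k, 'h, 'z) hopf_scheme \<Rightarrow> bool"
  where "hopf_algebra K H \<longleftrightarrow> unital_algebra K H \<and>
    comult H \<in> ring_hom H (tensor_algebra K H H) \<and>
    linear_map K H (tensor_space K H H) (comult H) \<and>
    counit H \<in> ring_hom H K \<and>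
    (\<forall>c\<in>carrier K. \<forall>h\<in>carrier H. counit H (c \<odot>\<^bsub>H\<^esub> h) = c \<otimes>\<^bsub>K\<^esub> counit H h) \<and>
    linear_map K H H (antipode H) \<and>
    (\<forall>h\<in>carrier H.
      (let T = tensor_space K (tensor_space K H H) H;
           t = (\<lambda>a b c. tens K (tensor_space K H H) H (tens K H H a b) c)
       in sweedler2 K H T (\<lambda>x c. sweedler2 K H T (\<lambda>a b. t a b c) x) h
        = sweedler2 K H T (\<lambda>a x. sweedler2 K H T (\<lambda>b c. t a b c) x) h) \<and>
      sweedler2 K H H (\<lambda>a b. counit H a \<odot>\<^bsub>H\<^esub> b) h = h \<and>
      sweedler2 K H H (\<lambda>a b. counit H b \<odot>\<^bsub>H\<^esub> a) h = h \<and>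
      sweedler2 K H H (\<lambda>a b. antipode H a \<otimes>\<^bsub>H\<^esub> b) h = counit H h \<odot>\<^bsub>H\<^esub> \<one>\<^bsub>H\<^esub> \<and>
      sweedler2 K H H (\<lambda>a b. a \<otimes>\<^bsub>H\<^esub> antipode H b) h = counit H h \<odot>\<^bsub>H\<^esub> \<one>\<^bsub>H\<^esub>)"

definition ker_counit :: "'k ring \<Rightarrow> ('k, 'h, 'z) hopf_scheme \<Rightarrow> 'h set"
  where "ker_counit K H = {h \<in> carrier H. counit H h = \<zero>\<^bsub>K\<^esub>}"

definition Ad :: "'k ring \<Rightarrow> ('k, 'h, 'z) hopf_scheme \<Rightarrow> 'h \<Rightarrow> ('k, 'h, 'h) tens"
  where "Ad K H h =
    sweedler3 K H (tensor_space K H H) (\<lambda>a b c. tens K H H b (antipode H a \<otimes>\<^bsub>H\<^esub> c)) h"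

definition bicovariant_ideal :: "'k ring \<Rightarrow> ('k, 'h, 'z) hopf_scheme \<Rightarrow> 'h set \<Rightarrow> bool"
  where "bicovariant_ideal K H Q \<longleftrightarrow> submodule Q K H \<and> Q \<subseteq> ker_counit K H \<and>
    (\<forall>q\<in>Q. \<forall>h\<in>carrier H. q \<otimes>\<^bsub>H\<^esub> h \<in> Q) \<and>
    (\<forall>q\<in>Q. Ad K H q \<in> sub_tensor K H H Q (carrier H))"

text \<open>The map sending \<open>h \<otimes> g\<close> to \<open>h g\<^sub>(\<^sub>1\<^sub>) \<otimes> g\<^sub>(\<^sub>2\<^sub>)\<close> is a bijection of \<open>H \<otimes> H\<close>
  which restricts to one of \<open>\<Omega>\<^sup>1H\<close> with \<open>H \<otimes> ker \<epsilon>\<close>.  The sub-bimodule of \<open>\<Omega>\<^sup>1H\<close> defining the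
  calculus is the one carried to \<open>H \<otimes> Q\<close>, so that it contains \<open>S q\<^sub>(\<^sub>1\<^sub>) \<otimes> q\<^sub>(\<^sub>2\<^sub>)\<close> for \<open>q\<close> in \<open>Q\<close>.\<close>

definition ideal_rels :: "'k ring \<Rightarrow> ('k, 'h, 'z) hopf_scheme \<Rightarrow> 'h set \<Rightarrow> ('k, 'h, 'h) tens set"
  where "ideal_rels K H Q = {x \<in> carrier (tensor_space K H H).
    tlift K (tensor_space K H H)
      (\<lambda>h g. sweedler2 K H (tensor_space K H H) (\<lambda>a b. tens K H H (h \<otimes>\<^bsub>H\<^esub> a) b) g) x
    \<in> sub_tensor K H H (carrier H) Q}"

definition inv_forms :: "'k ring \<Rightarrow> ('k, 'h, 'z) hopf_scheme \<Rightarrow> 'h set \<Rightarrow> ('k, 'h set) module"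
  where "inv_forms K H Q = quotient_module K (H\<lparr>carrier := ker_counit K H\<rparr>) Q"

text \<open>The canonical projection of \<open>ker \<epsilon>\<close> onto its quotient by \<open>Q\<close>, extended to \<open>H\<close> by
  composition with the projection \<open>h \<mapsto> h - \<epsilon>(h) 1\<close> of \<open>H\<close> onto \<open>ker \<epsilon>\<close>.  The extension is
  needed because the Sweedler components to which the projection is applied need not lie in
  \<open>ker \<epsilon>\<close>.\<close>

definition inv_proj :: "'k ring \<Rightarrow> ('k, 'h, 'z) hopf_scheme \<Rightarrow> 'h set \<Rightarrow> 'h \<Rightarrow> 'h set"
  where "inv_proj K H Q h = Q +>\<^bsub>H\<^esub> (h \<ominus>\<^bsub>H\<^esub> (counit H h \<odot>\<^bsub>H\<^esub> \<one>\<^bsub>H\<^esub>))"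

definition inv_Ad :: "'k ring \<Rightarrow> ('k, 'h, 'z) hopf_scheme \<Rightarrow> 'h set \<Rightarrow> 'h set \<Rightarrow> ('k, 'h set, 'h) tens"
  where "inv_Ad K H Q = induced (\<lambda>h. tlift K (tensor_space K (inv_forms K H Q) H)
    (\<lambda>b c. tens K (inv_forms K H Q) H (inv_proj K H Q b) c) (Ad K H h))"

section \<open>The tensor product bundle\<close>

record ('k, 'm, 'h) bundle_data =
  K_of :: "'k ring"
  M_of :: "('k, 'm) module"
  H_of :: "('k, 'h) hopf"
  NM_of :: "('k, 'm, 'm) tens set"
  QH_of :: "'h set"

definition tensor_bundle :: "('k, 'm, 'h) bundle_data \<Rightarrow> bool"
  where "tensor_bundle B \<longleftrightarrow> field (K_of B) \<and>
    unital_algebra (K_of B) (M_of B) \<and>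
    hopf_algebra (K_of B) (H_of B) \<and>
    bij_betw (antipode (H_of B)) (carrier (H_of B)) (carrier (H_of B)) \<and>
    sub_bimodule (K_of B) (M_of B) (NM_of B) \<and>
    bicovariant_ideal (K_of B) (H_of B) (QH_of B)"

type_synonym ('k, 'm, 'h) tot = "('k, 'm, 'h) tens"
type_synonym ('k, 'm, 'h) tot2 = "('k, ('k, 'm, 'h) tot, ('k, 'm, 'h) tot) tens"

definition NH_of :: "('k, 'm, 'h) bundle_data \<Rightarrow> ('k, 'h, 'h) tens set"
  where "NH_of B = ideal_rels (K_of B) (H_of B) (QH_of B)"

definition Omega0 :: "('k, 'm, 'h) bundle_data \<Rightarrow> ('k, 'h set) module"
  where "Omega0 B = inv_forms (K_of B) (H_of B) (QH_of B)"

definition pi0 :: "('k, 'm, 'h) bundle_data \<Rightarrow> 'h \<Rightarrow> 'h set"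
  where "pi0 B = inv_proj (K_of B) (H_of B) (QH_of B)"

definition OmegaM :: "('k, 'm, 'h) bundle_data \<Rightarrow> ('k, ('k, 'm, 'm) tens set) module"
  where "OmegaM B = forms (K_of B) (M_of B) (NM_of B)"

definition P_of :: "('k, 'm, 'h) bundle_data \<Rightarrow> ('k, ('k, 'm, 'h) tot) module"
  where "P_of B = tensor_algebra (K_of B) (M_of B) (H_of B)"

definition PP_of :: "('k, 'm, 'h) bundle_data \<Rightarrow> ('k, ('k, 'm, 'h) tot2) module"
  where "PP_of B = tensor_space (K_of B) (P_of B) (P_of B)"

definition mh :: "('k, 'm, 'h) bundle_data \<Rightarrow> 'm \<Rightarrow> 'h \<Rightarrow> ('k, 'm, 'h) tot"
  where "mh B m h = tens (K_of B) (M_of B) (H_of B) m h"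

text \<open>The identification of \<open>P \<otimes> P\<close> with \<open>M \<otimes> M \<otimes> H \<otimes> H\<close>: \<open>mmhh B m n h g\<close> is the element of
  \<open>P \<otimes> P\<close> written \<open>m \<otimes> n \<otimes> h \<otimes> g\<close>, that is \<open>(m \<otimes> h) \<otimes> (n \<otimes> g)\<close>; and \<open>flip B x y\<close> is
  the one written \<open>x \<otimes> y\<close>, for \<open>x\<close> in \<open>M \<otimes> M\<close> and \<open>y\<close> in \<open>H \<otimes> H\<close>.\<close>

definition mmhh :: "('k, 'm, 'h) bundle_data \<Rightarrow> 'm \<Rightarrow> 'm \<Rightarrow> 'h \<Rightarrow> 'h \<Rightarrow> ('k, 'm, 'h) tot2"
  where "mmhh B m n h g = tens (K_of B) (P_of B) (P_of B) (mh B m h) (mh B n g)"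

definition flip :: "('k, 'm, 'h) bundle_data \<Rightarrow> ('k, 'm, 'm) tens \<Rightarrow> ('k, 'h, 'h) tens \<Rightarrow> ('k, 'm, 'h) tot2"
  where "flip B x y = tlift (K_of B) (PP_of B) (\<lambda>m n.
    tlift (K_of B) (PP_of B) (\<lambda>h g. mmhh B m n h g) y) x"

definition NP_of :: "('k, 'm, 'h) bundle_data \<Rightarrow> ('k, 'm, 'h) tot2 set"
  where "NP_of B = lin_span (K_of B) (PP_of B)
    ({flip B x y | x y. x \<in> NM_of B \<and> y \<in> carrier (tensor_space (K_of B) (H_of B) (H_of B))}
   \<union> {flip B x y | x y. x \<in> carrier (tensor_space (K_of B) (M_of B) (M_of B)) \<and> y \<in> NH_of B}
   \<union> {flip B x y | x y. x \<in> carrier (univ_forms (K_of B) (M_of B)) \<and>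
        y \<in> carrier (univ_forms (K_of B) (H_of B))})"

definition OmegaP :: "('k, 'm, 'h) bundle_data \<Rightarrow> ('k, ('k, 'm, 'h) tot2 set) module"
  where "OmegaP B = forms (K_of B) (P_of B) (NP_of B)"

definition piP :: "('k, 'm, 'h) bundle_data \<Rightarrow> ('k, 'm, 'h) tot2 \<Rightarrow> ('k, 'm, 'h) tot2 set"
  where "piP B = form_proj (K_of B) (P_of B) (NP_of B)"

text \<open>The forms \<open>X \<otimes> 1 \<otimes> h\<close> for \<open>X\<close> in \<open>\<Omega>\<^sup>1(M)\<close>, the space \<open>\<Omega>\<^sup>1(M)P\<close> they span, and the forms
  \<open>1 \<otimes> 1 \<otimes> Y\<close> for \<open>Y\<close> in \<open>\<Omega>\<^sup>1(H)\<close>.\<close>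

definition hor :: "('k, 'm, 'h) bundle_data \<Rightarrow> ('k, 'm, 'm) tens set \<Rightarrow> 'h \<Rightarrow> ('k, 'm, 'h) tot2 set"
  where "hor B X h =
    induced (\<lambda>x. piP B (flip B x (tens (K_of B) (H_of B) (H_of B) \<one>\<^bsub>H_of B\<^esub> h))) X"

definition hor_forms :: "('k, 'm, 'h) bundle_data \<Rightarrow> ('k, 'm, 'h) tot2 set set"
  where "hor_forms B = lin_span (K_of B) (OmegaP B)
    {hor B X h | X h. X \<in> carrier (OmegaM B) \<and> h \<in> carrier (H_of B)}"

definition embH :: "('k, 'm, 'h) bundle_data \<Rightarrow> ('k, 'h, 'h) tens set \<Rightarrow> ('k, 'm, 'h) tot2 set"
  where "embH B = induced (\<lambda>y.
    piP B (flip B (tens (K_of B) (M_of B) (M_of B) \<one>\<^bsub>M_of B\<^esub> \<one>\<^bsub>M_of B\<^esub>) y))"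

subsection \<open>Coactions and the vertical map\<close>

definition coactP :: "('k, 'm, 'h) bundle_data \<Rightarrow> ('k, 'm, 'h) tot \<Rightarrow> ('k, ('k, 'm, 'h) tot, 'h) tens"
  where "coactP B = (let PH = tensor_space (K_of B) (P_of B) (H_of B) in
    tlift (K_of B) PH (\<lambda>m h. sweedler2 (K_of B) (H_of B) PH
      (\<lambda>a b. tens (K_of B) (P_of B) (H_of B) (mh B m a) b) h))"

text \<open>On \<open>\<Omega>\<^sup>1P\<close> one has \<open>\<Sum> p \<otimes> p' = \<Sum> p dp'\<close>, and the coaction induced by \<open>\<Delta>\<^sub>R\<close> is
  \<open>p dp' \<mapsto> p\<^sub>(\<^sub>0\<^sub>) dp'\<^sub>(\<^sub>0\<^sub>) \<otimes> p\<^sub>(\<^sub>1\<^sub>) p'\<^sub>(\<^sub>1\<^sub>)\<close>.\<close>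

definition coactForms ::
  "('k, 'm, 'h) bundle_data \<Rightarrow> ('k, 'm, 'h) tot2 set \<Rightarrow> ('k, ('k, 'm, 'h) tot2 set, 'h) tens"
  where "coactForms B = (let K = K_of B; H = H_of B; P = P_of B; U = tensor_space K (OmegaP B) H in
    induced (tlift K U (\<lambda>p p'.
      tlift K U (\<lambda>a h. tlift K U (\<lambda>b g.
        tens K (OmegaP B) H (piP B (lact K P a (univ_d K P b))) (h \<otimes>\<^bsub>H\<^esub> g))
      (coactP B p')) (coactP B p))))"

definition ver :: "('k, 'm, 'h) bundle_data \<Rightarrow> ('k, 'm, 'h) tot2 \<Rightarrow> ('k, ('k, 'm, 'h) tot, 'h) tens"
  where "ver B = (let K = K_of B; H = H_of B; P = P_of B; PH = tensor_space K P H in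
    tlift K PH (\<lambda>p p'. tlift K PH (\<lambda>q h. tens K P H (p \<otimes>\<^bsub>P\<^esub> q) h) (coactP B p')))"

text \<open>\<open>ver\<close> maps \<open>\<Omega>\<^sup>1P\<close> into \<open>P \<otimes> ker \<epsilon>\<close>, where \<open>pi0\<close> is the canonical projection.\<close>

definition verN :: "('k, 'm, 'h) bundle_data \<Rightarrow> ('k, 'm, 'h) tot2 set \<Rightarrow> ('k, ('k, 'm, 'h) tot, 'h set) tens"
  where "verN B = induced (\<lambda>x. tlift (K_of B) (tensor_space (K_of B) (P_of B) (Omega0 B))
    (\<lambda>p h. tens (K_of B) (P_of B) (Omega0 B) p (pi0 B h)) (ver B x))"

subsection \<open>Connections\<close>

type_synonym ('k, 'm, 'h) conn = "'h set \<Rightarrow> ('k, 'm, 'h) tot2 set"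
type_synonym ('k, 'm, 'h) gauge = "'h set \<Rightarrow> ('k, 'm, 'm) tens set"

definition connection :: "('k, 'm, 'h) bundle_data \<Rightarrow> ('k, 'm, 'h) conn \<Rightarrow> bool"
  where "connection B \<omega> \<longleftrightarrow> (let K = K_of B; H = H_of B; P = P_of B in
    linear_map K (Omega0 B) (OmegaP B) \<omega> \<and>
    (\<forall>v\<in>carrier (Omega0 B).
      tlift K (tensor_space K (OmegaP B) H) (\<lambda>u h. tens K (OmegaP B) H (\<omega> u) h)
        (inv_Ad K H (QH_of B) v) = coactForms B (\<omega> v) \<and>
      verN B (\<omega> v) = tens K P (Omega0 B) \<one>\<^bsub>P\<^esub> v))"

definition Pi_proj :: "('k, 'm, 'h) bundle_data \<Rightarrow> ('k, 'm, 'h) conn \<Rightarrow> ('k, 'm, 'h) tot2 set \<Rightarrow> ('k, 'm, 'h) tot2 set"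
  where "Pi_proj B \<omega> X = tlift (K_of B) (OmegaP B)
    (\<lambda>p v. form_lact (K_of B) (P_of B) (NP_of B) p (\<omega> v)) (verN B X)"

definition strong :: "('k, 'm, 'h) bundle_data \<Rightarrow> ('k, 'm, 'h) conn \<Rightarrow> bool"
  where "strong B \<omega> \<longleftrightarrow> (\<forall>p\<in>carrier (P_of B).
    let dp = form_d (K_of B) (P_of B) (NP_of B) p
    in dp \<ominus>\<^bsub>OmegaP B\<^esub> Pi_proj B \<omega> dp \<in> hor_forms B)"

definition omega_ref :: "('k, 'm, 'h) bundle_data \<Rightarrow> ('k, 'm, 'h) conn"
  where "omega_ref B = (let K = K_of B; H = H_of B in
    induced (\<lambda>v. embH B (form_proj K H (NH_of B)
      (sweedler2 K H (tensor_space K H H) (\<lambda>a b. tens K H H (antipode H a) b) v))))"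

text \<open>\<open>gauge_term B A v\<close> is \<open>\<pi>((S v\<^sub>(\<^sub>1\<^sub>)) \<cdot> A(\<pi> v\<^sub>(\<^sub>2\<^sub>)) \<cdot> v\<^sub>(\<^sub>3\<^sub>))\<close>, with \<open>H\<close> acting on
  \<open>P \<otimes> P\<close> as \<open>1 \<otimes> H \<subseteq> P\<close>, and with the values of \<open>A\<close> lifted to \<open>\<Omega>\<^sup>1M \<otimes> 1 \<otimes> 1\<close>.\<close>

definition gauge_term ::
  "('k, 'm, 'h) bundle_data \<Rightarrow> ('k, 'm, 'h) gauge \<Rightarrow> 'h \<Rightarrow> ('k, 'm, 'h) tot2 set"
  where "gauge_term B A = (let K = K_of B; H = H_of B; P = P_of B; j = (\<lambda>h. mh B \<one>\<^bsub>M_of B\<^esub> h) in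
    sweedler3 K H (OmegaP B) (\<lambda>a b c.
      induced (\<lambda>x. piP B (ract K P (lact K P (j (antipode H a))
          (flip B x (tens K H H \<one>\<^bsub>H\<^esub> \<one>\<^bsub>H\<^esub>))) (j c)))
        (A (pi0 B b))))"

text \<open>Functions are taken extensional on \<open>\<Omega>\<^sub>0\<close>, so that equality of elements of these two sets is
  equality of maps on \<open>\<Omega>\<^sub>0\<close>.\<close>

definition gauge_fields :: "('k, 'm, 'h) bundle_data \<Rightarrow> ('k, 'm, 'h) gauge set"
  where "gauge_fields B =
    {A \<in> extensional (carrier (Omega0 B)). linear_map (K_of B) (Omega0 B) (OmegaM B) A}"

definition connections :: "('k, 'm, 'h) bundle_data \<Rightarrow> ('k, 'm, 'h) conn set"
  where "connections B = {\<omega> \<in> extensional (carrier (Omega0 B)). connection B \<omega>}"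

end

theory Submission
  imports Defs
begin

text \<open>A horizontal form matters only up to \<open>\<Omega>\<^sup>1M \<otimes> \<Omega>\<^sup>1H\<close>, so its component in \<open>H \<otimes> H\<close> may be
  multiplied out.  Hence the form \<open>p dp'\<close> with \<open>p = m \<otimes> h\<close> and \<open>p' = n \<otimes> g\<close> is its projection
  along the reference connection plus \<open>m dn \<otimes> 1 \<otimes> h g\<close>, and the kernel of the vertical map is
  \<open>\<Omega>\<^sup>1(M)P = \<Omega>\<^sup>1(M) \<otimes> H\<close>.  A connection therefore differs from the reference connection by an
  equivariant map from \<open>\<Omega>\<^sub>0\<close> to \<open>\<Omega>\<^sup>1(M) \<otimes> H\<close>.  Since this is a cofree comodule, such a map is
  \<open>v \<mapsto> A(v\<^sub>(\<^sub>0\<^sub>)) \<otimes> v\<^sub>(\<^sub>1\<^sub>)\<close> for a unique linear \<open>A\<close>, which is recovered by applying the counit.\<close>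

section \<open>Linear maps and spans\<close>

text \<open>The maps in the definitions come from \<open>induced\<close> or \<open>tlift\<close>,
  which pick a common value on a coset; nothing can be computed until a map is known to be linear
  and to kill the relations. A second obstacle is that the natural elements lie outside the domains:
  a single \<open>m \<otimes> n \<otimes> h \<otimes> g\<close> need not be a form, and the Sweedler
  legs of an element of the kernel of the counit leave that kernel. Both quotient maps are therefore
  extended, that of forms by sending \<open>a \<otimes> b\<close> to \<open>a db\<close>, that onto
  \<Omega>0 by killing 1, and all claims become multilinear identities on pure tensors. The
  relations that resist are those from \<open>NH\<close> under the diagonal coaction: the antipode
  reverses the coproduct, which turns the coaction of \<open>S q1 \<otimes> q2\<close> into
  \<open>Ad q\<close>, and then Ad-stability of \<open>Q\<close> applies. Forms split by two
  explicit projections, the horizontal one rebuilt from the coaction and the counit. For a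
  connection, the vertical condition fixes one summand and equivariance gives the other its
  shape.\<close>

lemma linear_mapI:
  assumes "\<And>x. x \<in> carrier V \<Longrightarrow> f x \<in> carrier W"
    and "\<And>x y. x \<in> carrier V \<Longrightarrow> y \<in> carrier V \<Longrightarrow> f (x \<oplus>\<^bsub>V\<^esub> y) = f x \<oplus>\<^bsub>W\<^esub> f y"
    and "\<And>c x. c \<in> carrier K \<Longrightarrow> x \<in> carrier V \<Longrightarrow> f (c \<odot>\<^bsub>V\<^esub> x) = c \<odot>\<^bsub>W\<^esub> f x"
  shows "linear_map K V W f"
  using assms by (auto simp: linear_map_def)

lemma linear_map_closed: "linear_map K V W f \<Longrightarrow> x \<in> carrier V \<Longrightarrow> f x \<in> carrier W"
  by (auto simp: linear_map_def)

lemma linear_map_add: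
  "linear_map K V W f \<Longrightarrow> x \<in> carrier V \<Longrightarrow> y \<in> carrier V \<Longrightarrow> f (x \<oplus>\<^bsub>V\<^esub> y) = f x \<oplus>\<^bsub>W\<^esub> f y"
  by (auto simp: linear_map_def)

lemma linear_map_smult:
  "linear_map K V W f \<Longrightarrow> c \<in> carrier K \<Longrightarrow> x \<in> carrier V \<Longrightarrow> f (c \<odot>\<^bsub>V\<^esub> x) = c \<odot>\<^bsub>W\<^esub> f x"
  by (auto simp: linear_map_def)

text \<open>\<open>linear_map\<close> constrains values on the carrier only, so linearity passes
  between an \<open>induced\<close> or restricted map and an explicit formula that agrees with it
  there.\<close>

lemma linear_map_cong:
  assumes "linear_map K V W f" "\<And>x. x \<in> carrier V \<Longrightarrow> f x = g x" "module K V"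
  shows "linear_map K V W g"
proof -
  interpret V: module K V by fact
  show ?thesis
    using assms(1,2) by (auto simp: linear_map_def Pi_def)
qed

lemma linear_map_zero:
  assumes "module K V" "module K W" "linear_map K V W f"
  shows "f \<zero>\<^bsub>V\<^esub> = \<zero>\<^bsub>W\<^esub>"
proof -
  interpret V: module K V by fact
  interpret W: module K W by fact
  have "f \<zero>\<^bsub>V\<^esub> = f (\<zero>\<^bsub>K\<^esub> \<odot>\<^bsub>V\<^esub> \<zero>\<^bsub>V\<^esub>)" by simp
  also have "\<dots> = \<zero>\<^bsub>W\<^esub>"
    by (subst linear_map_smult[OF assms(3)]) (simp_all add: linear_map_closed[OF assms(3)])
  finally show ?thesis .
qed

lemma linear_map_uminus:
  assumes "module K V" "module K W" "linear_map K V W f" "x \<in> carrier V"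
  shows "f (\<ominus>\<^bsub>V\<^esub> x) = \<ominus>\<^bsub>W\<^esub> f x"
proof -
  interpret V: module K V by fact
  interpret W: module K W by fact
  have "f (\<ominus>\<^bsub>V\<^esub> x) \<oplus>\<^bsub>W\<^esub> f x = f (\<ominus>\<^bsub>V\<^esub> x \<oplus>\<^bsub>V\<^esub> x)"
    using linear_map_add[OF assms(3)] assms(4) by simp
  also have "\<dots> = \<zero>\<^bsub>W\<^esub>" using assms(4) linear_map_zero[OF assms(1-3)] by (simp add: V.l_neg)
  finally show ?thesis
    using linear_map_closed[OF assms(3)] assms(4) by (simp add: W.minus_equality)
qed

lemma linear_map_minus:
  assumes "module K V" "module K W" "linear_map K V W f" "x \<in> carrier V" "y \<in> carrier V"
  shows "f (x \<ominus>\<^bsub>V\<^esub> y) = f x \<ominus>\<^bsub>W\<^esub> f y"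
proof -
  interpret V: module K V by fact
  interpret W: module K W by fact
  show ?thesis
    using linear_map_add[OF assms(3), of x "\<ominus>\<^bsub>V\<^esub> y"] linear_map_uminus[OF assms(1-3,5)] assms(4,5)
    by (simp add: a_minus_def)
qed

lemma linear_map_finsum:
  assumes "module K V" "module K W" "linear_map K V W f" "finite I" "x \<in> I \<rightarrow> carrier V"
  shows "f (\<Oplus>\<^bsub>V\<^esub>i\<in>I. x i) = (\<Oplus>\<^bsub>W\<^esub>i\<in>I. f (x i))"
proof -
  interpret V: module K V by fact
  interpret W: module K W by fact
  show ?thesis using assms(4,5)
  proof (induction I rule: finite_induct)
    case empty
    then show ?case using linear_map_zero[OF assms(1-3)] by simp
  next
    case (insert i I)
    then have "(\<lambda>i. f (x i)) \<in> I \<rightarrow> carrier W" "f (x i) \<in> carrier W"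
      using linear_map_closed[OF assms(3)] by auto
    with insert show ?case
      using linear_map_add[OF assms(3)] by (auto simp: Pi_def)
  qed
qed

lemma linear_map_comp:
  "linear_map K W U g \<Longrightarrow> linear_map K V W f \<Longrightarrow> linear_map K V U (\<lambda>x. g (f x))"
  by (auto simp: linear_map_def Pi_def)

lemma linear_map_id: "linear_map K V V (\<lambda>x. x)"
  by (auto simp: linear_map_def)

lemma linear_map_const_zero:
  assumes "module K W" shows "linear_map K V W (\<lambda>x. \<zero>\<^bsub>W\<^esub>)"
proof -
  interpret W: module K W by fact
  show ?thesis by (auto simp: linear_map_def)
qed

lemma linear_map_plus:
  assumes "module K W" "linear_map K V W f" "linear_map K V W g"
  shows "linear_map K V W (\<lambda>x. f x \<oplus>\<^bsub>W\<^esub> g x)"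
proof -
  interpret W: module K W by fact
  show ?thesis
    using assms(2,3) by (auto simp: linear_map_def Pi_def W.smult_r_distr W.M.a_ac)
qed

lemma linear_map_const_smult:
  assumes "module K W" "c \<in> carrier K" "linear_map K V W f"
  shows "linear_map K V W (\<lambda>x. c \<odot>\<^bsub>W\<^esub> f x)"
proof -
  interpret W: module K W by fact
  show ?thesis
    using assms(2,3)
    by (auto simp: linear_map_def Pi_def W.smult_r_distr W.smult_assoc1[symmetric] W.R.m_comm)
qed

lemma linear_map_neg:
  assumes "module K W" "linear_map K V W f"
  shows "linear_map K V W (\<lambda>x. \<ominus>\<^bsub>W\<^esub> f x)"
proof -
  interpret W: module K W by fact
  show ?thesis
    using assms(2) by (auto simp: linear_map_def Pi_def W.smult_r_minus W.minus_add)
qed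

lemma linear_map_diff:
  assumes "module K W" "linear_map K V W f" "linear_map K V W g"
  shows "linear_map K V W (\<lambda>x. f x \<ominus>\<^bsub>W\<^esub> g x)"
  unfolding a_minus_def by (intro linear_map_plus linear_map_neg assms)

lemma submodule_zero_closed:
  assumes "module K V" "submodule N K V" shows "\<zero>\<^bsub>V\<^esub> \<in> N"
  using subgroup.one_closed[OF submodule.axioms(1)[OF assms(2)]] by simp

lemma submodule_preimage:
  assumes "module K V" "module K W" "linear_map K V W f" "submodule N K W"
  shows "submodule {x \<in> carrier V. f x \<in> N} K V"
proof -
  interpret V: module K V by fact
  interpret W: module K W by fact
  show ?thesis
    using W.submoduleE[OF assms(4)] submodule_zero_closed[OF assms(2,4)] linear_map_zero[OF assms(1-3)]
      linear_map_uminus[OF assms(1-3)] linear_map_add[OF assms(3)] linear_map_smult[OF assms(3)]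
    by (intro V.submoduleI) auto
qed

lemma zero_submodule:
  assumes "module K V" shows "submodule {\<zero>\<^bsub>V\<^esub>} K V"
proof -
  interpret V: module K V by fact
  show ?thesis by (intro V.submoduleI) auto
qed

lemma lin_span_submodule:
  assumes "module K V" "X \<subseteq> carrier V"
  shows "submodule (lin_span K V X) K V"
proof -
  interpret V: module K V by fact
  have sub: "lin_span K V X \<subseteq> carrier V"
    unfolding lin_span_def using V.carrier_is_submodule assms(2) by (intro hull_minimal) auto
  show ?thesis
  proof (rule V.submoduleI[OF sub])
    show "\<zero>\<^bsub>V\<^esub> \<in> lin_span K V X"
      using submodule_zero_closed[OF assms(1)] by (auto simp: lin_span_def hull_def)
  next
    fix a b assume "a \<in> lin_span K V X" "b \<in> lin_span K V X"
    then show "a \<oplus>\<^bsub>V\<^esub> b \<in> lin_span K V X"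
      using V.submoduleE(5) by (auto simp: lin_span_def hull_def)
  next
    fix a assume "a \<in> lin_span K V X"
    then show "\<ominus>\<^bsub>V\<^esub> a \<in> lin_span K V X"
      using V.submoduleE(3) by (auto simp: lin_span_def hull_def)
  next
    fix c x assume "c \<in> carrier K" "x \<in> lin_span K V X"
    then show "c \<odot>\<^bsub>V\<^esub> x \<in> lin_span K V X"
      using V.submoduleE(4) by (auto simp: lin_span_def hull_def)
  qed
qed

lemma lin_span_inc: "x \<in> X \<Longrightarrow> x \<in> lin_span K V X"
  by (simp add: lin_span_def hull_inc)

lemma lin_span_minimal: "X \<subseteq> N \<Longrightarrow> submodule N K V \<Longrightarrow> lin_span K V X \<subseteq> N"
  by (simp add: lin_span_def hull_minimal)

text \<open>The preimage of \<open>N\<close> is a submodule containing the generators, hence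
  contains their hull. Vanishing on a space of relations is the case of the zero submodule.\<close>

lemma linear_map_lin_span:
  assumes "module K V" "module K W" "linear_map K V W f" "submodule N K W" "X \<subseteq> carrier V"
    and "\<And>x. x \<in> X \<Longrightarrow> f x \<in> N" and "x \<in> lin_span K V X"
  shows "f x \<in> N"
proof -
  have "lin_span K V X \<subseteq> {x \<in> carrier V. f x \<in> N}"
    using assms(5,6) by (intro lin_span_minimal submodule_preimage[OF assms(1-4)]) auto
  then show ?thesis using assms(7) by auto
qed

lemma linear_map_lin_span_zero:
  assumes "module K V" "module K W" "linear_map K V W f" "X \<subseteq> carrier V"
    and "\<And>x. x \<in> X \<Longrightarrow> f x = \<zero>\<^bsub>W\<^esub>" and "x \<in> lin_span K V X"
  shows "f x = \<zero>\<^bsub>W\<^esub>"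
  using linear_map_lin_span[OF assms(1-3) zero_submodule[OF assms(2)] assms(4) _ assms(6)] assms(5)
  by auto

text \<open>Prepared for the final formula: \<open>v\<close> will be the vertical part shared by a
  form and its projection, \<open>d\<close> the term with \<open>m dn\<close>, \<open>g\<close> the
  term with the gauge field.\<close>

lemma (in abelian_group) add_minus_add_cancel:
  assumes "v \<in> carrier G" "d \<in> carrier G" "g \<in> carrier G"
  shows "(v \<oplus> d) \<ominus> (v \<oplus> g) = \<ominus> g \<oplus> d"
proof -
  have "(v \<oplus> d) \<ominus> (v \<oplus> g) = (v \<oplus> \<ominus> v) \<oplus> (\<ominus> g \<oplus> d)"
    using assms by (simp add: a_minus_def minus_add a_ac)
  then show ?thesis using assms by (simp add: r_neg)
qed

section \<open>Quotients\<close>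

lemma submodule_abelian_subgroup:
  assumes "module K V" "submodule N K V"
  shows "abelian_subgroup N V"
proof -
  interpret V: module K V by fact
  have "additive_subgroup N V" using assms(2) by (simp add: additive_subgroup_def submodule_def)
  then show ?thesis by (rule abelian_subgroupI3) unfold_locales
qed

lemma mem_coset_iff:
  assumes "module K V" "submodule N K V" "x \<in> carrier V"
  shows "y \<in> N +>\<^bsub>V\<^esub> x \<longleftrightarrow> y \<in> carrier V \<and> y \<ominus>\<^bsub>V\<^esub> x \<in> N"
proof -
  interpret V: module K V by fact
  interpret N: abelian_subgroup N V by (rule submodule_abelian_subgroup[OF assms(1,2)])
  show ?thesis
    using N.a_rcos_module[OF assms(3)] N.a_elemrcos_carrier[OF assms(3)] by (auto simp: a_minus_def)
qed

lemma coset_eq_iff: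
  assumes "module K V" "submodule N K V" "x \<in> carrier V" "y \<in> carrier V"
  shows "N +>\<^bsub>V\<^esub> x = N +>\<^bsub>V\<^esub> y \<longleftrightarrow> x \<ominus>\<^bsub>V\<^esub> y \<in> N"
proof -
  interpret V: module K V by fact
  interpret N: abelian_subgroup N V by (rule submodule_abelian_subgroup[OF assms(1,2)])
  show ?thesis
    using mem_coset_iff[OF assms(1,2,4), of x] assms(3,4) N.a_repr_independence'[of x y]
      N.a_repr_independenceD[of x y] by auto
qed

lemma coset_zero_iff:
  assumes "module K V" "submodule N K V" "x \<in> carrier V"
  shows "N +>\<^bsub>V\<^esub> x = N \<longleftrightarrow> x \<in> N"
proof -
  interpret V: module K V by fact
  have "N +>\<^bsub>V\<^esub> \<zero>\<^bsub>V\<^esub> = N" using V.submoduleE(1)[OF assms(2)] by simp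
  moreover have "x \<ominus>\<^bsub>V\<^esub> \<zero>\<^bsub>V\<^esub> = x"
    using assms(3) V.M.add.inv_one by (simp add: a_minus_def)
  ultimately show ?thesis using coset_eq_iff[OF assms V.zero_closed] by simp
qed

lemma carrier_quotient: "carrier (quotient_module K V N) = (\<lambda>x. N +>\<^bsub>V\<^esub> x) ` carrier V"
  by (auto simp: quotient_module_def A_RCOSETS_def RCOSETS_def a_r_coset_def)

lemma zero_quotient: "\<zero>\<^bsub>quotient_module K V N\<^esub> = N"
  by (simp add: quotient_module_def)

lemma add_quotient:
  assumes "module K V" "submodule N K V" "x \<in> carrier V" "y \<in> carrier V"
  shows "(N +>\<^bsub>V\<^esub> x) \<oplus>\<^bsub>quotient_module K V N\<^esub> (N +>\<^bsub>V\<^esub> y) = N +>\<^bsub>V\<^esub> (x \<oplus>\<^bsub>V\<^esub> y)"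
proof -
  interpret N: abelian_subgroup N V by (rule submodule_abelian_subgroup[OF assms(1,2)])
  show ?thesis using N.a_rcos_sum[OF assms(3,4)] by (simp add: quotient_module_def)
qed

text \<open>Scalar multiplication on the quotient is a union over all representatives; the result is
  one coset because the cosets in that union coincide.\<close>

lemma smult_quotient:
  assumes "module K V" "submodule N K V" "c \<in> carrier K" "x \<in> carrier V"
  shows "c \<odot>\<^bsub>quotient_module K V N\<^esub> (N +>\<^bsub>V\<^esub> x) = N +>\<^bsub>V\<^esub> (c \<odot>\<^bsub>V\<^esub> x)"
proof -
  interpret V: module K V by fact
  interpret N: abelian_subgroup N V by (rule submodule_abelian_subgroup[OF assms(1,2)])
  have "N +>\<^bsub>V\<^esub> (c \<odot>\<^bsub>V\<^esub> y) = N +>\<^bsub>V\<^esub> (c \<odot>\<^bsub>V\<^esub> x)" if "y \<in> N +>\<^bsub>V\<^esub> x" for y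
  proof -
    have y: "y \<in> carrier V" "y \<ominus>\<^bsub>V\<^esub> x \<in> N" using that mem_coset_iff[OF assms(1,2,4)] by auto
    have "c \<odot>\<^bsub>V\<^esub> y \<ominus>\<^bsub>V\<^esub> c \<odot>\<^bsub>V\<^esub> x = c \<odot>\<^bsub>V\<^esub> (y \<ominus>\<^bsub>V\<^esub> x)"
      using y assms by (simp add: a_minus_def V.smult_r_distr V.smult_r_minus)
    also have "\<dots> \<in> N" using V.submoduleE(4)[OF assms(2)] y assms by simp
    finally show ?thesis using coset_eq_iff[OF assms(1,2)] y assms by simp
  qed
  moreover have "x \<in> N +>\<^bsub>V\<^esub> x" using N.a_rcos_self assms(4) by simp
  ultimately have "(\<Union>y\<in>N +>\<^bsub>V\<^esub> x. N +>\<^bsub>V\<^esub> (c \<odot>\<^bsub>V\<^esub> y)) = N +>\<^bsub>V\<^esub> (c \<odot>\<^bsub>V\<^esub> x)" by blast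
  then show ?thesis by (simp add: quotient_module_def)
qed

lemma module_quotient:
  assumes "module K V" "submodule N K V"
  shows "module K (quotient_module K V N)"
proof -
  interpret V: module K V by fact
  have zero: "\<zero>\<^bsub>quotient_module K V N\<^esub> = N +>\<^bsub>V\<^esub> \<zero>\<^bsub>V\<^esub>"
    using coset_zero_iff[OF assms V.zero_closed] submodule_zero_closed[OF assms]
    by (simp add: quotient_module_def)
  note [simp] = add_quotient[OF assms] smult_quotient[OF assms] zero
  show ?thesis
  proof (rule moduleI)
    show "abelian_group (quotient_module K V N)"
    proof (rule abelian_groupI)
      fix x assume x: "x \<in> carrier (quotient_module K V N)"
      then obtain x' where x': "x' \<in> carrier V" "x = N +>\<^bsub>V\<^esub> x'" by (auto simp: carrier_quotient)
      then have "(N +>\<^bsub>V\<^esub> (\<ominus>\<^bsub>V\<^esub> x')) \<oplus>\<^bsub>quotient_module K V N\<^esub> x = \<zero>\<^bsub>quotient_module K V N\<^esub>"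
        by (simp add: V.l_neg)
      then show "\<exists>y\<in>carrier (quotient_module K V N).
          y \<oplus>\<^bsub>quotient_module K V N\<^esub> x = \<zero>\<^bsub>quotient_module K V N\<^esub>"
        using x' by (auto simp: carrier_quotient)
      show "\<zero>\<^bsub>quotient_module K V N\<^esub> \<oplus>\<^bsub>quotient_module K V N\<^esub> x = x"
        using x' by simp
      fix y assume "y \<in> carrier (quotient_module K V N)"
      then obtain y' where y': "y' \<in> carrier V" "y = N +>\<^bsub>V\<^esub> y'" by (auto simp: carrier_quotient)
      show "x \<oplus>\<^bsub>quotient_module K V N\<^esub> y \<in> carrier (quotient_module K V N)"
        using x' y' by (simp add: carrier_quotient)
      show "x \<oplus>\<^bsub>quotient_module K V N\<^esub> y = y \<oplus>\<^bsub>quotient_module K V N\<^esub> x"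
        using x' y' by (simp add: V.M.a_comm)
      fix z assume "z \<in> carrier (quotient_module K V N)"
      then obtain z' where z': "z' \<in> carrier V" "z = N +>\<^bsub>V\<^esub> z'" by (auto simp: carrier_quotient)
      show "x \<oplus>\<^bsub>quotient_module K V N\<^esub> y \<oplus>\<^bsub>quotient_module K V N\<^esub> z
          = x \<oplus>\<^bsub>quotient_module K V N\<^esub> (y \<oplus>\<^bsub>quotient_module K V N\<^esub> z)"
        using x' y' z' by (simp add: V.M.a_assoc)
    qed (simp add: carrier_quotient)
  qed (auto simp: carrier_quotient V.smult_l_distr V.smult_r_distr V.smult_assoc1 V.R.is_cring)
qed

lemma linear_map_coset:
  assumes "module K V" "submodule N K V"
  shows "linear_map K V (quotient_module K V N) (\<lambda>x. N +>\<^bsub>V\<^esub> x)"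
  by (rule linear_mapI) (auto simp: carrier_quotient add_quotient[OF assms] smult_quotient[OF assms])

text \<open>\<open>the_elem\<close> returns the intended value only if the image of the coset is a
  singleton; vanishing of \<open>f\<close> on \<open>N\<close> provides this.\<close>

lemma induced_coset:
  assumes "module K V" "submodule N K V" "module K U" "linear_map K V U f"
    and "\<And>x. x \<in> N \<Longrightarrow> f x = \<zero>\<^bsub>U\<^esub>" and "x \<in> carrier V"
  shows "induced f (N +>\<^bsub>V\<^esub> x) = f x"
proof -
  interpret V: module K V by fact
  interpret U: module K U by fact
  interpret N: abelian_subgroup N V by (rule submodule_abelian_subgroup[OF assms(1,2)])
  have "f y = f x" if "y \<in> N +>\<^bsub>V\<^esub> x" for y
  proof -
    have y: "y \<in> carrier V" "y \<ominus>\<^bsub>V\<^esub> x \<in> N" using that mem_coset_iff[OF assms(1,2,6)] by auto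
    have "f y \<ominus>\<^bsub>U\<^esub> f x = \<zero>\<^bsub>U\<^esub>"
      using linear_map_minus[OF assms(1,3,4) y(1) assms(6)] assms(5)[OF y(2)] by simp
    then show ?thesis
      using linear_map_closed[OF assms(4)] y assms(6) U.M.minus_equality[of "f y" "\<ominus>\<^bsub>U\<^esub> f x"]
      by (simp add: a_minus_def)
  qed
  moreover have "x \<in> N +>\<^bsub>V\<^esub> x" using N.a_rcos_self assms(6) by simp
  ultimately have "f ` (N +>\<^bsub>V\<^esub> x) = {f x}" by blast
  then show ?thesis by (simp add: induced_def)
qed

lemma linear_map_induced:
  assumes "module K V" "submodule N K V" "module K U" "linear_map K V U f"
    and "\<And>x. x \<in> N \<Longrightarrow> f x = \<zero>\<^bsub>U\<^esub>"
  shows "linear_map K (quotient_module K V N) U (induced f)"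
proof -
  interpret V: module K V by fact
  note [simp] = induced_coset[OF assms] add_quotient[OF assms(1,2)] smult_quotient[OF assms(1,2)]
  show ?thesis
    by (rule linear_mapI) (auto simp: carrier_quotient linear_map_closed[OF assms(4)]
      linear_map_add[OF assms(4)] linear_map_smult[OF assms(4)])
qed

section \<open>Free modules\<close>

lemma free_module_carrier_iff:
  "f \<in> carrier (free_module K X) \<longleftrightarrow>
    (\<forall>x\<in>X. f x \<in> carrier K) \<and> (\<forall>x. x \<notin> X \<longrightarrow> f x = \<zero>\<^bsub>K\<^esub>) \<and> finite {x. f x \<noteq> \<zero>\<^bsub>K\<^esub>}"
  by (simp add: free_module_def)

lemma free_module_value:
  assumes "cring K" "f \<in> carrier (free_module K X)" shows "f x \<in> carrier K"
proof -
  interpret K: cring K by fact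
  show ?thesis using assms(2) by (cases "x \<in> X") (auto simp: free_module_carrier_iff)
qed

lemma free_module_add: "x \<oplus>\<^bsub>free_module K X\<^esub> y = (\<lambda>p. x p \<oplus>\<^bsub>K\<^esub> y p)"
  and free_module_smult: "c \<odot>\<^bsub>free_module K X\<^esub> x = (\<lambda>p. c \<otimes>\<^bsub>K\<^esub> x p)"
  and free_module_zero: "\<zero>\<^bsub>free_module K X\<^esub> = (\<lambda>p. \<zero>\<^bsub>K\<^esub>)"
  by (simp_all add: free_module_def)

lemma free_module_add_closed:
  assumes "cring K" "x \<in> carrier (free_module K X)" "y \<in> carrier (free_module K X)"
  shows "(\<lambda>p. x p \<oplus>\<^bsub>K\<^esub> y p) \<in> carrier (free_module K X)"
proof -
  interpret K: cring K by fact
  have "{p. x p \<oplus>\<^bsub>K\<^esub> y p \<noteq> \<zero>\<^bsub>K\<^esub>} \<subseteq> {p. x p \<noteq> \<zero>\<^bsub>K\<^esub>} \<union> {p. y p \<noteq> \<zero>\<^bsub>K\<^esub>}" by auto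
  then have "finite {p. x p \<oplus>\<^bsub>K\<^esub> y p \<noteq> \<zero>\<^bsub>K\<^esub>}"
    by (rule finite_subset) (use assms in \<open>auto simp: free_module_carrier_iff\<close>)
  with assms show ?thesis by (auto simp: free_module_carrier_iff)
qed

lemma free_module_smult_closed:
  assumes "cring K" "c \<in> carrier K" "x \<in> carrier (free_module K X)"
  shows "(\<lambda>p. c \<otimes>\<^bsub>K\<^esub> x p) \<in> carrier (free_module K X)"
proof -
  interpret K: cring K by fact
  have "{p. c \<otimes>\<^bsub>K\<^esub> x p \<noteq> \<zero>\<^bsub>K\<^esub>} \<subseteq> {p. x p \<noteq> \<zero>\<^bsub>K\<^esub>}" using assms(2) by auto
  then have "finite {p. c \<otimes>\<^bsub>K\<^esub> x p \<noteq> \<zero>\<^bsub>K\<^esub>}"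
    by (rule finite_subset) (use assms in \<open>auto simp: free_module_carrier_iff\<close>)
  with assms show ?thesis by (auto simp: free_module_carrier_iff)
qed

lemma module_free_module:
  assumes "cring K" shows "module K (free_module K X)"
proof -
  interpret K: cring K by fact
  note val = free_module_value[OF assms, of _ X]
  show ?thesis
  proof (rule moduleI)
    show "abelian_group (free_module K X)"
    proof (rule abelian_groupI)
      fix x assume x: "x \<in> carrier (free_module K X)"
      have "(\<lambda>p. \<ominus>\<^bsub>K\<^esub> \<one>\<^bsub>K\<^esub> \<otimes>\<^bsub>K\<^esub> x p) \<in> carrier (free_module K X)"
        by (rule free_module_smult_closed[OF assms _ x]) simp
      moreover have "(\<lambda>p. \<ominus>\<^bsub>K\<^esub> \<one>\<^bsub>K\<^esub> \<otimes>\<^bsub>K\<^esub> x p) \<oplus>\<^bsub>free_module K X\<^esub> x = \<zero>\<^bsub>free_module K X\<^esub>"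
        using val[OF x] by (simp add: free_module_add free_module_zero K.l_minus K.l_neg)
      ultimately show "\<exists>y\<in>carrier (free_module K X). y \<oplus>\<^bsub>free_module K X\<^esub> x = \<zero>\<^bsub>free_module K X\<^esub>"
        by blast
    next
      show "\<zero>\<^bsub>free_module K X\<^esub> \<in> carrier (free_module K X)"
        by (simp add: free_module_zero free_module_carrier_iff)
    qed (simp_all add: free_module_add free_module_zero free_module_add_closed assms val K.a_ac)
  qed (auto simp: free_module_add free_module_smult assms free_module_smult_closed val
      K.l_distr K.r_distr K.m_assoc)
qed

lemma free_gen_closed:
  assumes "cring K" "p \<in> X" shows "free_gen K p \<in> carrier (free_module K X)"
proof -
  interpret K: cring K by fact
  have "finite {x. free_gen K p x \<noteq> \<zero>\<^bsub>K\<^esub>}"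
    by (rule finite_subset[of _ "{p}"]) (auto simp: free_gen_def)
  then show ?thesis using assms(2) by (auto simp: free_module_carrier_iff free_gen_def)
qed

lemma free_module_induct [consumes 2, case_names zero add gen]:
  assumes "cring K" "x \<in> carrier (free_module K X)"
    and zero: "P (\<lambda>p. \<zero>\<^bsub>K\<^esub>)"
    and add: "\<And>x y. x \<in> carrier (free_module K X) \<Longrightarrow> y \<in> carrier (free_module K X) \<Longrightarrow> P x \<Longrightarrow> P y \<Longrightarrow>
      P (\<lambda>p. x p \<oplus>\<^bsub>K\<^esub> y p)"
    and gen: "\<And>c p. c \<in> carrier K \<Longrightarrow> p \<in> X \<Longrightarrow> P (\<lambda>q. c \<otimes>\<^bsub>K\<^esub> free_gen K p q)"
  shows "P x"
proof -
  interpret K: cring K by fact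
  have "finite S \<Longrightarrow> x \<in> carrier (free_module K X) \<Longrightarrow> {p. x p \<noteq> \<zero>\<^bsub>K\<^esub>} = S \<Longrightarrow> P x" for S x
  proof (induction S arbitrary: x rule: finite_induct)
    case empty
    then have "x = (\<lambda>p. \<zero>\<^bsub>K\<^esub>)" by auto
    with zero show ?case by simp
  next
    case (insert p S)
    note val = free_module_value[OF assms(1) insert.prems(1)]
    have p: "p \<in> X" using insert.prems by (auto simp: free_module_carrier_iff)
    \<comment> \<open>\<open>?y\<close> drops the point \<open>p\<close> from the support, and
      \<open>?g\<close> restores the value there.\<close>
    let ?y = "x(p := \<zero>\<^bsub>K\<^esub>)" and ?g = "\<lambda>q. x p \<otimes>\<^bsub>K\<^esub> free_gen K p q"
    have supp: "{q. ?y q \<noteq> \<zero>\<^bsub>K\<^esub>} = S" using insert.prems(2) insert.hyps by auto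
    then have y: "?y \<in> carrier (free_module K X)"
      using insert.prems(1) insert.hyps(1) p by (auto simp: free_module_carrier_iff)
    have g: "?g \<in> carrier (free_module K X)"
      by (intro free_module_smult_closed free_gen_closed assms(1) val p)
    have "P (\<lambda>q. ?y q \<oplus>\<^bsub>K\<^esub> ?g q)"
      by (rule add[OF y g insert.IH[OF y supp] gen[OF val p]])
    moreover have "(\<lambda>q. ?y q \<oplus>\<^bsub>K\<^esub> ?g q) = x"
      using val by (auto simp: free_gen_def)
    ultimately show ?case by simp
  qed
  then show ?thesis using assms(2) by (auto simp: free_module_carrier_iff)
qed

text \<open>The formula on representatives inside \<open>tlift\<close>, for an arbitrary function on
  generators; folding with \<open>free_lift_def[symmetric]\<close> exposes it.\<close>

definition free_lift ::
  "'k ring \<Rightarrow> ('k, 'c, 'z) module_scheme \<Rightarrow> ('a \<Rightarrow> 'c) \<Rightarrow> ('a \<Rightarrow> 'k) \<Rightarrow> 'c"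
  where "free_lift K U g x = (\<Oplus>\<^bsub>U\<^esub>p\<in>{p. x p \<noteq> \<zero>\<^bsub>K\<^esub>}. x p \<odot>\<^bsub>U\<^esub> g p)"

text \<open>Supports shrink when coefficients cancel, so the lifts of \<open>x\<close>,
  \<open>y\<close> and their sum are compared over one common index set.\<close>

lemma free_lift_superset:
  assumes "module K U" "g \<in> X \<rightarrow> carrier U" "x \<in> carrier (free_module K X)"
    and "finite S" "S \<subseteq> X" "{p. x p \<noteq> \<zero>\<^bsub>K\<^esub>} \<subseteq> S"
  shows "free_lift K U g x = (\<Oplus>\<^bsub>U\<^esub>p\<in>S. x p \<odot>\<^bsub>U\<^esub> g p)"
proof -
  interpret U: module K U by fact
  have cl: "x p \<odot>\<^bsub>U\<^esub> g p \<in> carrier U" if "p \<in> X" for p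
    using that free_module_value[OF U.R.is_cring assms(3)] assms(2) by auto
  show ?thesis unfolding free_lift_def
  proof (rule U.M.add.finprod_mono_neutral_cong_left)
    show "\<And>p. p \<in> S - {p. x p \<noteq> \<zero>\<^bsub>K\<^esub>} \<Longrightarrow> x p \<odot>\<^bsub>U\<^esub> g p = \<zero>\<^bsub>U\<^esub>"
      using assms(2,5) by (auto simp: Pi_def subset_eq)
  qed (use assms cl in auto)
qed

lemma linear_map_free_lift:
  assumes "module K U" "g \<in> X \<rightarrow> carrier U"
  shows "linear_map K (free_module K X) U (free_lift K U g)"
proof -
  interpret U: module K U by fact
  note val = free_module_value[OF U.R.is_cring, of _ X]
  have cl: "x p \<odot>\<^bsub>U\<^esub> g p \<in> carrier U" if "p \<in> X" "x \<in> carrier (free_module K X)" for p x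
    using that val assms(2) by auto
  show ?thesis
  proof (rule linear_mapI)
    fix x assume x: "x \<in> carrier (free_module K X)"
    then have "finite {p. x p \<noteq> \<zero>\<^bsub>K\<^esub>}" "{p. x p \<noteq> \<zero>\<^bsub>K\<^esub>} \<subseteq> X" by (auto simp: free_module_carrier_iff)
    note fx = this
    show "free_lift K U g x \<in> carrier U"
      unfolding free_lift_def using fx x cl by (intro U.M.finsum_closed) auto
    {
      fix y assume y: "y \<in> carrier (free_module K X)"
      then have "finite {p. y p \<noteq> \<zero>\<^bsub>K\<^esub>}" "{p. y p \<noteq> \<zero>\<^bsub>K\<^esub>} \<subseteq> X" by (auto simp: free_module_carrier_iff)
      note fy = this
      let ?S = "{p. x p \<noteq> \<zero>\<^bsub>K\<^esub>} \<union> {p. y p \<noteq> \<zero>\<^bsub>K\<^esub>}"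
      have S: "finite ?S" "?S \<subseteq> X" using fx fy by auto
      have xy: "(\<lambda>p. x p \<oplus>\<^bsub>K\<^esub> y p) \<in> carrier (free_module K X)"
        by (rule free_module_add_closed[OF U.R.is_cring x y])
      have "free_lift K U g (\<lambda>p. x p \<oplus>\<^bsub>K\<^esub> y p) = (\<Oplus>\<^bsub>U\<^esub>p\<in>?S. (x p \<oplus>\<^bsub>K\<^esub> y p) \<odot>\<^bsub>U\<^esub> g p)"
        by (rule free_lift_superset[OF assms xy S]) auto
      also have "\<dots> = (\<Oplus>\<^bsub>U\<^esub>p\<in>?S. x p \<odot>\<^bsub>U\<^esub> g p \<oplus>\<^bsub>U\<^esub> y p \<odot>\<^bsub>U\<^esub> g p)"
        using S assms(2) cl x y val by (intro U.M.finsum_cong') (auto intro!: U.smult_l_distr)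
      also have "\<dots> = (\<Oplus>\<^bsub>U\<^esub>p\<in>?S. x p \<odot>\<^bsub>U\<^esub> g p) \<oplus>\<^bsub>U\<^esub> (\<Oplus>\<^bsub>U\<^esub>p\<in>?S. y p \<odot>\<^bsub>U\<^esub> g p)"
        using S cl x y by (intro U.M.finsum_addf) auto
      also have "\<dots> = free_lift K U g x \<oplus>\<^bsub>U\<^esub> free_lift K U g y"
        using free_lift_superset[OF assms x S] free_lift_superset[OF assms y S] by auto
      finally show "free_lift K U g (x \<oplus>\<^bsub>free_module K X\<^esub> y)
          = free_lift K U g x \<oplus>\<^bsub>U\<^esub> free_lift K U g y"
        by (simp add: free_module_add)
    }
    fix c assume c: "c \<in> carrier K"
    have cx: "(\<lambda>p. c \<otimes>\<^bsub>K\<^esub> x p) \<in> carrier (free_module K X)"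
      by (rule free_module_smult_closed[OF U.R.is_cring c x])
    have "free_lift K U g (\<lambda>p. c \<otimes>\<^bsub>K\<^esub> x p) = (\<Oplus>\<^bsub>U\<^esub>p\<in>{p. x p \<noteq> \<zero>\<^bsub>K\<^esub>}. (c \<otimes>\<^bsub>K\<^esub> x p) \<odot>\<^bsub>U\<^esub> g p)"
      by (rule free_lift_superset[OF assms cx fx]) (use c in auto)
    also have "\<dots> = (\<Oplus>\<^bsub>U\<^esub>p\<in>{p. x p \<noteq> \<zero>\<^bsub>K\<^esub>}. c \<odot>\<^bsub>U\<^esub> (x p \<odot>\<^bsub>U\<^esub> g p))"
      using fx assms(2) cl x c val by (intro U.M.finsum_cong') (auto intro!: U.smult_assoc1)
    also have "\<dots> = c \<odot>\<^bsub>U\<^esub> free_lift K U g x"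
      unfolding free_lift_def using fx cl x c by (intro U.finsum_smult_ldistr[symmetric]) auto
    finally show "free_lift K U g (c \<odot>\<^bsub>free_module K X\<^esub> x) = c \<odot>\<^bsub>U\<^esub> free_lift K U g x"
      by (simp add: free_module_smult)
  qed
qed

lemma free_lift_gen:
  assumes "module K U" "g \<in> X \<rightarrow> carrier U" "p \<in> X"
  shows "free_lift K U g (free_gen K p) = g p"
proof -
  interpret U: module K U by fact
  have "free_lift K U g (free_gen K p) = (\<Oplus>\<^bsub>U\<^esub>q\<in>{p}. free_gen K p q \<odot>\<^bsub>U\<^esub> g q)"
    by (rule free_lift_superset[OF assms(1,2) free_gen_closed[OF U.R.is_cring assms(3)]])
      (use assms(3) in \<open>auto simp: free_gen_def\<close>)
  also have "\<dots> = g p" using assms(2,3) by (auto simp: free_gen_def Pi_def)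
  finally show ?thesis .
qed

section \<open>Tensor products\<close>

definition bilinear ::
  "'k ring \<Rightarrow> ('k, 'a, 'x) module_scheme \<Rightarrow> ('k, 'b, 'y) module_scheme \<Rightarrow> ('k, 'c, 'z) module_scheme
    \<Rightarrow> ('a \<Rightarrow> 'b \<Rightarrow> 'c) \<Rightarrow> bool"
  where "bilinear K V W U f \<longleftrightarrow>
    (\<forall>v\<in>carrier V. linear_map K W U (f v)) \<and> (\<forall>w\<in>carrier W. linear_map K V U (\<lambda>v. f v w))"

lemma bilinearI:
  "(\<And>v. v \<in> carrier V \<Longrightarrow> linear_map K W U (\<lambda>w. f v w)) \<Longrightarrow>
    (\<And>w. w \<in> carrier W \<Longrightarrow> linear_map K V U (\<lambda>v. f v w)) \<Longrightarrow> bilinear K V W U (\<lambda>v w. f v w)"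
  by (simp add: bilinear_def)

lemma bilinear_left: "bilinear K V W U f \<Longrightarrow> w \<in> carrier W \<Longrightarrow> linear_map K V U (\<lambda>v. f v w)"
  and bilinear_right: "bilinear K V W U f \<Longrightarrow> v \<in> carrier V \<Longrightarrow> linear_map K W U (f v)"
  and bilinear_closed:
    "bilinear K V W U f \<Longrightarrow> v \<in> carrier V \<Longrightarrow> w \<in> carrier W \<Longrightarrow> f v w \<in> carrier U"
  by (auto simp: bilinear_def linear_map_closed)

lemma module_free_pairs: "cring K \<Longrightarrow> module K (free_pairs K V W)"
  by (simp add: free_pairs_def module_free_module)

lemma free_pairs_gen_closed:
  "cring K \<Longrightarrow> v \<in> carrier V \<Longrightarrow> w \<in> carrier W \<Longrightarrow> free_gen K (v, w) \<in> carrier (free_pairs K V W)"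
  by (simp add: free_pairs_def free_gen_closed)

lemma bilinear_relations_closed:
  assumes "module K V" "module K W"
  shows "bilinear_relations K V W \<subseteq> carrier (free_pairs K V W)"
proof -
  interpret V: module K V by fact
  interpret W: module K W by fact
  interpret F: module K "free_pairs K V W" by (rule module_free_pairs[OF V.R.is_cring])
  show ?thesis
    by (auto simp: bilinear_relations_def Let_def free_pairs_gen_closed V.R.is_cring)
qed

lemma tensor_null_submodule:
  assumes "module K V" "module K W"
  shows "submodule (tensor_null K V W) K (free_pairs K V W)"
  unfolding tensor_null_def
  by (intro lin_span_submodule module_free_pairs bilinear_relations_closed assms module.axioms(1)[OF assms(1)])

lemma module_tensor_space:
  assumes "module K V" "module K W"
  shows "module K (tensor_space K V W)"
  unfolding tensor_space_def
  by (intro module_quotient module_free_pairs tensor_null_submodule assms module.axioms(1)[OF assms(1)])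

lemma linear_map_tensor_coset:
  assumes "module K V" "module K W"
  shows "linear_map K (free_pairs K V W) (tensor_space K V W)
    (\<lambda>x. tensor_null K V W +>\<^bsub>free_pairs K V W\<^esub> x)"
  unfolding tensor_space_def
  by (intro linear_map_coset module_free_pairs tensor_null_submodule assms module.axioms(1)[OF assms(1)])

lemma tens_closed:
  assumes "module K V" "module K W" "v \<in> carrier V" "w \<in> carrier W"
  shows "tens K V W v w \<in> carrier (tensor_space K V W)"
  unfolding tens_def
  by (intro linear_map_closed[OF linear_map_tensor_coset] free_pairs_gen_closed assms
      module.axioms(1)[OF assms(1)])

lemma tensor_space_induct [consumes 3, case_names zero add tens]:
  assumes "module K V" "module K W" "x \<in> carrier (tensor_space K V W)"
    and zero: "P \<zero>\<^bsub>tensor_space K V W\<^esub>"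
    and add: "\<And>x y. x \<in> carrier (tensor_space K V W) \<Longrightarrow> y \<in> carrier (tensor_space K V W) \<Longrightarrow>
      P x \<Longrightarrow> P y \<Longrightarrow> P (x \<oplus>\<^bsub>tensor_space K V W\<^esub> y)"
    and tens: "\<And>c v w. c \<in> carrier K \<Longrightarrow> v \<in> carrier V \<Longrightarrow> w \<in> carrier W \<Longrightarrow>
      P (c \<odot>\<^bsub>tensor_space K V W\<^esub> tens K V W v w)"
  shows "P x"
proof -
  interpret V: module K V by fact
  let ?F = "free_pairs K V W" and ?c = "\<lambda>x. tensor_null K V W +>\<^bsub>free_pairs K V W\<^esub> x"
  note lin = linear_map_tensor_coset[OF assms(1,2)]
  note F = module_free_pairs[OF V.R.is_cring]
  obtain f where f: "f \<in> carrier ?F" "x = ?c f"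
    using assms(3) by (auto simp: tensor_space_def carrier_quotient)
  have "P (?c f)" using V.R.is_cring f(1)[unfolded free_pairs_def]
  proof (induction rule: free_module_induct)
    case zero
    show ?case
      using linear_map_zero[OF F module_tensor_space[OF assms(1,2)] lin] assms(4)
      by (simp add: free_pairs_def free_module_zero)
  next
    case (add x y)
    then show ?case
      using linear_map_add[OF lin, of x y] assms(5)[of "?c x" "?c y"] linear_map_closed[OF lin]
      by (simp add: free_pairs_def free_module_add)
  next
    case (gen c p)
    then show ?case
      using linear_map_smult[OF lin gen(1), of "free_gen K p"] tens[OF gen(1), of "fst p" "snd p"]
      by (auto simp: free_pairs_def free_module_smult tens_def free_gen_closed V.R.is_cring)
  qed
  with f show ?thesis by simp
qed

text \<open>Each of the four families in \<open>bilinear_relations\<close> yields one of the four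
  identities, because elements whose difference is a relation have the same coset.\<close>

lemma bilinear_tens:
  assumes "module K V" "module K W"
  shows "bilinear K V W (tensor_space K V W) (tens K V W)"
proof -
  interpret V: module K V by fact
  interpret W: module K W by fact
  interpret F: module K "free_pairs K V W" by (rule module_free_pairs[OF V.R.is_cring])
  let ?F = "free_pairs K V W" and ?T = "tensor_space K V W" and ?e = "\<lambda>v w. free_gen K (v, w)"
  let ?c = "\<lambda>x. tensor_null K V W +>\<^bsub>free_pairs K V W\<^esub> x"
  note lin = linear_map_tensor_coset[OF assms]
  have gen: "?e v w \<in> carrier ?F" if "v \<in> carrier V" "w \<in> carrier W" for v w
    using that by (simp add: free_pairs_gen_closed V.R.is_cring)
  have eq: "?c x = ?c y" if "x \<ominus>\<^bsub>?F\<^esub> y \<in> bilinear_relations K V W" "x \<in> carrier ?F" "y \<in> carrier ?F" for x y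
    using coset_eq_iff[OF F.module_axioms tensor_null_submodule[OF assms] that(2,3)] that(1)
    by (simp add: tensor_null_def lin_span_inc)
  show ?thesis
  proof (intro bilinearI linear_mapI)
    fix v w w' assume A: "v \<in> carrier V" "w \<in> carrier W" "w' \<in> carrier W"
    have "?c (?e v (w \<oplus>\<^bsub>W\<^esub> w')) = ?c (?e v w \<oplus>\<^bsub>?F\<^esub> ?e v w')"
      by (rule eq) (use A gen in \<open>auto simp: bilinear_relations_def Let_def\<close>)
    then show "tens K V W v (w \<oplus>\<^bsub>W\<^esub> w') = tens K V W v w \<oplus>\<^bsub>?T\<^esub> tens K V W v w'"
      using linear_map_add[OF lin] A gen by (simp add: tens_def)
  next
    fix v c w assume A: "v \<in> carrier V" "c \<in> carrier K" "w \<in> carrier W"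
    have "?c (?e v (c \<odot>\<^bsub>W\<^esub> w)) = ?c (c \<odot>\<^bsub>?F\<^esub> ?e v w)"
      by (rule eq) (use A gen in \<open>auto simp: bilinear_relations_def Let_def\<close>)
    then show "tens K V W v (c \<odot>\<^bsub>W\<^esub> w) = c \<odot>\<^bsub>?T\<^esub> tens K V W v w"
      using linear_map_smult[OF lin] A gen by (simp add: tens_def)
  next
    fix w v v' assume A: "w \<in> carrier W" "v \<in> carrier V" "v' \<in> carrier V"
    have "?c (?e (v \<oplus>\<^bsub>V\<^esub> v') w) = ?c (?e v w \<oplus>\<^bsub>?F\<^esub> ?e v' w)"
      by (rule eq) (use A gen in \<open>auto simp: bilinear_relations_def Let_def\<close>)
    then show "tens K V W (v \<oplus>\<^bsub>V\<^esub> v') w = tens K V W v w \<oplus>\<^bsub>?T\<^esub> tens K V W v' w"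
      using linear_map_add[OF lin] A gen by (simp add: tens_def)
  next
    fix w c v assume A: "w \<in> carrier W" "c \<in> carrier K" "v \<in> carrier V"
    have "?c (?e (c \<odot>\<^bsub>V\<^esub> v) w) = ?c (c \<odot>\<^bsub>?F\<^esub> ?e v w)"
      by (rule eq) (use A gen in \<open>auto simp: bilinear_relations_def Let_def\<close>)
    then show "tens K V W (c \<odot>\<^bsub>V\<^esub> v) w = c \<odot>\<^bsub>?T\<^esub> tens K V W v w"
      using linear_map_smult[OF lin] A gen by (simp add: tens_def)
  qed (simp_all add: tens_closed assms)
qed

lemma linear_map_eq_on_tensor_space:
  assumes "module K V" "module K W" "module K U"
    and "linear_map K (tensor_space K V W) U f" "linear_map K (tensor_space K V W) U g"
    and "\<And>v w. v \<in> carrier V \<Longrightarrow> w \<in> carrier W \<Longrightarrow> f (tens K V W v w) = g (tens K V W v w)"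
    and "x \<in> carrier (tensor_space K V W)"
  shows "f x = g x"
  using assms(1,2,7)
proof (induction rule: tensor_space_induct)
  case zero
  then show ?case
    using linear_map_zero[OF module_tensor_space[OF assms(1,2)] assms(3)] assms(4,5) by metis
next
  case (add x y)
  then show ?case using linear_map_add[OF assms(4)] linear_map_add[OF assms(5)] by simp
next
  case (tens c v w)
  then show ?case
    using linear_map_smult[OF assms(4)] linear_map_smult[OF assms(5)] assms(6)
    by (simp add: tens_closed assms(1,2))
qed

text \<open>Bilinearity makes the lift vanish on every defining relation, which is the condition
  under which \<open>induced\<close> is meaningful.\<close>

lemma free_lift_bilinear:
  assumes "module K V" "module K W" "module K U" "bilinear K V W U f"
  shows "linear_map K (free_pairs K V W) U (free_lift K U (\<lambda>p. f (fst p) (snd p)))"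
    and "\<And>x. x \<in> tensor_null K V W \<Longrightarrow> free_lift K U (\<lambda>p. f (fst p) (snd p)) x = \<zero>\<^bsub>U\<^esub>"
    and "\<And>v w. v \<in> carrier V \<Longrightarrow> w \<in> carrier W \<Longrightarrow>
      free_lift K U (\<lambda>p. f (fst p) (snd p)) (free_gen K (v, w)) = f v w"
proof -
  interpret V: module K V by fact
  interpret W: module K W by fact
  interpret U: module K U by fact
  interpret F: module K "free_pairs K V W" by (rule module_free_pairs[OF V.R.is_cring])
  let ?l = "free_lift K U (\<lambda>p. f (fst p) (snd p))"
  have cl: "(\<lambda>p. f (fst p) (snd p)) \<in> carrier V \<times> carrier W \<rightarrow> carrier U"
    using bilinear_closed[OF assms(4)] by auto
  show lin: "linear_map K (free_pairs K V W) U ?l"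
    unfolding free_pairs_def by (rule linear_map_free_lift[OF assms(3) cl])
  show val: "?l (free_gen K (v, w)) = f v w" if "v \<in> carrier V" "w \<in> carrier W" for v w
    using free_lift_gen[OF assms(3) cl, of "(v, w)"] that by simp
  note [simp] = linear_map_uminus[OF F.module_axioms assms(3) lin] linear_map_add[OF lin]
    linear_map_smult[OF lin] val free_pairs_gen_closed V.R.is_cring
    linear_map_add[OF bilinear_left[OF assms(4)]] linear_map_add[OF bilinear_right[OF assms(4)]]
    linear_map_smult[OF bilinear_left[OF assms(4)]] linear_map_smult[OF bilinear_right[OF assms(4)]]
    bilinear_closed[OF assms(4)]
  show "?l x = \<zero>\<^bsub>U\<^esub>" if "x \<in> tensor_null K V W" for x
  proof (rule linear_map_lin_span_zero[OF F.module_axioms assms(3) lin bilinear_relations_closed[OF assms(1,2)]])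
    show "x \<in> lin_span K (free_pairs K V W) (bilinear_relations K V W)"
      using that by (simp add: tensor_null_def)
    show "?l y = \<zero>\<^bsub>U\<^esub>" if "y \<in> bilinear_relations K V W" for y
      using that unfolding bilinear_relations_def Let_def
      by (elim UnE CollectE exE conjE) (simp_all add: a_minus_def U.M.r_neg)
  qed
qed

section \<open>Universal property of the tensor product\<close>

lemma linear_map_tlift:
  assumes "module K V" "module K W" "module K U" "bilinear K V W U f"
  shows "linear_map K (tensor_space K V W) U (tlift K U f)"
  unfolding tensor_space_def tlift_def free_lift_def[symmetric]
  by (intro linear_map_induced free_lift_bilinear[OF assms] module_free_pairs tensor_null_submodule
      assms module.axioms(1)[OF assms(1)])

lemma tlift_tens:
  assumes "module K V" "module K W" "module K U" "bilinear K V W U f" "v \<in> carrier V" "w \<in> carrier W"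
  shows "tlift K U f (tens K V W v w) = f v w"
proof -
  have K: "cring K" using assms(1) by (rule module.axioms)
  show ?thesis
    unfolding tlift_def free_lift_def[symmetric] tens_def
    using induced_coset[OF module_free_pairs[OF K] tensor_null_submodule[OF assms(1,2)] assms(3)
        free_lift_bilinear(1,2)[OF assms(1-4)] free_pairs_gen_closed[OF K assms(5,6)]]
      free_lift_bilinear(3)[OF assms] by simp
qed

text \<open>Holds for arbitrary \<open>U\<close> and for values in or out of the carrier: a
  derivation in \<open>foldSetD\<close>, from which \<open>finsum\<close> is built, evaluates the
  function on the index set only.\<close>

lemma finsum_cong_all:
  assumes "\<And>p. p \<in> A \<Longrightarrow> f p = g p" shows "finsum U f A = finsum U g A"
proof -
  let ?m = "\<lambda>f. (\<oplus>\<^bsub>U\<^esub>) \<circ> f"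
  have "(B, x) \<in> foldSetD D (?m f) e \<Longrightarrow> B \<subseteq> A \<Longrightarrow> (\<And>p. p \<in> A \<Longrightarrow> f p = g p) \<Longrightarrow>
      (B, x) \<in> foldSetD D (?m g) e" for B x f g D e
  proof (induction set: foldSetD)
    case (insertI p B y)
    then have "(insert p B, (?m g) p y) \<in> foldSetD D (?m g) e"
      by (intro foldSetD.insertI) auto
    moreover have "(?m g) p y = (?m f) p y" using insertI by simp
    ultimately show ?case by metis
  qed (auto intro: foldSetD.emptyI)
  then have "(A, x) \<in> foldSetD D (?m f) e \<longleftrightarrow> (A, x) \<in> foldSetD D (?m g) e" for x D e
    using assms by (metis order_refl)
  then show ?thesis by (simp add: finsum_def finprod_def foldD_def)
qed

text \<open>Representatives of a tensor are supported on pairs from the carriers. As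
  \<open>f\<close> and \<open>g\<close> are not assumed bilinear, this rewrites under
  \<open>tlift\<close> before multilinearity is established.\<close>

lemma tlift_cong:
  assumes "module K V" "module K W"
    and "\<And>v w. v \<in> carrier V \<Longrightarrow> w \<in> carrier W \<Longrightarrow> f v w = g v w"
    and "t \<in> carrier (tensor_space K V W)"
  shows "tlift K U f t = tlift K U g t"
proof -
  interpret V: module K V by fact
  interpret F: module K "free_pairs K V W" by (rule module_free_pairs[OF V.R.is_cring])
  obtain y where y: "y \<in> carrier (free_pairs K V W)" "t = tensor_null K V W +>\<^bsub>free_pairs K V W\<^esub> y"
    using assms(4) by (auto simp: tensor_space_def carrier_quotient)
  have "(\<Oplus>\<^bsub>U\<^esub>p\<in>{p. x p \<noteq> \<zero>\<^bsub>K\<^esub>}. x p \<odot>\<^bsub>U\<^esub> f (fst p) (snd p))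
      = (\<Oplus>\<^bsub>U\<^esub>p\<in>{p. x p \<noteq> \<zero>\<^bsub>K\<^esub>}. x p \<odot>\<^bsub>U\<^esub> g (fst p) (snd p))" if "x \<in> t" for x
  proof -
    have "x \<in> carrier (free_pairs K V W)"
      using that y mem_coset_iff[OF F.module_axioms tensor_null_submodule[OF assms(1,2)]] by auto
    then have "p \<in> carrier V \<times> carrier W" if "x p \<noteq> \<zero>\<^bsub>K\<^esub>" for p
      using that by (cases p) (auto simp: free_pairs_def free_module_carrier_iff)
    then show ?thesis using assms(3) by (intro finsum_cong_all) auto
  qed
  then show ?thesis by (simp add: tlift_def induced_def)
qed

lemma sub_tensor_submodule:
  assumes "module K V" "module K W" "X \<subseteq> carrier V" "Y \<subseteq> carrier W"
  shows "submodule (sub_tensor K V W X Y) K (tensor_space K V W)"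
  unfolding sub_tensor_def using assms(3,4)
  by (intro lin_span_submodule module_tensor_space assms(1,2)) (auto intro!: tens_closed assms(1,2))

section \<open>Rules for multilinear expressions\<close>

text \<open>Linearity of a long expression is derived along its syntax: each operation contributes
  rules with one varying argument and the others fixed in their carriers, while
  \<open>bilinearI\<close> and \<open>trilinearI\<close> split a goal by variable.\<close>

named_theorems linear_intros

declare linear_map_id [linear_intros] linear_map_plus [linear_intros] linear_map_neg [linear_intros]
  linear_map_diff [linear_intros] linear_map_const_smult [linear_intros] bilinearI [linear_intros]

lemma linear_map_tens_left [linear_intros]:
  assumes "module K V" "module K W" "linear_map K T V f" "w \<in> carrier W"
  shows "linear_map K T (tensor_space K V W) (\<lambda>x. tens K V W (f x) w)"
  by (rule linear_map_comp[OF bilinear_left[OF bilinear_tens[OF assms(1,2)] assms(4)] assms(3)])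

lemma linear_map_tens_right [linear_intros]:
  assumes "module K V" "module K W" "linear_map K T W f" "v \<in> carrier V"
  shows "linear_map K T (tensor_space K V W) (\<lambda>x. tens K V W v (f x))"
  by (rule linear_map_comp[OF bilinear_right[OF bilinear_tens[OF assms(1,2)] assms(4)] assms(3)])

lemma bilinear_left_comp:
  "bilinear K V W U f \<Longrightarrow> linear_map K T V g \<Longrightarrow> w \<in> carrier W \<Longrightarrow> linear_map K T U (\<lambda>x. f (g x) w)"
  by (rule linear_map_comp[OF bilinear_left])

lemma bilinear_right_comp:
  "bilinear K V W U f \<Longrightarrow> linear_map K T W g \<Longrightarrow> v \<in> carrier V \<Longrightarrow> linear_map K T U (\<lambda>x. f v (g x))"
  by (rule linear_map_comp[OF bilinear_right])

lemma linear_map_tlift_arg: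
  assumes "module K V" "module K W" "module K U" "bilinear K V W U f"
    and "linear_map K T (tensor_space K V W) g"
  shows "linear_map K T U (\<lambda>x. tlift K U f (g x))"
  by (rule linear_map_comp[OF linear_map_tlift[OF assms(1-4)] assms(5)])

text \<open>For a fixed tensor the lift depends linearly on the map being lifted. Nested lifts, as
  in products of tensors and iterated Sweedler sums, need this besides linearity in the
  tensor.\<close>

lemma linear_map_tlift_param:
  assumes "module K V" "module K W" "module K U" "module K T"
    and "t \<in> carrier (tensor_space K V W)"
    and f: "\<And>x. x \<in> carrier T \<Longrightarrow> bilinear K V W U (f x)"
    and lin: "\<And>v w. v \<in> carrier V \<Longrightarrow> w \<in> carrier W \<Longrightarrow> linear_map K T U (\<lambda>x. f x v w)"
  shows "linear_map K T U (\<lambda>x. tlift K U (f x) t)"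
proof -
  interpret T: module K T by fact
  interpret U: module K U by fact
  note lt = linear_map_tlift[OF assms(1-3)] and tt = tlift_tens[OF assms(1-3)]
  note eq = linear_map_eq_on_tensor_space[OF assms(1-3) _ _ _ assms(5)]
  show ?thesis
  proof (rule linear_mapI)
    show "tlift K U (f x) t \<in> carrier U" if "x \<in> carrier T" for x
      using linear_map_closed[OF lt assms(5)] f that by blast
    show "tlift K U (f (x \<oplus>\<^bsub>T\<^esub> y)) t = tlift K U (f x) t \<oplus>\<^bsub>U\<^esub> tlift K U (f y) t"
      if "x \<in> carrier T" "y \<in> carrier T" for x y
      by (rule eq[OF lt[OF f] linear_map_plus[OF assms(3) lt[OF f] lt[OF f]]])
        (use that tt f in \<open>simp_all add: linear_map_add[OF lin]\<close>)
    show "tlift K U (f (c \<odot>\<^bsub>T\<^esub> x)) t = c \<odot>\<^bsub>U\<^esub> tlift K U (f x) t"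
      if "c \<in> carrier K" "x \<in> carrier T" for c x
      by (rule eq[OF lt[OF f] linear_map_const_smult[OF assms(3) _ lt[OF f]]])
        (use that tt f in \<open>simp_all add: linear_map_smult[OF lin]\<close>)
  qed
qed

text \<open>Moves a linear map under the summation hidden in \<open>tlift\<close>: both sides are
  linear in \<open>t\<close> and agree on pure tensors.\<close>

lemma linear_map_of_tlift:
  assumes "module K V" "module K W" "module K U" "module K U'"
    and "linear_map K U U' \<phi>" "bilinear K V W U f" "t \<in> carrier (tensor_space K V W)"
  shows "\<phi> (tlift K U f t) = tlift K U' (\<lambda>v w. \<phi> (f v w)) t"
proof -
  have bil: "bilinear K V W U' (\<lambda>v w. \<phi> (f v w))"
    by (intro bilinearI linear_map_comp[OF assms(5)] bilinear_left[OF assms(6)] bilinear_right[OF assms(6)])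
  show ?thesis
    by (rule linear_map_eq_on_tensor_space[OF assms(1,2,4) linear_map_comp[OF assms(5)
          linear_map_tlift[OF assms(1-3,6)]] linear_map_tlift[OF assms(1,2,4) bil] _ assms(7)])
      (simp add: tlift_tens[OF assms(1-3,6)] tlift_tens[OF assms(1,2,4) bil])
qed

lemma tens_zero_left:
  "module K V \<Longrightarrow> module K W \<Longrightarrow> w \<in> carrier W \<Longrightarrow> tens K V W \<zero>\<^bsub>V\<^esub> w = \<zero>\<^bsub>tensor_space K V W\<^esub>"
  by (rule linear_map_zero[OF _ module_tensor_space bilinear_left[OF bilinear_tens]])

lemma tens_zero_right:
  "module K V \<Longrightarrow> module K W \<Longrightarrow> v \<in> carrier V \<Longrightarrow> tens K V W v \<zero>\<^bsub>W\<^esub> = \<zero>\<^bsub>tensor_space K V W\<^esub>"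
  by (rule linear_map_zero[OF _ module_tensor_space bilinear_right[OF bilinear_tens]])

lemma bilinear_zero_left:
  "module K V \<Longrightarrow> module K U \<Longrightarrow> bilinear K V W U f \<Longrightarrow> w \<in> carrier W \<Longrightarrow> f \<zero>\<^bsub>V\<^esub> w = \<zero>\<^bsub>U\<^esub>"
  by (rule linear_map_zero[OF _ _ bilinear_left])

lemma bilinear_zero_right:
  "module K W \<Longrightarrow> module K U \<Longrightarrow> bilinear K V W U f \<Longrightarrow> v \<in> carrier V \<Longrightarrow> f v \<zero>\<^bsub>W\<^esub> = \<zero>\<^bsub>U\<^esub>"
  by (rule linear_map_zero[OF _ _ bilinear_right])

lemma tlift_zero:
  assumes "module K V" "module K W" "module K U" "x \<in> carrier (tensor_space K V W)"
  shows "tlift K U (\<lambda>v w. \<zero>\<^bsub>U\<^esub>) x = \<zero>\<^bsub>U\<^esub>"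
proof -
  have "bilinear K V W U (\<lambda>v w. \<zero>\<^bsub>U\<^esub>)" by (intro bilinearI linear_map_const_zero assms)
  from linear_map_of_tlift[OF assms(1-3,3) linear_map_const_zero[OF assms(3)] this assms(4)]
  show ?thesis by simp
qed

lemma unital_algebra_module: "unital_algebra K A \<Longrightarrow> module K A"
  and unital_algebra_ring: "unital_algebra K A \<Longrightarrow> ring A"
  by (simp_all add: unital_algebra_def)

lemma bilinear_mult:
  assumes "unital_algebra K A"
  shows "bilinear K A A A (\<lambda>a b. a \<otimes>\<^bsub>A\<^esub> b)"
proof -
  interpret A: ring A by (rule unital_algebra_ring[OF assms])
  show ?thesis
    using assms
    by (intro bilinearI linear_mapI) (simp_all add: A.l_distr A.r_distr unital_algebra_def, metis+)
qed

lemma linear_map_mult_left [linear_intros]: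
  "unital_algebra K A \<Longrightarrow> linear_map K V A f \<Longrightarrow> a \<in> carrier A \<Longrightarrow> linear_map K V A (\<lambda>x. f x \<otimes>\<^bsub>A\<^esub> a)"
  by (rule bilinear_left_comp[OF bilinear_mult])

lemma linear_map_mult_right [linear_intros]:
  "unital_algebra K A \<Longrightarrow> linear_map K V A f \<Longrightarrow> a \<in> carrier A \<Longrightarrow> linear_map K V A (\<lambda>x. a \<otimes>\<^bsub>A\<^esub> f x)"
  by (rule bilinear_right_comp[OF bilinear_mult])

definition trilinear ::
  "'k ring \<Rightarrow> ('k, 'h, 'x) module_scheme \<Rightarrow> ('k, 'c, 'z) module_scheme \<Rightarrow> ('h \<Rightarrow> 'h \<Rightarrow> 'h \<Rightarrow> 'c) \<Rightarrow> bool"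
  where "trilinear K V U F \<longleftrightarrow> (\<forall>x\<in>carrier V. \<forall>y\<in>carrier V.
    linear_map K V U (\<lambda>z. F z x y) \<and> linear_map K V U (\<lambda>z. F x z y) \<and> linear_map K V U (\<lambda>z. F x y z))"

lemma trilinearI [linear_intros]:
  "(\<And>x y. x \<in> carrier V \<Longrightarrow> y \<in> carrier V \<Longrightarrow> linear_map K V U (\<lambda>z. F z x y)) \<Longrightarrow>
   (\<And>x y. x \<in> carrier V \<Longrightarrow> y \<in> carrier V \<Longrightarrow> linear_map K V U (\<lambda>z. F x z y)) \<Longrightarrow>
   (\<And>x y. x \<in> carrier V \<Longrightarrow> y \<in> carrier V \<Longrightarrow> linear_map K V U (\<lambda>z. F x y z)) \<Longrightarrow>
   trilinear K V U (\<lambda>x y z. F x y z)"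
  by (simp add: trilinear_def)

section \<open>Sweedler calculus\<close>

locale hopf_alg =
  fixes K :: "'k ring" and H :: "('k, 'h) hopf"
  assumes hopf: "hopf_algebra K H"
begin

lemma H_alg [simp, linear_intros]: "unital_algebra K H"
  using hopf by (simp add: hopf_algebra_def)

lemma H_mod [simp, linear_intros]: "module K H" by (rule unital_algebra_module) simp

sublocale H: ring H by (rule unital_algebra_ring[OF H_alg])
sublocale HM: module K H by (rule H_mod)

lemma module_HH [simp, linear_intros]: "module K (tensor_space K H H)" by (simp add: module_tensor_space)

lemma comult_closed [simp]: "h \<in> carrier H \<Longrightarrow> comult H h \<in> carrier (tensor_space K H H)"
  using hopf by (auto simp: hopf_algebra_def linear_map_closed)

lemma linear_comult: "linear_map K H (tensor_space K H H) (comult H)"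
  using hopf by (simp add: hopf_algebra_def)

lemma linear_antipode: "linear_map K H H (antipode H)"
  using hopf by (simp add: hopf_algebra_def)

lemma antipode_closed [simp]: "h \<in> carrier H \<Longrightarrow> antipode H h \<in> carrier H"
  by (rule linear_map_closed[OF linear_antipode])

lemma counit_hom: "counit H \<in> ring_hom H K"
  using hopf by (simp add: hopf_algebra_def)

lemma counit_closed [simp]: "h \<in> carrier H \<Longrightarrow> counit H h \<in> carrier K"
  by (rule ring_hom_closed[OF counit_hom])

lemma counit_one [simp]: "counit H \<one>\<^bsub>H\<^esub> = \<one>\<^bsub>K\<^esub>"
  by (rule ring_hom_one[OF counit_hom])

lemma counit_mult [simp]:
  "h \<in> carrier H \<Longrightarrow> g \<in> carrier H \<Longrightarrow> counit H (h \<otimes>\<^bsub>H\<^esub> g) = counit H h \<otimes>\<^bsub>K\<^esub> counit H g"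
  by (rule ring_hom_mult[OF counit_hom])

lemma counit_add [simp]:
  "h \<in> carrier H \<Longrightarrow> g \<in> carrier H \<Longrightarrow> counit H (h \<oplus>\<^bsub>H\<^esub> g) = counit H h \<oplus>\<^bsub>K\<^esub> counit H g"
  by (rule ring_hom_add[OF counit_hom])

lemma counit_smult [simp]:
  "c \<in> carrier K \<Longrightarrow> h \<in> carrier H \<Longrightarrow> counit H (c \<odot>\<^bsub>H\<^esub> h) = c \<otimes>\<^bsub>K\<^esub> counit H h"
  using hopf by (simp add: hopf_algebra_def)

lemma linear_map_antipode_comp [linear_intros]:
  "linear_map K V H f \<Longrightarrow> linear_map K V H (\<lambda>x. antipode H (f x))"
  by (rule linear_map_comp[OF linear_antipode])

lemma linear_map_counit_smult [linear_intros]: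
  assumes "module K U" "linear_map K V H f" "u \<in> carrier U"
  shows "linear_map K V U (\<lambda>x. counit H (f x) \<odot>\<^bsub>U\<^esub> u)"
proof -
  interpret U: module K U by fact
  show ?thesis
    using assms(2,3)
    by (auto simp: linear_map_def Pi_def U.smult_l_distr U.smult_assoc1)
qed

abbreviation hmult :: "'h \<Rightarrow> 'h \<Rightarrow> 'h" (infixl \<open>\<cdot>\<close> 70)
  where "a \<cdot> b \<equiv> a \<otimes>\<^bsub>H\<^esub> b"

abbreviation S :: "'h \<Rightarrow> 'h" where "S \<equiv> antipode H"

abbreviation sw :: "('k, 'c, 'y) module_scheme \<Rightarrow> ('h \<Rightarrow> 'h \<Rightarrow> 'c) \<Rightarrow> 'h \<Rightarrow> 'c"
  where "sw \<equiv> sweedler2 K H"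

lemma linear_map_sweedler2 [linear_intros]:
  assumes "module K U" "bilinear K H H U f" "linear_map K V H g"
  shows "linear_map K V U (\<lambda>x. sw U f (g x))"
  unfolding sweedler2_def
  by (rule linear_map_tlift_arg[OF _ _ assms(1,2) linear_map_comp[OF linear_comult assms(3)]]) simp_all

lemma linear_map_sweedler2_param [linear_intros]:
  assumes "module K U" "module K V" "h \<in> carrier H"
    and "\<And>x. x \<in> carrier V \<Longrightarrow> bilinear K H H U (\<lambda>a b. f x a b)"
    and "\<And>a b. a \<in> carrier H \<Longrightarrow> b \<in> carrier H \<Longrightarrow> linear_map K V U (\<lambda>x. f x a b)"
  shows "linear_map K V U (\<lambda>x. sw U (\<lambda>a b. f x a b) h)"
  unfolding sweedler2_def using assms
  by (intro linear_map_tlift_param[OF H_mod H_mod]) auto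

lemma sweedler2_closed [linear_intros]:
  "module K U \<Longrightarrow> bilinear K H H U f \<Longrightarrow> h \<in> carrier H \<Longrightarrow> sw U f h \<in> carrier U"
  by (rule linear_map_closed[OF linear_map_sweedler2[OF _ _ linear_map_id]])

lemma linear_map_of_sweedler2:
  "module K U \<Longrightarrow> module K U' \<Longrightarrow> linear_map K U U' \<phi> \<Longrightarrow> bilinear K H H U f \<Longrightarrow> h \<in> carrier H \<Longrightarrow>
    \<phi> (sw U f h) = sw U' (\<lambda>a b. \<phi> (f a b)) h"
  unfolding sweedler2_def by (rule linear_map_of_tlift[OF H_mod H_mod]) simp_all

text \<open>Shaped as a congruence rule for the simplifier, which then rewrites under the bound
  Sweedler legs with their carrier membership at hand.\<close>

lemma sweedler2_cong:
  "h = h' \<Longrightarrow> h' \<in> carrier H \<Longrightarrow>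
    (\<And>a b. a \<in> carrier H \<Longrightarrow> b \<in> carrier H \<Longrightarrow> f a b = g a b) \<Longrightarrow> sw U f h = sw U g h'"
  unfolding sweedler2_def by (simp, rule tlift_cong[OF H_mod H_mod]) simp_all

text \<open>The coassociativity axiom is an equation between triple tensors; the linear map
  \<open>\<phi>\<close> that \<open>F\<close> induces on them is applied to both sides.\<close>

lemma sweedler2_coassoc:
  assumes U: "module K U" and F: "trilinear K H U F" and h: "h \<in> carrier H"
  shows "sw U (\<lambda>x c. sw U (\<lambda>a b. F a b c) x) h = sw U (\<lambda>a x. sw U (\<lambda>b c. F a b c) x) h"
proof -
  let ?T = "tensor_space K (tensor_space K H H) H"
  let ?t = "\<lambda>a b c. tens K (tensor_space K H H) H (tens K H H a b) c"
  define \<phi> where "\<phi> = tlift K U (\<lambda>t c. tlift K U (\<lambda>a b. F a b c) t)"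
  have T: "module K ?T" by (simp add: module_tensor_space)
  have lin: "linear_map K H U (\<lambda>z. F z x y)" "linear_map K H U (\<lambda>z. F x z y)" "linear_map K H U (\<lambda>z. F x y z)"
    if "x \<in> carrier H" "y \<in> carrier H" for x y
    using F that by (auto simp: trilinear_def)
  have bil: "bilinear K (tensor_space K H H) H U (\<lambda>t c. tlift K U (\<lambda>a b. F a b c) t)"
    by (intro bilinearI linear_map_tlift_param[OF H_mod H_mod] linear_map_tlift lin) (simp_all add: U)
  have \<phi>: "linear_map K ?T U \<phi>"
    unfolding \<phi>_def by (intro linear_map_tlift bil) (simp_all add: U)
  have val: "\<phi> (?t a b c) = F a b c" if "a \<in> carrier H" "b \<in> carrier H" "c \<in> carrier H" for a b c
    unfolding \<phi>_def using that
    by (subst tlift_tens[OF module_HH H_mod U bil]) (simp_all add: tens_closed tlift_tens U bilinearI lin)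
  have "sw ?T (\<lambda>x c. sw ?T (\<lambda>a b. ?t a b c) x) h = sw ?T (\<lambda>a x. sw ?T (\<lambda>b c. ?t a b c) x) h"
    using hopf h by (simp add: hopf_algebra_def Let_def)
  moreover have "\<phi> (sw ?T (\<lambda>x c. sw ?T (\<lambda>a b. ?t a b c) x) h) = sw U (\<lambda>x c. sw U (\<lambda>a b. F a b c) x) h"
  proof (subst linear_map_of_sweedler2[OF T U \<phi> _ h], goal_cases)
    case 1 show ?case by (intro linear_intros; simp add: T tens_closed)
  next
    case 2
    show ?case
    proof (rule sweedler2_cong[OF refl h], goal_cases)
      case (1 x c)
      then show ?case
        by (subst linear_map_of_sweedler2[OF T U \<phi>])
          ((intro linear_intros; simp add: T tens_closed), simp, simp add: val cong: sweedler2_cong)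
    qed
  qed
  moreover have "\<phi> (sw ?T (\<lambda>a x. sw ?T (\<lambda>b c. ?t a b c) x) h) = sw U (\<lambda>a x. sw U (\<lambda>b c. F a b c) x) h"
  proof (subst linear_map_of_sweedler2[OF T U \<phi> _ h], goal_cases)
    case 1 show ?case by (intro linear_intros; simp add: T tens_closed)
  next
    case 2
    show ?case
    proof (rule sweedler2_cong[OF refl h], goal_cases)
      case (1 x c)
      then show ?case
        by (subst linear_map_of_sweedler2[OF T U \<phi>])
          ((intro linear_intros; simp add: T tens_closed), simp, simp add: val cong: sweedler2_cong)
    qed
  qed
  ultimately show ?thesis by simp
qed

text \<open>The counit axiom with \<open>f\<close> applied to it. This rule and the next three carry
  such an \<open>f\<close> because in use the legs sit inside larger expressions.\<close>

lemma counit_left: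
  assumes "module K U" "linear_map K H U f" "h \<in> carrier H"
  shows "sw U (\<lambda>a b. counit H a \<odot>\<^bsub>U\<^esub> f b) h = f h"
proof -
  interpret U: module K U by fact
  have "sw H (\<lambda>a b. counit H a \<odot>\<^bsub>H\<^esub> b) h = h"
    using hopf assms(3) by (simp add: hopf_algebra_def)
  then have "f h = f (sw H (\<lambda>a b. counit H a \<odot>\<^bsub>H\<^esub> b) h)" by simp
  also have "\<dots> = sw U (\<lambda>a b. f (counit H a \<odot>\<^bsub>H\<^esub> b)) h"
    by (rule linear_map_of_sweedler2[OF H_mod assms(1,2) _ assms(3)]) (intro linear_intros; simp)
  also have "\<dots> = sw U (\<lambda>a b. counit H a \<odot>\<^bsub>U\<^esub> f b) h"
    by (rule sweedler2_cong[OF refl assms(3)]) (simp add: linear_map_smult[OF assms(2)])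
  finally show ?thesis by simp
qed

lemma counit_right:
  assumes "module K U" "linear_map K H U f" "h \<in> carrier H"
  shows "sw U (\<lambda>a b. counit H b \<odot>\<^bsub>U\<^esub> f a) h = f h"
proof -
  interpret U: module K U by fact
  have "sw H (\<lambda>a b. counit H b \<odot>\<^bsub>H\<^esub> a) h = h"
    using hopf assms(3) by (simp add: hopf_algebra_def)
  then have "f h = f (sw H (\<lambda>a b. counit H b \<odot>\<^bsub>H\<^esub> a) h)" by simp
  also have "\<dots> = sw U (\<lambda>a b. f (counit H b \<odot>\<^bsub>H\<^esub> a)) h"
    by (rule linear_map_of_sweedler2[OF H_mod assms(1,2) _ assms(3)]) (intro linear_intros; simp)
  also have "\<dots> = sw U (\<lambda>a b. counit H b \<odot>\<^bsub>U\<^esub> f a) h"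
    by (rule sweedler2_cong[OF refl assms(3)]) (simp add: linear_map_smult[OF assms(2)])
  finally show ?thesis by simp
qed

lemma antipode_left:
  assumes "module K U" "linear_map K H U f" "h \<in> carrier H"
  shows "sw U (\<lambda>a b. f (S a \<cdot> b)) h = counit H h \<odot>\<^bsub>U\<^esub> f \<one>\<^bsub>H\<^esub>"
proof -
  have "f (sw H (\<lambda>a b. S a \<cdot> b) h) = sw U (\<lambda>a b. f (S a \<cdot> b)) h"
    by (rule linear_map_of_sweedler2[OF H_mod assms(1,2) _ assms(3)]) (intro linear_intros; simp)
  moreover have "sw H (\<lambda>a b. S a \<cdot> b) h = counit H h \<odot>\<^bsub>H\<^esub> \<one>\<^bsub>H\<^esub>"
    using hopf assms(3) by (simp add: hopf_algebra_def)
  ultimately show ?thesis using assms(3) by (simp add: linear_map_smult[OF assms(2)])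
qed

lemma antipode_right:
  assumes "module K U" "linear_map K H U f" "h \<in> carrier H"
  shows "sw U (\<lambda>a b. f (a \<cdot> S b)) h = counit H h \<odot>\<^bsub>U\<^esub> f \<one>\<^bsub>H\<^esub>"
proof -
  have "f (sw H (\<lambda>a b. a \<cdot> S b) h) = sw U (\<lambda>a b. f (a \<cdot> S b)) h"
    by (rule linear_map_of_sweedler2[OF H_mod assms(1,2) _ assms(3)]) (intro linear_intros; simp)
  moreover have "sw H (\<lambda>a b. a \<cdot> S b) h = counit H h \<odot>\<^bsub>H\<^esub> \<one>\<^bsub>H\<^esub>"
    using hopf assms(3) by (simp add: hopf_algebra_def)
  ultimately show ?thesis using assms(3) by (simp add: linear_map_smult[OF assms(2)])
qed

text \<open>Fubini for Sweedler sums over two elements: once \<open>comult H h\<close> is replaced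
  by an arbitrary tensor, both sides are linear in it, so it may be taken pure.\<close>

lemma sweedler2_swap:
  assumes U: "module K U" and hg: "h \<in> carrier H" "g \<in> carrier H"
    and F: "\<And>c d. c \<in> carrier H \<Longrightarrow> d \<in> carrier H \<Longrightarrow> bilinear K H H U (\<lambda>a b. F a b c d)"
    and F': "\<And>a b. a \<in> carrier H \<Longrightarrow> b \<in> carrier H \<Longrightarrow> bilinear K H H U (\<lambda>c d. F a b c d)"
  shows "sw U (\<lambda>a b. sw U (\<lambda>c d. F a b c d) g) h = sw U (\<lambda>c d. sw U (\<lambda>a b. F a b c d) h) g"
proof -
  let ?T = "tensor_space K H H" and ?s = "comult H g"
  note tl = linear_map_tlift[OF H_mod H_mod U] and tt = tlift_tens[OF H_mod H_mod U]
    and tp = linear_map_tlift_param[OF H_mod H_mod U] and s = comult_closed[OF hg(2)]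
  have bil: "bilinear K H H U (\<lambda>c d. tlift K U (\<lambda>a b. F a b c d) t)" if t: "t \<in> carrier ?T" for t
    by (intro bilinearI tp H_mod t F bilinear_left[OF F'] bilinear_right[OF F'])
  have bil': "bilinear K H H U (\<lambda>a b. tlift K U (\<lambda>c d. F a b c d) ?s)"
    by (intro bilinearI tp H_mod s F' bilinear_left[OF F] bilinear_right[OF F])
  have "tlift K U (\<lambda>a b. tlift K U (\<lambda>c d. F a b c d) ?s) t = tlift K U (\<lambda>c d. tlift K U (\<lambda>a b. F a b c d) t) ?s"
    if t: "t \<in> carrier ?T" for t
  proof (rule linear_map_eq_on_tensor_space[OF H_mod H_mod U tl[OF bil'] _ _ t])
    show "linear_map K ?T U (\<lambda>t. tlift K U (\<lambda>c d. tlift K U (\<lambda>a b. F a b c d) t) ?s)"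
      by (intro tp module_HH s bil tl F)
    show "tlift K U (\<lambda>a b. tlift K U (\<lambda>c d. F a b c d) ?s) (tens K H H a b)
        = tlift K U (\<lambda>c d. tlift K U (\<lambda>a b. F a b c d) (tens K H H a b)) ?s"
      if ab: "a \<in> carrier H" "b \<in> carrier H" for a b
      by (subst tt[OF bil' ab], rule tlift_cong[OF H_mod H_mod _ s]) (simp add: tt[OF F ab])
  qed
  then show ?thesis using hg(1) by (simp add: sweedler2_def)
qed

text \<open>Coassociativity brings the first two legs together; they contract to a counit, which the
  third leg absorbs. In short, \<open>S h1 h2 \<otimes> h3 = 1 \<otimes> h\<close>.\<close>

lemma antipode_left_cancel:
  assumes U: "module K U" and J: "bilinear K H H U J" and h: "h \<in> carrier H"
  shows "sw U (\<lambda>a x. sw U (\<lambda>b c. J (S a \<cdot> b) c) x) h = J \<one>\<^bsub>H\<^esub> h"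
proof -
  note bl = bilinear_left_comp[OF J] bilinear_right_comp[OF J]
  have "sw U (\<lambda>a x. sw U (\<lambda>b c. J (S a \<cdot> b) c) x) h
      = sw U (\<lambda>x c. sw U (\<lambda>a b. J (S a \<cdot> b) c) x) h"
    by (rule sweedler2_coassoc[OF U _ h, symmetric]) (intro linear_intros bl; simp)
  also have "\<dots> = sw U (\<lambda>x c. counit H x \<odot>\<^bsub>U\<^esub> J \<one>\<^bsub>H\<^esub> c) h"
    by (rule sweedler2_cong[OF refl h], rule antipode_left[OF U]) ((intro linear_intros bl)?; simp)+
  also have "\<dots> = J \<one>\<^bsub>H\<^esub> h"
    by (rule counit_left[OF U _ h]) (intro linear_intros bl; simp)
  finally show ?thesis .
qed

lemma antipode_right_cancel:
  assumes U: "module K U" and J: "bilinear K H H U J" and h: "h \<in> carrier H"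
  shows "sw U (\<lambda>a x. sw U (\<lambda>b c. J (a \<cdot> S b) c) x) h = J \<one>\<^bsub>H\<^esub> h"
proof -
  note bl = bilinear_left_comp[OF J] bilinear_right_comp[OF J]
  have "sw U (\<lambda>a x. sw U (\<lambda>b c. J (a \<cdot> S b) c) x) h
      = sw U (\<lambda>x c. sw U (\<lambda>a b. J (a \<cdot> S b) c) x) h"
    by (rule sweedler2_coassoc[OF U _ h, symmetric]) (intro linear_intros bl; simp)
  also have "\<dots> = sw U (\<lambda>x c. counit H x \<odot>\<^bsub>U\<^esub> J \<one>\<^bsub>H\<^esub> c) h"
    by (rule sweedler2_cong[OF refl h], rule antipode_right[OF U]) ((intro linear_intros bl)?; simp)+
  also have "\<dots> = J \<one>\<^bsub>H\<^esub> h"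
    by (rule counit_left[OF U _ h]) (intro linear_intros bl; simp)
  finally show ?thesis .
qed

lemma sweedler2_one:
  assumes "module K U" "bilinear K H H U f"
  shows "sw U f \<one>\<^bsub>H\<^esub> = f \<one>\<^bsub>H\<^esub> \<one>\<^bsub>H\<^esub>"
proof -
  have "comult H \<one>\<^bsub>H\<^esub> = tens K H H \<one>\<^bsub>H\<^esub> \<one>\<^bsub>H\<^esub>"
    using hopf ring_hom_one by (fastforce simp: hopf_algebra_def tensor_algebra_def)
  then show ?thesis by (simp add: sweedler2_def tlift_tens assms)
qed

text \<open>The coproduct is multiplicative, and the product of the tensor algebra is by definition
  a double lift, that is, a nested Sweedler sum when applied to two coproducts.\<close>

lemma sweedler2_mult:
  assumes U: "module K U" and f: "bilinear K H H U f" and hg: "h \<in> carrier H" "g \<in> carrier H"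
  shows "sw U f (h \<cdot> g) = sw U (\<lambda>a b. sw U (\<lambda>c d. f (a \<cdot> c) (b \<cdot> d)) g) h"
proof -
  let ?T = "tensor_space K H H"
  note bl = bilinear_left_comp[OF f] bilinear_right_comp[OF f]
  have "comult H (h \<cdot> g) = comult H h \<otimes>\<^bsub>tensor_algebra K H H\<^esub> comult H g"
    using hopf hg by (simp add: hopf_algebra_def ring_hom_mult)
  also have "\<dots> = sw ?T (\<lambda>a b. sw ?T (\<lambda>c d. tens K H H (a \<cdot> c) (b \<cdot> d)) g) h"
    by (simp add: tensor_algebra_def sweedler2_def)
  finally have "sw U f (h \<cdot> g)
      = tlift K U f (sw ?T (\<lambda>a b. sw ?T (\<lambda>c d. tens K H H (a \<cdot> c) (b \<cdot> d)) g) h)"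
    by (simp add: sweedler2_def)
  also have "\<dots> = sw U (\<lambda>a b. tlift K U f (sw ?T (\<lambda>c d. tens K H H (a \<cdot> c) (b \<cdot> d)) g)) h"
    by (rule linear_map_of_sweedler2[OF module_HH U linear_map_tlift[OF H_mod H_mod U f] _ hg(1)])
      (intro linear_intros; simp add: hg)
  also have "\<dots> = sw U (\<lambda>a b. sw U (\<lambda>c d. f (a \<cdot> c) (b \<cdot> d)) g) h"
  proof (rule sweedler2_cong[OF refl hg(1)])
    fix a b assume ab: "a \<in> carrier H" "b \<in> carrier H"
    have "tlift K U f (sw ?T (\<lambda>c d. tens K H H (a \<cdot> c) (b \<cdot> d)) g)
       = sw U (\<lambda>c d. tlift K U f (tens K H H (a \<cdot> c) (b \<cdot> d))) g"
      by (rule linear_map_of_sweedler2[OF module_HH U linear_map_tlift[OF H_mod H_mod U f] _ hg(2)])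
        (intro linear_intros; simp add: ab)
    then show "tlift K U f (sw ?T (\<lambda>c d. tens K H H (a \<cdot> c) (b \<cdot> d)) g)
       = sw U (\<lambda>c d. f (a \<cdot> c) (b \<cdot> d)) g"
      using ab hg by (simp add: tlift_tens U f cong: sweedler2_cong)
  qed
  finally show ?thesis .
qed

section \<open>The antipode against unit, counit and coproduct\<close>

lemma antipode_one [simp]: "S \<one>\<^bsub>H\<^esub> = \<one>\<^bsub>H\<^esub>"
  using antipode_left[OF H_mod linear_map_id H.one_closed]
  by (subst (asm) sweedler2_one) ((intro linear_intros)?; simp)+

lemma counit_antipode [simp]:
  assumes h: "h \<in> carrier H" shows "counit H (S h) = counit H h"
proof -
  \<comment> \<open>Sweedler sums take values in a module over \<open>K\<close>, so the counit is
    composed with the unit of \<open>H\<close>; the scalar is read off at the end by applying the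
    counit.\<close>
  let ?f = "\<lambda>u. counit H u \<odot>\<^bsub>H\<^esub> \<one>\<^bsub>H\<^esub>"
  have "?f h = counit H h \<odot>\<^bsub>H\<^esub> ?f \<one>\<^bsub>H\<^esub>" using h by simp
  also have "\<dots> = sw H (\<lambda>a b. ?f (S a \<cdot> b)) h"
    by (rule antipode_left[OF H_mod _ h, symmetric]) (intro linear_intros; simp)
  also have "\<dots> = sw H (\<lambda>a b. counit H b \<odot>\<^bsub>H\<^esub> ?f (S a)) h"
    using h by (simp cong: sweedler2_cong add: HM.smult_assoc1[symmetric] HM.R.m_comm)
  also have "\<dots> = ?f (S h)"
    by (rule counit_right[OF H_mod _ h]) (intro linear_intros; simp)
  finally have "counit H (?f h) = counit H (?f (S h))" by simp
  then show ?thesis using h by (simp del: counit_mult)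
qed

text \<open>The left side is \<open>L\<close> at \<open>w1 S(w4) \<otimes> w2 S(w3)\<close>, the
  product of \<open>\<Delta>(w1)\<close> and \<open>(S \<otimes> S) \<tau> \<Delta>(w2)\<close>. The
  inner pair contracts first, which makes the outer pair adjacent.\<close>

lemma antipode_contract4:
  assumes U: "module K U" and L: "bilinear K H H U L" and w: "w \<in> carrier H"
  shows "sw U (\<lambda>y z. sw U (\<lambda>p q. sw U (\<lambda>c d. L (p \<cdot> S d) (q \<cdot> S c)) z) y) w
    = counit H w \<odot>\<^bsub>U\<^esub> L \<one>\<^bsub>H\<^esub> \<one>\<^bsub>H\<^esub>"
proof -
  note bl = bilinear_left_comp[OF L] bilinear_right_comp[OF L]
  have "sw U (\<lambda>y z. sw U (\<lambda>p q. sw U (\<lambda>c d. L (p \<cdot> S d) (q \<cdot> S c)) z) y) w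
     = sw U (\<lambda>p t. sw U (\<lambda>q z. sw U (\<lambda>c d. L (p \<cdot> S d) (q \<cdot> S c)) z) t) w"
    by (rule sweedler2_coassoc[OF U _ w]) (intro linear_intros bl; simp add: U)
  also have "\<dots> = sw U (\<lambda>p t. L (p \<cdot> S t) \<one>\<^bsub>H\<^esub>) w"
    by (rule sweedler2_cong[OF refl w],
      rule antipode_right_cancel[OF U, where J = "\<lambda>u d. L (_ \<cdot> S d) u"])
      ((intro linear_intros bl)?; simp)+
  also have "\<dots> = counit H w \<odot>\<^bsub>U\<^esub> L \<one>\<^bsub>H\<^esub> \<one>\<^bsub>H\<^esub>"
    by (rule antipode_right[OF U _ w]) (intro linear_intros bl; simp)
  finally show ?thesis .
qed

text \<open>\<open>\<Delta> S\<close> and \<open>(S \<otimes> S) \<tau> \<Delta>\<close> are both convolution inverses of \<open>\<Delta>\<close>: the expression \<open>?X\<close> below is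
  \<open>\<Delta>(S h\<^sub>(\<^sub>1\<^sub>)) \<Delta>(h\<^sub>(\<^sub>2\<^sub>)) (S \<otimes> S) \<tau> \<Delta>(h\<^sub>(\<^sub>3\<^sub>))\<close>, contracted in two ways.\<close>

lemma sweedler2_antipode:
  assumes U: "module K U" and F: "bilinear K H H U F" and h: "h \<in> carrier H"
  shows "sw U F (S h) = sw U (\<lambda>a b. F (S b) (S a)) h"
proof -
  interpret U: module K U by (rule U)
  note bl = bilinear_left_comp[OF F] bilinear_right_comp[OF F]
  let ?G = "\<lambda>u z. sw U (\<lambda>a b. sw U (\<lambda>c d. F (a \<cdot> S d) (b \<cdot> S c)) z) u"
  let ?X = "sw U (\<lambda>x t. sw U (\<lambda>y z. ?G (S x \<cdot> y) z) t) h"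
  \<comment> \<open>First contraction: \<open>S x \<cdot> y\<close> cancels, and the coproduct at 1
    is trivial.\<close>
  have "?X = ?G \<one>\<^bsub>H\<^esub> h"
    by (rule antipode_left_cancel[OF U _ h]) (intro linear_intros bl; simp add: U)
  also have "\<dots> = sw U (\<lambda>c d. F (\<one>\<^bsub>H\<^esub> \<cdot> S d) (\<one>\<^bsub>H\<^esub> \<cdot> S c)) h"
    by (rule sweedler2_one[OF U]) (intro linear_intros bl; simp add: U h)
  also have "\<dots> = sw U (\<lambda>a b. F (S b) (S a)) h"
    using h by (simp cong: sweedler2_cong)
  finally have 1: "?X = sw U (\<lambda>a b. F (S b) (S a)) h" .
  \<comment> \<open>Second contraction: the coproducts of \<open>S x\<close> and \<open>y\<close>
    are separated, and that of \<open>y\<close> cancels against the reversed antipodes of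
    \<open>z\<close>.\<close>
  have "?X = sw U (\<lambda>x t. counit H t \<odot>\<^bsub>U\<^esub> sw U F (S x)) h"
  proof (rule sweedler2_cong[OF refl h])
    fix x t assume xt: "x \<in> carrier H" "t \<in> carrier H"
    have "sw U (\<lambda>y z. ?G (S x \<cdot> y) z) t = sw U (\<lambda>y z. sw U (\<lambda>a b. sw U (\<lambda>p q.
        sw U (\<lambda>c d. F (a \<cdot> (p \<cdot> S d)) (b \<cdot> (q \<cdot> S c))) z) y) (S x)) t"
    proof (rule sweedler2_cong[OF refl xt(2)])
      fix y z assume yz: "y \<in> carrier H" "z \<in> carrier H"
      have "?G (S x \<cdot> y) z = sw U (\<lambda>a b. sw U (\<lambda>p q.
          sw U (\<lambda>c d. F (a \<cdot> p \<cdot> S d) (b \<cdot> q \<cdot> S c)) z) y) (S x)"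
        by (rule sweedler2_mult[OF U]) ((intro linear_intros bl)?; simp add: U xt yz)+
      then show "?G (S x \<cdot> y) z = sw U (\<lambda>a b. sw U (\<lambda>p q.
          sw U (\<lambda>c d. F (a \<cdot> (p \<cdot> S d)) (b \<cdot> (q \<cdot> S c))) z) y) (S x)"
        using xt yz by (simp cong: sweedler2_cong add: H.m_assoc)
    qed
    also have "\<dots> = sw U (\<lambda>a b. sw U (\<lambda>y z. sw U (\<lambda>p q.
        sw U (\<lambda>c d. F (a \<cdot> (p \<cdot> S d)) (b \<cdot> (q \<cdot> S c))) z) y) t) (S x)"
      by (rule sweedler2_swap[OF U]) ((intro linear_intros bl)?; simp add: U xt)+
    also have "\<dots> = sw U (\<lambda>a b. counit H t \<odot>\<^bsub>U\<^esub> F a b) (S x)"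
    proof (rule sweedler2_cong[OF refl])
      fix a b assume ab: "a \<in> carrier H" "b \<in> carrier H"
      show "sw U (\<lambda>y z. sw U (\<lambda>p q.
        sw U (\<lambda>c d. F (a \<cdot> (p \<cdot> S d)) (b \<cdot> (q \<cdot> S c))) z) y) t = counit H t \<odot>\<^bsub>U\<^esub> F a b"
        using antipode_contract4[OF U, of "\<lambda>u v. F (a \<cdot> u) (b \<cdot> v)", OF _ xt(2)] ab
        by (simp add: linear_intros bl)
    qed (use xt in simp)
    also have "\<dots> = counit H t \<odot>\<^bsub>U\<^esub> sw U F (S x)"
      by (rule linear_map_of_sweedler2[OF U U _ F, symmetric]) ((intro linear_intros)?; simp add: U xt)+
    finally show "sw U (\<lambda>y z. ?G (S x \<cdot> y) z) t = counit H t \<odot>\<^bsub>U\<^esub> sw U F (S x)" .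
  qed
  also have "\<dots> = sw U F (S h)"
    by (rule counit_right[OF U _ h]) (intro linear_intros bl F; simp add: U)
  finally show ?thesis using 1 by simp
qed

lemma sweedler2_zero:
  "module K U \<Longrightarrow> h \<in> carrier H \<Longrightarrow> sw U (\<lambda>a b. \<zero>\<^bsub>U\<^esub>) h = \<zero>\<^bsub>U\<^esub>"
  unfolding sweedler2_def by (rule tlift_zero[OF H_mod H_mod]) simp_all

lemma tlift_sweedler2:
  assumes "module K V" "module K W" "module K U" "bilinear K V W U f"
    "bilinear K H H (tensor_space K V W) g" "h \<in> carrier H"
  shows "tlift K U f (sw (tensor_space K V W) g h) = sw U (\<lambda>a b. tlift K U f (g a b)) h"
  by (rule linear_map_of_sweedler2[OF module_tensor_space[OF assms(1,2)] assms(3) linear_map_tlift[OF assms(1-4)] assms(5,6)])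

section \<open>The adjoint coaction\<close>

lemma Ad_eq: "Ad K H h = sw (tensor_space K H H) (\<lambda>a x. sw (tensor_space K H H)
    (\<lambda>b c. tens K H H b (S a \<cdot> c)) x) h"
  by (simp add: Ad_def sweedler3_def)

lemma Ad_closed [simp]: "h \<in> carrier H \<Longrightarrow> Ad K H h \<in> carrier (tensor_space K H H)"
  unfolding Ad_eq by (intro linear_intros; simp)

lemma linear_Ad [linear_intros]:
  "linear_map K V H f \<Longrightarrow> linear_map K V (tensor_space K H H) (\<lambda>x. Ad K H (f x))"
  unfolding Ad_eq by (intro linear_intros; simp)

text \<open>Turns a contraction with \<open>Ad\<close> into an iterated Sweedler sum, the form in
  which the Hopf algebra rules apply.\<close>

lemma tlift_Ad:
  assumes U: "module K U" and f: "bilinear K H H U f" and h: "h \<in> carrier H"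
  shows "tlift K U f (Ad K H h) = sw U (\<lambda>a x. sw U (\<lambda>b c. f b (S a \<cdot> c)) x) h"
proof -
  have "tlift K U f (Ad K H h) = sw U (\<lambda>a x. tlift K U f (sw (tensor_space K H H)
      (\<lambda>b c. tens K H H b (S a \<cdot> c)) x)) h"
    unfolding Ad_eq by (rule tlift_sweedler2[OF H_mod H_mod U f _ h]) (intro linear_intros; simp)
  also have "\<dots> = sw U (\<lambda>a x. sw U (\<lambda>b c. f b (S a \<cdot> c)) x) h"
  proof (rule sweedler2_cong[OF refl h])
    fix a x assume ax: "a \<in> carrier H" "x \<in> carrier H"
    have "tlift K U f (sw (tensor_space K H H) (\<lambda>b c. tens K H H b (S a \<cdot> c)) x)
      = sw U (\<lambda>b c. tlift K U f (tens K H H b (S a \<cdot> c))) x"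
      by (rule tlift_sweedler2[OF H_mod H_mod U f _ ax(2)]) (intro linear_intros; simp add: ax)
    then show "tlift K U f (sw (tensor_space K H H) (\<lambda>b c. tens K H H b (S a \<cdot> c)) x)
      = sw U (\<lambda>b c. f b (S a \<cdot> c)) x"
      using ax by (simp add: tlift_tens[OF H_mod H_mod U f] cong: sweedler2_cong)
  qed
  finally show ?thesis .
qed

text \<open>The diagonal coaction intertwines \<open>r \<mapsto> S r\<^sub>(\<^sub>1\<^sub>) \<otimes> r\<^sub>(\<^sub>2\<^sub>)\<close> with \<open>Ad\<close>.\<close>

lemma antipode_form_coaction:
  assumes V: "module K V" and U: "module K U" and Y: "bilinear K H H V Y" and R: "bilinear K V H U R"
    and r: "r \<in> carrier H"
  shows "sw U (\<lambda>a b. sw U (\<lambda>k l. sw U (\<lambda>c d. R (Y k c) (l \<cdot> d)) b) (S a)) r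
    = tlift K U (\<lambda>s w. R (sw V (\<lambda>a c. Y (S a) c) s) w) (Ad K H r)"
proof -
  note bl = bilinear_left_comp[OF R] bilinear_right_comp[OF R] bilinear_left_comp[OF Y] bilinear_right_comp[OF Y]
    bilinear_closed[OF Y] bilinear_closed[OF R]
  \<comment> \<open>Reversing the coproduct at \<open>S a\<close> leaves four legs, with
    \<open>S r2\<close> and \<open>r3\<close> under \<open>Y\<close> and
    \<open>S r1 \<cdot> r4\<close> outside. Grouping the inner pair into one leg \<open>s\<close>
    produces the three legs of \<open>Ad r\<close>.\<close>
  have "sw U (\<lambda>a b. sw U (\<lambda>k l. sw U (\<lambda>c d. R (Y k c) (l \<cdot> d)) b) (S a)) r
    = sw U (\<lambda>a b. sw U (\<lambda>k l. sw U (\<lambda>c d. R (Y (S l) c) (S k \<cdot> d)) b) a) r"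
    by (rule sweedler2_cong[OF refl r], rule sweedler2_antipode[OF U])
      ((intro linear_intros bl)?; simp add: U V bl)+
  also have "\<dots> = sw U (\<lambda>k x. sw U (\<lambda>l b. sw U (\<lambda>c d. R (Y (S l) c) (S k \<cdot> d)) b) x) r"
    by (rule sweedler2_coassoc[OF U _ r]) (intro linear_intros bl; simp add: U V bl)
  also have "\<dots> = sw U (\<lambda>k x. sw U (\<lambda>s d. sw U (\<lambda>l c. R (Y (S l) c) (S k \<cdot> d)) s) x) r"
    by (rule sweedler2_cong[OF refl r], rule sweedler2_coassoc[OF U, symmetric])
      ((intro linear_intros bl)?; simp add: U V bl)+
  also have "\<dots> = sw U (\<lambda>k x. sw U (\<lambda>s d. R (sw V (\<lambda>l c. Y (S l) c) s) (S k \<cdot> d)) x) r"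
  proof (rule sweedler2_cong[OF refl r], rule sweedler2_cong[OF refl])
    fix k s d assume A: "k \<in> carrier H" "s \<in> carrier H" "d \<in> carrier H"
    show "sw U (\<lambda>l c. R (Y (S l) c) (S k \<cdot> d)) s = R (sw V (\<lambda>l c. Y (S l) c) s) (S k \<cdot> d)"
      by (rule linear_map_of_sweedler2[OF V U, symmetric, of "\<lambda>v. R v (S k \<cdot> d)"])
        ((intro linear_intros bl)?; simp add: A U V bl)+
  qed
  also have "\<dots> = tlift K U (\<lambda>s w. R (sw V (\<lambda>a c. Y (S a) c) s) w) (Ad K H r)"
    by (rule tlift_Ad[OF U _ r, symmetric]) (intro linear_intros bl; simp add: U V bl)
  finally show ?thesis .
qed

text \<open>This is \<open>(id \<otimes> \<Delta>) Ad = (Ad \<otimes> id) Ad\<close>.\<close>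

lemma Ad_comodule:
  assumes U: "module K U" and h: "h \<in> carrier H"
    and G: "\<And>b. b \<in> carrier H \<Longrightarrow> bilinear K H H U (G b)"
    and G': "\<And>u v. u \<in> carrier H \<Longrightarrow> v \<in> carrier H \<Longrightarrow> linear_map K H U (\<lambda>b. G b u v)"
  shows "tlift K U (\<lambda>b u. sw U (G b) u) (Ad K H h) = tlift K U (\<lambda>s v. tlift K U (\<lambda>b u. G b u v) (Ad K H s)) (Ad K H h)"
proof -
  note bl = linear_map_comp[OF G'] bilinear_left_comp[OF G] bilinear_right_comp[OF G]
    bilinear_closed[OF G] G
  have "tlift K U (\<lambda>b u. sw U (\<lambda>p q. G b p q) u) (Ad K H h)
     = sw U (\<lambda>a x. sw U (\<lambda>b c. sw U (\<lambda>p q. G b p q) (S a \<cdot> c)) x) h"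
    by (rule tlift_Ad[OF U _ h]) (intro linear_intros bl; simp add: U)
  also have "\<dots> = sw U (\<lambda>a x. sw U (\<lambda>b c. sw U (\<lambda>k l. sw U (\<lambda>r t. G b (S l \<cdot> r) (S k \<cdot> t)) c) a) x) h"
  proof (rule sweedler2_cong[OF refl h], rule sweedler2_cong[OF refl])
    fix a x b c assume A: "a \<in> carrier H" "b \<in> carrier H" "c \<in> carrier H"
    have "sw U (\<lambda>p q. G b p q) (S a \<cdot> c)
       = sw U (\<lambda>k l. sw U (\<lambda>r t. G b (k \<cdot> r) (l \<cdot> t)) c) (S a)"
      by (rule sweedler2_mult[OF U]) (simp_all add: A G)
    also have "\<dots> = sw U (\<lambda>k l. sw U (\<lambda>r t. G b (S l \<cdot> r) (S k \<cdot> t)) c) a"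
      by (rule sweedler2_antipode[OF U]) ((intro linear_intros bl)?; simp add: A U)+
    finally show "sw U (\<lambda>p q. G b p q) (S a \<cdot> c)
      = sw U (\<lambda>k l. sw U (\<lambda>r t. G b (S l \<cdot> r) (S k \<cdot> t)) c) a" .
  qed simp
  \<comment> \<open>The five legs are to be ordered as \<open>k, l, b, r, t\<close>. The swap moves
    \<open>k\<close> and \<open>l\<close> to the front; coassociativity then groups
    \<open>l, b, r\<close> into a leg \<open>s\<close>, on which they form \<open>Ad s\<close>, with
    \<open>S k \<cdot> t\<close> outside.\<close>
  also have "\<dots> = sw U (\<lambda>a x. sw U (\<lambda>k l. sw U (\<lambda>b c. sw U (\<lambda>r t. G b (S l \<cdot> r) (S k \<cdot> t)) c) x) a) h"
    by (rule sweedler2_cong[OF refl h], rule sweedler2_swap[OF U]) ((intro linear_intros bl)?; simp add: U)+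
  also have "\<dots> = sw U (\<lambda>k y. sw U (\<lambda>l x. sw U (\<lambda>b c. sw U (\<lambda>r t. G b (S l \<cdot> r) (S k \<cdot> t)) c) x) y) h"
    by (rule sweedler2_coassoc[OF U _ h]) (intro linear_intros bl; simp add: U)
  also have "\<dots> = sw U (\<lambda>k y. sw U (\<lambda>l x. sw U (\<lambda>c t. sw U (\<lambda>b r. G b (S l \<cdot> r) (S k \<cdot> t)) c) x) y) h"
    by (rule sweedler2_cong[OF refl h], rule sweedler2_cong[OF refl], assumption, rule sweedler2_coassoc[OF U, symmetric])
      ((intro linear_intros bl)?; simp add: U)+
  also have "\<dots> = sw U (\<lambda>k y. sw U (\<lambda>s t. sw U (\<lambda>l c. sw U (\<lambda>b r. G b (S l \<cdot> r) (S k \<cdot> t)) c) s) y) h"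
    by (rule sweedler2_cong[OF refl h], rule sweedler2_coassoc[OF U, symmetric]) ((intro linear_intros bl)?; simp add: U)+
  also have "\<dots> = sw U (\<lambda>k y. sw U (\<lambda>s t. tlift K U (\<lambda>b u. G b u (S k \<cdot> t)) (Ad K H s)) y) h"
    by (rule sweedler2_cong[OF refl h], rule sweedler2_cong[OF refl], assumption, rule tlift_Ad[OF U, symmetric])
      ((intro linear_intros bl)?; simp add: U)+
  also have "\<dots> = tlift K U (\<lambda>s v. tlift K U (\<lambda>b u. G b u v) (Ad K H s)) (Ad K H h)"
  proof (rule tlift_Ad[OF U _ h, symmetric])
    have bil: "bilinear K H H U (\<lambda>b u. G b u v)" if "v \<in> carrier H" for v
      by (intro linear_intros bl; simp add: that)
    show "bilinear K H H U (\<lambda>s v. tlift K U (\<lambda>b u. G b u v) (Ad K H s))"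
      by (intro bilinearI linear_map_tlift_arg[OF H_mod H_mod U] linear_map_tlift_param[OF H_mod H_mod U] bil
          linear_Ad linear_map_id bilinear_right[OF G]) simp_all
  qed
  finally show ?thesis .
qed

text \<open>Membership in \<open>N\<close> becomes an equation in the quotient by \<open>N\<close>,
  where the sum vanishes term by term.\<close>

lemma sweedler2_in_submodule:
  assumes U: "module K U" and N: "submodule N K U" and f: "bilinear K H H U f" and h: "h \<in> carrier H"
    and mem: "\<And>a b. a \<in> carrier H \<Longrightarrow> b \<in> carrier H \<Longrightarrow> f a b \<in> N"
  shows "sw U f h \<in> N"
proof -
  let ?Q = "quotient_module K U N"
  note Q = module_quotient[OF U N]
  have "N +>\<^bsub>U\<^esub> sw U f h = sw ?Q (\<lambda>a b. N +>\<^bsub>U\<^esub> f a b) h"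
    by (rule linear_map_of_sweedler2[OF U Q linear_map_coset[OF U N] f h])
  also have "\<dots> = sw ?Q (\<lambda>a b. \<zero>\<^bsub>?Q\<^esub>) h"
    by (rule sweedler2_cong[OF refl h]) (simp add: coset_zero_iff[OF U N] bilinear_closed[OF f] mem zero_quotient)
  also have "\<dots> = N" using sweedler2_zero[OF Q h] by (simp add: zero_quotient)
  finally show ?thesis
    using coset_zero_iff[OF U N linear_map_closed[OF linear_map_sweedler2[OF U f linear_map_id] h]] by simp
qed

end

section \<open>Tensor product algebras\<close>

lemma tensor_algebra_simps [simp]:
  "carrier (tensor_algebra K A B) = carrier (tensor_space K A B)"
  "add (tensor_algebra K A B) = add (tensor_space K A B)"
  "zero (tensor_algebra K A B) = zero (tensor_space K A B)"
  "smult (tensor_algebra K A B) = smult (tensor_space K A B)"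
  "\<one>\<^bsub>tensor_algebra K A B\<^esub> = tens K A B \<one>\<^bsub>A\<^esub> \<one>\<^bsub>B\<^esub>"
  by (simp_all add: tensor_algebra_def)

lemma linear_map_tensor_algebra_dom [simp]:
  "linear_map K (tensor_algebra K A B) U f \<longleftrightarrow> linear_map K (tensor_space K A B) U f"
  by (simp add: linear_map_def)

lemma linear_map_tensor_algebra_cod [simp]:
  "linear_map K V (tensor_algebra K A B) f \<longleftrightarrow> linear_map K V (tensor_space K A B) f"
  by (simp add: linear_map_def)

text \<open>\<open>tensor_algebra\<close> changes only \<open>mult\<close> and \<open>one\<close> of
  \<open>tensor_space\<close>, so the additive axioms carry over field by field.\<close>

lemma abelian_group_transfer:
  assumes "abelian_group V" "carrier W = carrier V" "add W = add V" "zero W = zero V"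
  shows "abelian_group W"
proof -
  interpret V: abelian_group V by fact
  show ?thesis
    by (rule abelian_groupI) (auto simp: assms(2-4) V.a_ac intro!: bexI[where x = "\<ominus>\<^bsub>V\<^esub> _"] V.l_neg)
qed

lemma module_tensor_algebra:
  assumes "module K A" "module K B"
  shows "module K (tensor_algebra K A B)"
proof -
  interpret T: module K "tensor_space K A B" by (rule module_tensor_space[OF assms])
  show ?thesis
  proof (rule moduleI)
    show "abelian_group (tensor_algebra K A B)"
      by (rule abelian_group_transfer[OF T.M.abelian_group_axioms]) simp_all
  qed (simp_all add: T.R.is_cring T.smult_l_distr T.smult_r_distr T.smult_assoc1)
qed

locale algebra_pair =
  fixes K :: "'k ring" and A :: "('k, 'a, 'x) module_scheme" and B :: "('k, 'b, 'y) module_scheme"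
  assumes A_alg: "unital_algebra K A" and B_alg: "unital_algebra K B"
begin

abbreviation "T \<equiv> tensor_space K A B"
abbreviation "P \<equiv> tensor_algebra K A B"
abbreviation "t \<equiv> tens K A B"

lemma pair_mods: "module K A" "module K B" "module K T" "module K P"
  using A_alg B_alg by (simp_all add: unital_algebra_module module_tensor_space module_tensor_algebra)

sublocale A: ring A by (rule unital_algebra_ring[OF A_alg])
sublocale B: ring B by (rule unital_algebra_ring[OF B_alg])

lemma inner_bilinear:
  assumes "a \<in> carrier A" "b \<in> carrier B"
  shows "bilinear K A B T (\<lambda>a' b'. t (a \<otimes>\<^bsub>A\<^esub> a') (b \<otimes>\<^bsub>B\<^esub> b'))"
  by (intro linear_intros pair_mods A_alg B_alg; simp add: assms)

lemma outer_bilinear: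
  assumes "y \<in> carrier T"
  shows "bilinear K A B T (\<lambda>a b. tlift K T (\<lambda>a' b'. t (a \<otimes>\<^bsub>A\<^esub> a') (b \<otimes>\<^bsub>B\<^esub> b')) y)"
  by (intro bilinearI linear_map_tlift_param[OF pair_mods(1-3)] inner_bilinear pair_mods assms linear_intros A_alg B_alg)
    simp_all

lemma tensor_mult: "x \<otimes>\<^bsub>P\<^esub> y = tlift K T (\<lambda>a b. tlift K T (\<lambda>a' b'. t (a \<otimes>\<^bsub>A\<^esub> a') (b \<otimes>\<^bsub>B\<^esub> b')) y) x"
  by (simp add: tensor_algebra_def)

lemma tensor_mult_tens [simp]:
  assumes "a \<in> carrier A" "b \<in> carrier B" "a' \<in> carrier A" "b' \<in> carrier B"
  shows "t a b \<otimes>\<^bsub>P\<^esub> t a' b' = t (a \<otimes>\<^bsub>A\<^esub> a') (b \<otimes>\<^bsub>B\<^esub> b')"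
  unfolding tensor_mult using assms
  by (simp add: tlift_tens[OF pair_mods(1-3)] outer_bilinear inner_bilinear tens_closed pair_mods)

lemma bilinear_tensor_mult: "bilinear K T T T (\<lambda>x y. x \<otimes>\<^bsub>P\<^esub> y)"
  unfolding tensor_mult
  by (intro bilinearI linear_map_tlift linear_map_tlift_param[OF pair_mods(1-3)] outer_bilinear inner_bilinear pair_mods)

lemma tens_eqI:
  assumes "module K U" "linear_map K T U f" "linear_map K T U g"
    and "\<And>a b. a \<in> carrier A \<Longrightarrow> b \<in> carrier B \<Longrightarrow> f (t a b) = g (t a b)" and "x \<in> carrier T"
  shows "f x = g x"
  by (rule linear_map_eq_on_tensor_space[OF pair_mods(1,2) assms])

lemma tens_one_closed: "t \<one>\<^bsub>A\<^esub> \<one>\<^bsub>B\<^esub> \<in> carrier T"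
  by (simp add: tens_closed pair_mods)

lemma tensor_mult_assoc:
  assumes "x \<in> carrier T" "y \<in> carrier T" "z \<in> carrier T"
  shows "x \<otimes>\<^bsub>P\<^esub> y \<otimes>\<^bsub>P\<^esub> z = x \<otimes>\<^bsub>P\<^esub> (y \<otimes>\<^bsub>P\<^esub> z)"
proof -
  note bl = bilinear_left_comp[OF bilinear_tensor_mult] bilinear_right_comp[OF bilinear_tensor_mult]
    linear_map_id bilinear_closed[OF bilinear_tensor_mult] tens_closed[OF pair_mods(1,2)]
  show ?thesis
  proof (rule tens_eqI[OF pair_mods(3) _ _ _ assms(1)], goal_cases)
    case (3 a b)
    show ?case
    proof (rule tens_eqI[OF pair_mods(3) _ _ _ assms(2)], goal_cases)
      case (3 c d)
      show ?case
        by (rule tens_eqI[OF pair_mods(3) _ _ _ assms(3)])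
          (use \<open>a \<in> _\<close> \<open>b \<in> _\<close> \<open>c \<in> _\<close> \<open>d \<in> _\<close> in
            \<open>(intro bl; simp add: tens_closed pair_mods) | simp add: A.m_assoc B.m_assoc\<close>)+
    qed (intro bl assms; simp add: 3)+
  qed (intro bl assms)+
qed

lemma unital_algebra_tensor: "unital_algebra K P"
proof -
  interpret T: module K T by (rule pair_mods)
  interpret P: module K P by (rule pair_mods)
  note bl = bilinear_left[OF bilinear_tensor_mult] bilinear_right[OF bilinear_tensor_mult]
    linear_map_id bilinear_closed[OF bilinear_tensor_mult]
  note [simp] = tens_one_closed bilinear_closed[OF bilinear_tensor_mult]
    linear_map_add[OF bilinear_left[OF bilinear_tensor_mult]]
    linear_map_add[OF bilinear_right[OF bilinear_tensor_mult]]
    linear_map_smult[OF bilinear_left[OF bilinear_tensor_mult]]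
    linear_map_smult[OF bilinear_right[OF bilinear_tensor_mult]]
  have "ring P"
  proof (rule ringI)
    show "abelian_group P" by (rule P.M.abelian_group_axioms)
    show "Group.monoid P"
    proof (rule monoidI)
      fix x assume x: "x \<in> carrier P"
      have "t \<one>\<^bsub>A\<^esub> \<one>\<^bsub>B\<^esub> \<otimes>\<^bsub>P\<^esub> x = x"
        by (rule tens_eqI[OF pair_mods(3)]) (use x in \<open>simp_all add: bl\<close>)
      then show "\<one>\<^bsub>P\<^esub> \<otimes>\<^bsub>P\<^esub> x = x" by simp
      have "x \<otimes>\<^bsub>P\<^esub> t \<one>\<^bsub>A\<^esub> \<one>\<^bsub>B\<^esub> = x"
        by (rule tens_eqI[OF pair_mods(3)]) (use x in \<open>simp_all add: bl\<close>)
      then show "x \<otimes>\<^bsub>P\<^esub> \<one>\<^bsub>P\<^esub> = x" by simp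
    qed (simp_all add: tensor_mult_assoc)
  qed simp_all
  then show ?thesis by (simp add: unital_algebra_def pair_mods)
qed

end

section \<open>First order differential calculi\<close>

text \<open>Serves the base, the Hopf algebra and the total space alike, the last two also with zero
  relations, so that quotient maps and left actions are treated once.\<close>

locale calculus =
  fixes K :: "'k ring" and A :: "('k, 'a, 'x) module_scheme" and N :: "('k, 'a, 'a) tens set"
  assumes A_alg: "unital_algebra K A"
    and N_sub: "submodule N K (univ_forms K A)"
    and N_lact: "\<And>a x. a \<in> carrier A \<Longrightarrow> x \<in> N \<Longrightarrow> lact K A a x \<in> N"
begin

abbreviation "T \<equiv> tensor_space K A A"
abbreviation "t \<equiv> tens K A A"
abbreviation "Om \<equiv> univ_forms K A"

definition mul :: "('k, 'a, 'a) tens \<Rightarrow> 'a" where "mul = tlift K A (\<lambda>a b. a \<otimes>\<^bsub>A\<^esub> b)"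

lemma mods: "module K A" "module K T"
  using A_alg by (simp_all add: unital_algebra_module module_tensor_space)

sublocale A: ring A by (rule unital_algebra_ring[OF A_alg])
sublocale AM: module K A by (rule mods)
sublocale T: module K T by (rule mods)

lemma linear_mul: "linear_map K T A mul"
  unfolding mul_def by (intro linear_map_tlift mods bilinear_mult A_alg)

lemma mul_tens [simp]: "a \<in> carrier A \<Longrightarrow> b \<in> carrier A \<Longrightarrow> mul (t a b) = a \<otimes>\<^bsub>A\<^esub> b"
  unfolding mul_def by (simp add: tlift_tens mods bilinear_mult A_alg)

lemma t_closed [simp]: "a \<in> carrier A \<Longrightarrow> b \<in> carrier A \<Longrightarrow> t a b \<in> carrier T"
  by (simp add: tens_closed mods)

lemma mul_closed [simp]: "x \<in> carrier T \<Longrightarrow> mul x \<in> carrier A"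
  by (rule linear_map_closed[OF linear_mul])

lemma univ_carrier: "carrier Om = {x \<in> carrier T. mul x = \<zero>\<^bsub>A\<^esub>}"
  by (simp add: univ_forms_def mul_def)

lemma univ_ops [simp]: "add Om = add T" "zero Om = zero T" "smult Om = smult T"
  by (simp_all add: univ_forms_def)

lemma module_Om: "module K Om"
proof -
  have "submodule {x \<in> carrier T. mul x \<in> {\<zero>\<^bsub>A\<^esub>}} K T"
    by (rule submodule_preimage[OF mods(2,1) linear_mul zero_submodule[OF mods(1)]])
  then have "module K (T\<lparr>carrier := {x \<in> carrier T. mul x \<in> {\<zero>\<^bsub>A\<^esub>}}\<rparr>)"
    by (rule submodule.submodule_is_module) (rule mods)
  then show ?thesis by (simp add: univ_forms_def mul_def)
qed

sublocale Om: module K Om by (rule module_Om)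

lemma module_forms: "module K (forms K A N)"
  unfolding forms_def by (intro module_quotient module_Om N_sub)

sublocale F: module K "forms K A N" by (rule module_forms)

text \<open>The projection of \<open>A \<otimes> A\<close> onto \<Omega>^1 along
  \<open>A \<otimes> 1\<close>. It sends \<open>a \<otimes> b\<close> to
  \<open>a \<otimes> b - ab \<otimes> 1\<close>, which is \<open>a db\<close>.\<close>

definition resid :: "('k, 'a, 'a) tens \<Rightarrow> ('k, 'a, 'a) tens"
  where "resid x = x \<ominus>\<^bsub>T\<^esub> t (mul x) \<one>\<^bsub>A\<^esub>"

text \<open>The quotient map of \<open>\<Omega>\<^sup>1A\<close>, extended to all of \<open>A \<otimes> A\<close> by sending \<open>a \<otimes> b\<close> to \<open>a db\<close>, so that
  it can be applied to a single tensor.\<close>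

definition form_of :: "('k, 'a, 'a) tens \<Rightarrow> ('k, 'a, 'a) tens set"
  where "form_of x = form_proj K A N (resid x)"

lemma linear_tens_one: "linear_map K T T (\<lambda>x. t (mul x) \<one>\<^bsub>A\<^esub>)"
  by (intro linear_intros mods linear_mul) simp

lemma linear_resid: "linear_map K T Om resid"
proof -
  have lin: "linear_map K T T (\<lambda>x. x \<ominus>\<^bsub>T\<^esub> t (mul x) \<one>\<^bsub>A\<^esub>)"
    by (intro linear_map_diff mods linear_map_id linear_tens_one)
  have "mul (x \<ominus>\<^bsub>T\<^esub> t (mul x) \<one>\<^bsub>A\<^esub>) = \<zero>\<^bsub>A\<^esub>" if "x \<in> carrier T" for x
    using that linear_map_minus[OF mods(2,1) linear_mul, of x "t (mul x) \<one>\<^bsub>A\<^esub>"]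
    by (simp add: a_minus_def A.r_neg)
  with lin show ?thesis by (auto simp: linear_map_def univ_carrier Pi_def resid_def)
qed

lemma linear_form_of: "linear_map K T (forms K A N) form_of"
  unfolding form_of_def form_proj_def forms_def
  by (rule linear_map_comp[OF linear_map_coset[OF module_Om N_sub] linear_resid])

lemma form_of_closed [simp]: "x \<in> carrier T \<Longrightarrow> form_of x \<in> carrier (forms K A N)"
  by (rule linear_map_closed[OF linear_form_of])

lemma resid_univ: "x \<in> carrier Om \<Longrightarrow> resid x = x"
  using linear_map_zero[OF mods(1,2), of "\<lambda>a. t a \<one>\<^bsub>A\<^esub>"] T.M.add.inv_one
  by (simp add: resid_def univ_carrier linear_intros mods a_minus_def)

lemma form_of_univ: "x \<in> carrier Om \<Longrightarrow> form_of x = form_proj K A N x"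
  by (simp add: form_of_def resid_univ)

lemma forms_cases:
  assumes "X \<in> carrier (forms K A N)"
  obtains x where "x \<in> carrier Om" "x \<in> carrier T" "X = form_of x"
proof -
  obtain x where "x \<in> carrier Om" "X = form_proj K A N x"
    using assms by (auto simp: forms_def carrier_quotient form_proj_def)
  then show ?thesis using that[of x] by (simp add: form_of_univ univ_carrier)
qed

lemma form_of_tens_one [simp]:
  assumes "a \<in> carrier A" shows "form_of (t a \<one>\<^bsub>A\<^esub>) = \<zero>\<^bsub>forms K A N\<^esub>"
  using assms coset_zero_iff[OF module_Om N_sub Om.M.zero_closed] submodule_zero_closed[OF module_Om N_sub]
  by (simp add: form_of_def resid_def form_proj_def forms_def zero_quotient a_minus_def T.M.r_neg)

lemma N_univ: "x \<in> N \<Longrightarrow> x \<in> carrier Om"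
  using Om.submoduleE(1)[OF N_sub] by auto

lemma N_T: "x \<in> N \<Longrightarrow> x \<in> carrier T"
  using N_univ by (simp add: univ_carrier)

lemma form_of_N [simp]:
  assumes "x \<in> N" shows "form_of x = \<zero>\<^bsub>forms K A N\<^esub>"
  using assms form_of_univ[OF N_univ] coset_zero_iff[OF module_Om N_sub N_univ]
  by (simp add: form_proj_def forms_def zero_quotient)

lemma linear_map_Om: "linear_map K T U f \<Longrightarrow> linear_map K Om U f"
  by (auto simp: linear_map_def univ_carrier)

text \<open>Since \<open>A \<otimes> A\<close> is the sum of the one-forms and
  \<open>A \<otimes> 1\<close>, a map on classes of forms can be given by an \<open>f\<close> on all
  tensors that kills \<open>N\<close> and \<open>A \<otimes> 1\<close>. The separate
  \<open>g\<close> is the formula of a definition, which need agree with \<open>f\<close> only on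
  one-forms.\<close>

lemma induced_form_of:
  assumes U: "module K U" and f: "linear_map K T U f"
    and N: "\<And>x. x \<in> N \<Longrightarrow> f x = \<zero>\<^bsub>U\<^esub>" and one: "\<And>a. a \<in> carrier A \<Longrightarrow> f (t a \<one>\<^bsub>A\<^esub>) = \<zero>\<^bsub>U\<^esub>"
    and g: "\<And>x. x \<in> carrier Om \<Longrightarrow> g x = f x"
  shows "x \<in> carrier T \<Longrightarrow> induced g (form_of x) = f x"
    and "linear_map K (forms K A N) U (induced g)"
proof -
  interpret U: module K U by (rule U)
  have ind: "induced g (form_proj K A N y) = induced f (form_proj K A N y)" if "y \<in> carrier Om" for y
  proof -
    have "form_proj K A N y \<subseteq> carrier Om"
      using mem_coset_iff[OF module_Om N_sub that] by (auto simp: form_proj_def)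
    then have "g ` form_proj K A N y = f ` form_proj K A N y" using g by (intro image_cong) auto
    then show ?thesis by (simp add: induced_def)
  qed
  have resid: "resid x \<in> carrier Om" if "x \<in> carrier T" for x
    using linear_map_closed[OF linear_resid that] .
  show "induced g (form_of x) = f x" if x: "x \<in> carrier T"
  proof -
    have "induced g (form_of x) = f (resid x)"
      unfolding form_of_def ind[OF resid[OF x]] unfolding form_proj_def
      by (rule induced_coset[OF module_Om N_sub U linear_map_Om[OF f] N resid[OF x]])
    also have "\<dots> = f x"
      using x linear_map_minus[OF mods(2) U f, of x "t (mul x) \<one>\<^bsub>A\<^esub>"] linear_map_closed[OF f x]
        U.M.add.inv_one
      by (simp add: resid_def one a_minus_def)
    finally show ?thesis .
  qed
  have "linear_map K (forms K A N) U (induced f)"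
    unfolding forms_def by (rule linear_map_induced[OF module_Om N_sub U linear_map_Om[OF f] N])
  then show "linear_map K (forms K A N) U (induced g)"
  proof (rule linear_map_cong[OF _ _ module_forms])
    fix X assume "X \<in> carrier (forms K A N)"
    then show "induced f X = induced g X"
      by (elim forms_cases) (simp add: form_of_univ ind)
  qed
qed

lemma bilinear_lact: "bilinear K A T T (\<lambda>a x. lact K A a x)"
  unfolding lact_def
  by (intro bilinearI linear_map_tlift linear_map_tlift_param[OF mods(1,1,2)] mods linear_intros A_alg) simp_all

lemma lact_tens [simp]:
  "a \<in> carrier A \<Longrightarrow> b \<in> carrier A \<Longrightarrow> c \<in> carrier A \<Longrightarrow> lact K A a (t b c) = t (a \<otimes>\<^bsub>A\<^esub> b) c"
  unfolding lact_def
  by (subst tlift_tens[OF mods(1,1,2)]) ((intro linear_intros mods A_alg)?; simp)+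

lemma lact_closed [simp]: "a \<in> carrier A \<Longrightarrow> x \<in> carrier T \<Longrightarrow> lact K A a x \<in> carrier T"
  by (rule bilinear_closed[OF bilinear_lact])

lemma mul_lact:
  assumes "a \<in> carrier A" "x \<in> carrier T"
  shows "mul (lact K A a x) = a \<otimes>\<^bsub>A\<^esub> mul x"
  by (rule linear_map_eq_on_tensor_space[OF mods(1,1,1) linear_map_comp[OF linear_mul
          bilinear_right[OF bilinear_lact assms(1)]] _ _ assms(2)])
    (use assms(1) in \<open>simp_all add: linear_intros A_alg linear_mul A.m_assoc\<close>)

lemma lact_univ: "a \<in> carrier A \<Longrightarrow> x \<in> carrier Om \<Longrightarrow> lact K A a x \<in> carrier Om"
  by (simp add: univ_carrier mul_lact)

lemma form_lact_props:
  assumes "a \<in> carrier A"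
  shows "x \<in> carrier T \<Longrightarrow> form_lact K A N a (form_of x) = form_of (lact K A a x)"
    and "linear_map K (forms K A N) (forms K A N) (form_lact K A N a)"
  unfolding form_lact_def
  by (rule induced_form_of[OF module_forms linear_map_comp[OF linear_form_of
        bilinear_right[OF bilinear_lact assms]]]; simp add: assms N_lact form_of_univ lact_univ)+

lemmas form_lact_form_of [simp] = form_lact_props(1)

lemma form_d_form_of: "a \<in> carrier A \<Longrightarrow> form_d K A N a = form_of (t \<one>\<^bsub>A\<^esub> a)"
  by (simp add: form_d_def form_of_def univ_d_def resid_def)

lemma form_lact_closed [simp]:
  "a \<in> carrier A \<Longrightarrow> X \<in> carrier (forms K A N) \<Longrightarrow> form_lact K A N a X \<in> carrier (forms K A N)"
  by (rule linear_map_closed[OF form_lact_props(2)])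

lemma bilinear_form_lact: "bilinear K A (forms K A N) (forms K A N) (\<lambda>a X. form_lact K A N a X)"
proof (intro bilinearI form_lact_props(2))
  fix X assume "X \<in> carrier (forms K A N)"
  then obtain x where x: "x \<in> carrier T" "X = form_of x" by (elim forms_cases)
  show "linear_map K A (forms K A N) (\<lambda>a. form_lact K A N a X)"
  proof (rule linear_map_cong[OF _ _ mods(1)])
    show "linear_map K A (forms K A N) (\<lambda>a. form_of (lact K A a x))"
      by (rule linear_map_comp[OF linear_form_of bilinear_left[OF bilinear_lact x(1)]])
  qed (simp add: x)
qed

end

lemma (in calculus) submodule_OmI:
  assumes "submodule N' K T" "N' \<subseteq> carrier Om"
  shows "submodule N' K Om"
proof (rule Om.submoduleI[OF assms(2)])
  fix x assume x: "x \<in> N'"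
  \<comment> \<open>Additive inverses depend on the carrier of the record, so those of
    \<open>Om\<close> are compared with those of \<open>T\<close> through the scalar -1, whose
    action the two share.\<close>
  then have "\<ominus>\<^bsub>Om\<^esub> x = (\<ominus>\<^bsub>K\<^esub> \<one>\<^bsub>K\<^esub>) \<odot>\<^bsub>T\<^esub> x"
    using assms(2) Om.smult_l_minus[of "\<one>\<^bsub>K\<^esub>" x] Om.smult_one[of x] by auto
  then show "\<ominus>\<^bsub>Om\<^esub> x \<in> N'"
    using T.submoduleE(4)[OF assms(1)] x by simp
qed (use assms T.submoduleE[OF assms(1)] submodule_zero_closed[OF mods(2) assms(1)] in auto)

text \<open>This instance provides the product and the left action on \<open>A \<otimes> A\<close> before the relations of
  interest are known to form a submodule of \<open>\<Omega>\<^sup>1A\<close>.\<close>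

lemma calculus_zero:
  assumes A: "unital_algebra K A" shows "calculus K A {\<zero>\<^bsub>tensor_space K A A\<^esub>}"
proof -
  interpret A: ring A by (rule unital_algebra_ring[OF A])
  have mods: "module K A" "module K (tensor_space K A A)"
    using A by (simp_all add: unital_algebra_module module_tensor_space)
  interpret T: module K "tensor_space K A A" by (rule mods)
  interpret A: module K A by (rule mods)
  have mul: "linear_map K (tensor_space K A A) A (tlift K A (\<lambda>a b. a \<otimes>\<^bsub>A\<^esub> b))"
    by (intro linear_map_tlift mods bilinear_mult A)
  have "submodule {x \<in> carrier (tensor_space K A A). tlift K A (\<lambda>a b. a \<otimes>\<^bsub>A\<^esub> b) x \<in> {\<zero>\<^bsub>A\<^esub>}} K (tensor_space K A A)"
    by (rule submodule_preimage[OF mods(2,1) mul zero_submodule[OF mods(1)]])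
  then have Om: "module K (univ_forms K A)"
    using submodule.submodule_is_module[OF _ mods(2)] by (auto simp: univ_forms_def)
  show ?thesis
  proof (rule calculus.intro[OF A])
    show "submodule {\<zero>\<^bsub>tensor_space K A A\<^esub>} K (univ_forms K A)"
      using zero_submodule[OF Om] by (simp add: univ_forms_def)
    fix a x assume a: "a \<in> carrier A" and "x \<in> {\<zero>\<^bsub>tensor_space K A A\<^esub>}"
    have "linear_map K (tensor_space K A A) (tensor_space K A A) (lact K A a)"
      unfolding lact_def by (intro linear_map_tlift mods linear_intros A) (simp_all add: a)
    with \<open>x \<in> _\<close> show "lact K A a x \<in> {\<zero>\<^bsub>tensor_space K A A\<^esub>}"
      using linear_map_zero[OF mods(2,2)] by simp
  qed
qed

section \<open>The tensor product bundle\<close>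

locale trivial_bundle =
  fixes B :: "('k, 'm, 'h) bundle_data"
  assumes is_bundle: "tensor_bundle B"
begin

abbreviation "K \<equiv> K_of B"
abbreviation "M \<equiv> M_of B"
abbreviation "H \<equiv> H_of B"
abbreviation "Q \<equiv> QH_of B"
abbreviation "NM \<equiv> NM_of B"
abbreviation "NH \<equiv> NH_of B"
abbreviation "NP \<equiv> NP_of B"
abbreviation "P \<equiv> P_of B"
abbreviation "PP \<equiv> PP_of B"
abbreviation "MM \<equiv> tensor_space K M M"
abbreviation "HH \<equiv> tensor_space K H H"
abbreviation "tM \<equiv> tens K M M"
abbreviation "tH \<equiv> tens K H H"

sublocale hopf_alg K H
  by unfold_locales (use is_bundle in \<open>simp add: tensor_bundle_def\<close>)

notation hmult (infixl \<open>\<cdot>\<close> 70)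

lemma M_alg [simp, linear_intros]: "unital_algebra K M"
  using is_bundle by (simp add: tensor_bundle_def)

sublocale M: calculus K M NM
  by (rule calculus.intro) (use is_bundle in \<open>auto simp: tensor_bundle_def sub_bimodule_def\<close>)

sublocale pair: algebra_pair K M H
  by unfold_locales simp_all

lemma P_eq: "P = tensor_algebra K M H" by (simp add: P_of_def)

lemma P_alg [simp, linear_intros]: "unital_algebra K P"
  unfolding P_eq by (rule pair.unital_algebra_tensor)

lemma mods [simp, linear_intros]: "module K M" "module K P" "module K PP" "module K MM"
  by (simp_all add: M.mods PP_of_def unital_algebra_module module_tensor_space)

sublocale P0: calculus K P "{\<zero>\<^bsub>tensor_space K P P\<^esub>}" by (rule calculus_zero) simp
sublocale H0: calculus K H "{\<zero>\<^bsub>HH\<^esub>}" by (rule calculus_zero) simp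

abbreviation "mulM \<equiv> M.mul"
abbreviation "mulH \<equiv> H0.mul"
abbreviation "mulP \<equiv> P0.mul"

lemma bilinear_mh: "bilinear K M H P (mh B)"
  unfolding mh_def P_eq using bilinear_tens[OF mods(1) H_mod]
  by (simp add: bilinear_def)

lemmas linear_map_mh [linear_intros] =
  bilinear_left_comp[OF bilinear_mh] bilinear_right_comp[OF bilinear_mh]

lemma mh_closed [simp]: "m \<in> carrier M \<Longrightarrow> h \<in> carrier H \<Longrightarrow> mh B m h \<in> carrier P"
  by (rule bilinear_closed[OF bilinear_mh])

lemma mh_mult [simp]:
  "m \<in> carrier M \<Longrightarrow> n \<in> carrier M \<Longrightarrow> h \<in> carrier H \<Longrightarrow> g \<in> carrier H \<Longrightarrow>
    mh B m h \<otimes>\<^bsub>P\<^esub> mh B n g = mh B (m \<otimes>\<^bsub>M\<^esub> n) (h \<cdot> g)"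
  by (simp add: mh_def P_eq)

lemma one_P: "\<one>\<^bsub>P\<^esub> = mh B \<one>\<^bsub>M\<^esub> \<one>\<^bsub>H\<^esub>"
  by (simp add: mh_def P_eq)

lemma P_eqI:
  assumes "module K U" "linear_map K P U f" "linear_map K P U g"
    and "\<And>m h. m \<in> carrier M \<Longrightarrow> h \<in> carrier H \<Longrightarrow> f (mh B m h) = g (mh B m h)" and "p \<in> carrier P"
  shows "f p = g p"
  using pair.tens_eqI[of U f g p] assms by (simp add: mh_def P_eq)

lemma linear_map_tens_PP [linear_intros]:
  "linear_map K V P f \<Longrightarrow> p \<in> carrier P \<Longrightarrow> linear_map K V PP (\<lambda>x. tens K P P (f x) p)"
  "linear_map K V P f \<Longrightarrow> p \<in> carrier P \<Longrightarrow> linear_map K V PP (\<lambda>x. tens K P P p (f x))"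
  unfolding PP_of_def by (intro linear_intros; simp)+

lemma tens_PP_closed [simp]: "p \<in> carrier P \<Longrightarrow> p' \<in> carrier P \<Longrightarrow> tens K P P p p' \<in> carrier PP"
  by (simp add: PP_of_def)

lemma linear_map_mmhh [linear_intros]:
  "linear_map K V M f \<Longrightarrow> n \<in> carrier M \<Longrightarrow> h \<in> carrier H \<Longrightarrow> g \<in> carrier H \<Longrightarrow>
    linear_map K V PP (\<lambda>x. mmhh B (f x) n h g)"
  "m \<in> carrier M \<Longrightarrow> linear_map K V M f \<Longrightarrow> h \<in> carrier H \<Longrightarrow> g \<in> carrier H \<Longrightarrow>
    linear_map K V PP (\<lambda>x. mmhh B m (f x) h g)"
  "m \<in> carrier M \<Longrightarrow> n \<in> carrier M \<Longrightarrow> linear_map K V H f' \<Longrightarrow> g \<in> carrier H \<Longrightarrow>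
    linear_map K V PP (\<lambda>x. mmhh B m n (f' x) g)"
  "m \<in> carrier M \<Longrightarrow> n \<in> carrier M \<Longrightarrow> h \<in> carrier H \<Longrightarrow> linear_map K V H f' \<Longrightarrow>
    linear_map K V PP (\<lambda>x. mmhh B m n h (f' x))"
  unfolding mmhh_def by (intro linear_intros; simp)+

lemma mmhh_closed [simp]:
  "m \<in> carrier M \<Longrightarrow> n \<in> carrier M \<Longrightarrow> h \<in> carrier H \<Longrightarrow> g \<in> carrier H \<Longrightarrow> mmhh B m n h g \<in> carrier PP"
  by (simp add: mmhh_def)

lemma PP_eqI:
  assumes U: "module K U" and f: "linear_map K PP U f" and g: "linear_map K PP U g"
    and eq: "\<And>m n h g'. m \<in> carrier M \<Longrightarrow> n \<in> carrier M \<Longrightarrow> h \<in> carrier H \<Longrightarrow> g' \<in> carrier H \<Longrightarrow>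
      f (mmhh B m n h g') = g (mmhh B m n h g')" and x: "x \<in> carrier PP"
  shows "f x = g x"
proof (rule linear_map_eq_on_tensor_space[OF mods(2,2) U f[unfolded PP_of_def] g[unfolded PP_of_def] _ x[unfolded PP_of_def]])
  fix p p' assume p: "p \<in> carrier P" "p' \<in> carrier P"
  show "f (tens K P P p p') = g (tens K P P p p')"
  proof (rule P_eqI[OF U _ _ _ p(1)])
    fix m h assume mh: "m \<in> carrier M" "h \<in> carrier H"
    show "f (tens K P P (mh B m h) p') = g (tens K P P (mh B m h) p')"
      by (rule P_eqI[OF U _ _ _ p(2)])
        ((intro linear_intros linear_map_comp[OF f] linear_map_comp[OF g])?; simp add: mh eq flip: mmhh_def)+
  qed ((intro linear_intros linear_map_comp[OF f] linear_map_comp[OF g])?; simp add: p)+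
qed

lemma bilinear_mmhh_inner:
  assumes "m \<in> carrier M" "n \<in> carrier M"
  shows "bilinear K H H PP (\<lambda>h g. mmhh B m n h g)"
  by (intro linear_intros; simp add: assms)

lemma bilinear_flip_inner:
  assumes "y \<in> carrier HH"
  shows "bilinear K M M PP (\<lambda>m n. tlift K PP (\<lambda>h g. mmhh B m n h g) y)"
  by (intro bilinearI linear_map_tlift_param[OF H_mod H_mod] linear_intros; simp add: assms)

lemma bilinear_flip: "bilinear K MM HH PP (flip B)"
  unfolding flip_def
  by (intro bilinearI linear_map_tlift linear_map_tlift_param[OF mods(1,1,3)] bilinear_flip_inner
      bilinear_mmhh_inner; simp)

lemmas linear_map_flip [linear_intros] =
  bilinear_left_comp[OF bilinear_flip] bilinear_right_comp[OF bilinear_flip]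

lemma flip_closed [simp]: "x \<in> carrier MM \<Longrightarrow> y \<in> carrier HH \<Longrightarrow> flip B x y \<in> carrier PP"
  by (rule bilinear_closed[OF bilinear_flip])

lemma flip_tens [simp]:
  "m \<in> carrier M \<Longrightarrow> n \<in> carrier M \<Longrightarrow> h \<in> carrier H \<Longrightarrow> g \<in> carrier H \<Longrightarrow>
    flip B (tM m n) (tH h g) = mmhh B m n h g"
  unfolding flip_def
  by (simp add: tlift_tens[OF mods(1,1,3)] tlift_tens[OF H_mod H_mod mods(3)] bilinear_flip_inner bilinear_mmhh_inner)

lemma MM_HH_eqI:
  assumes U: "module K U" and f: "bilinear K MM HH U f" and g: "bilinear K MM HH U g"
    and eq: "\<And>m n h g'. m \<in> carrier M \<Longrightarrow> n \<in> carrier M \<Longrightarrow> h \<in> carrier H \<Longrightarrow> g' \<in> carrier H \<Longrightarrow>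
      f (tM m n) (tH h g') = g (tM m n) (tH h g')"
    and xy: "x \<in> carrier MM" "y \<in> carrier HH"
  shows "f x y = g x y"
proof (rule linear_map_eq_on_tensor_space[OF mods(1,1) U bilinear_left[OF f xy(2)] bilinear_left[OF g xy(2)] _ xy(1)])
  fix m n assume mn: "m \<in> carrier M" "n \<in> carrier M"
  show "f (tM m n) y = g (tM m n) y"
    by (rule linear_map_eq_on_tensor_space[OF H_mod H_mod U bilinear_right[OF f] bilinear_right[OF g] _ xy(2)])
      (simp_all add: mn eq)
qed

lemma linear_mulM [linear_intros]: "linear_map K V MM f \<Longrightarrow> linear_map K V M (\<lambda>x. mulM (f x))"
  by (rule linear_map_comp[OF M.linear_mul])

lemma linear_mulH [linear_intros]: "linear_map K V HH f \<Longrightarrow> linear_map K V H (\<lambda>x. mulH (f x))"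
  by (rule linear_map_comp[OF H0.linear_mul])

lemma linear_mulP [linear_intros]: "linear_map K V PP f \<Longrightarrow> linear_map K V P (\<lambda>x. mulP (f x))"
  unfolding PP_of_def by (rule linear_map_comp[OF P0.linear_mul])

lemma linear_lactM [linear_intros]:
  "linear_map K V M f \<Longrightarrow> x \<in> carrier MM \<Longrightarrow> linear_map K V MM (\<lambda>v. lact K M (f v) x)"
  "linear_map K V MM f' \<Longrightarrow> m \<in> carrier M \<Longrightarrow> linear_map K V MM (\<lambda>v. lact K M m (f' v))"
  by (rule bilinear_left_comp[OF M.bilinear_lact] bilinear_right_comp[OF M.bilinear_lact]; assumption)+

lemma linear_lactH [linear_intros]:
  "linear_map K V H f \<Longrightarrow> x \<in> carrier HH \<Longrightarrow> linear_map K V HH (\<lambda>v. lact K H (f v) x)"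
  "linear_map K V HH f' \<Longrightarrow> m \<in> carrier H \<Longrightarrow> linear_map K V HH (\<lambda>v. lact K H m (f' v))"
  by (rule bilinear_left_comp[OF H0.bilinear_lact] bilinear_right_comp[OF H0.bilinear_lact]; assumption)+

lemma linear_lactP [linear_intros]:
  "linear_map K V P f \<Longrightarrow> x \<in> carrier PP \<Longrightarrow> linear_map K V PP (\<lambda>v. lact K P (f v) x)"
  "linear_map K V PP f' \<Longrightarrow> p \<in> carrier P \<Longrightarrow> linear_map K V PP (\<lambda>v. lact K P p (f' v))"
  unfolding PP_of_def
  by (rule bilinear_left_comp[OF P0.bilinear_lact] bilinear_right_comp[OF P0.bilinear_lact]; assumption)+

lemma mulP_mmhh [simp]:
  "m \<in> carrier M \<Longrightarrow> n \<in> carrier M \<Longrightarrow> h \<in> carrier H \<Longrightarrow> g \<in> carrier H \<Longrightarrow>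
    mulP (mmhh B m n h g) = mh B (m \<otimes>\<^bsub>M\<^esub> n) (h \<cdot> g)"
  by (simp add: mmhh_def)

lemma mulP_flip:
  assumes "x \<in> carrier MM" "y \<in> carrier HH"
  shows "mulP (flip B x y) = mh B (mulM x) (mulH y)"
  by (rule MM_HH_eqI[OF mods(2) _ _ _ assms]) ((intro linear_intros)?; simp)+

lemma lactP_mmhh [simp]:
  "m \<in> carrier M \<Longrightarrow> n \<in> carrier M \<Longrightarrow> h \<in> carrier H \<Longrightarrow> g \<in> carrier H \<Longrightarrow>
   m' \<in> carrier M \<Longrightarrow> h' \<in> carrier H \<Longrightarrow>
    lact K P (mh B m' h') (mmhh B m n h g) = mmhh B (m' \<otimes>\<^bsub>M\<^esub> m) n (h' \<cdot> h) g"
  by (simp add: mmhh_def)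

lemma lactP_flip:
  assumes "x \<in> carrier MM" "y \<in> carrier HH" "m \<in> carrier M" "h \<in> carrier H"
  shows "lact K P (mh B m h) (flip B x y) = flip B (lact K M m x) (lact K H h y)"
  by (rule MM_HH_eqI[OF mods(3) _ _ _ assms(1,2)]) ((intro linear_intros)?; simp add: assms)+

subsection \<open>The calculus on the Hopf algebra\<close>

lemma Q_sub: "submodule Q K H" and Q_ker: "Q \<subseteq> ker_counit K H"
  using is_bundle by (simp_all add: tensor_bundle_def bicovariant_ideal_def)

lemma Q_closed [simp]: "x \<in> Q \<Longrightarrow> x \<in> carrier H"
  and Q_counit [simp]: "x \<in> Q \<Longrightarrow> counit H x = \<zero>\<^bsub>K\<^esub>"
  using Q_ker by (auto simp: ker_counit_def)

lemma Ad_Q: "x \<in> Q \<Longrightarrow> Ad K H x \<in> sub_tensor K H H Q (carrier H)"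
  using is_bundle by (simp add: tensor_bundle_def bicovariant_ideal_def)

text \<open>\<open>Psi\<close> is the bijection in the definition of \<open>ideal_rels\<close>, and \<open>Xi\<close> its inverse.\<close>

definition Psi :: "('k, 'h, 'h) tens \<Rightarrow> ('k, 'h, 'h) tens"
  where "Psi = tlift K HH (\<lambda>h g. sw HH (\<lambda>a b. tH (h \<cdot> a) b) g)"

definition Xi :: "('k, 'h, 'h) tens \<Rightarrow> ('k, 'h, 'h) tens"
  where "Xi = tlift K HH (\<lambda>h g. sw HH (\<lambda>a b. tH (h \<cdot> S a) b) g)"

lemma linear_Psi: "linear_map K HH HH Psi" and linear_Xi: "linear_map K HH HH Xi"
  unfolding Psi_def Xi_def
  by (intro linear_map_tlift linear_intros; simp)+

lemma Psi_tens [simp]: "h \<in> carrier H \<Longrightarrow> g \<in> carrier H \<Longrightarrow>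
    Psi (tH h g) = sw HH (\<lambda>a b. tH (h \<cdot> a) b) g"
  and Xi_tens [simp]: "h \<in> carrier H \<Longrightarrow> g \<in> carrier H \<Longrightarrow>
    Xi (tH h g) = sw HH (\<lambda>a b. tH (h \<cdot> S a) b) g"
  unfolding Psi_def Xi_def
  by (subst tlift_tens[OF H_mod H_mod module_HH]; (intro linear_intros)?; simp)+

text \<open>Lets every element of \<open>NH\<close> be written as \<open>Xi z\<close> with
  \<open>z\<close> in \<open>HQ\<close>, so that vanishing on \<open>NH\<close> can be tested on the
  elements \<open>h \<cdot> S q1 \<otimes> q2\<close>.\<close>

lemma Xi_Psi:
  assumes "y \<in> carrier HH" shows "Xi (Psi y) = y"
proof (rule linear_map_eq_on_tensor_space[OF H_mod H_mod module_HH _ _ _ assms])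
  fix h g assume hg: "h \<in> carrier H" "g \<in> carrier H"
  have "Xi (Psi (tH h g)) = sw HH (\<lambda>a b. Xi (tH (h \<cdot> a) b)) g"
    using hg by (simp, intro linear_map_of_sweedler2[OF module_HH module_HH linear_Xi] linear_intros; simp)
  also have "\<dots> = sw HH (\<lambda>a x. sw HH (\<lambda>b c. tH (h \<cdot> (a \<cdot> S b)) c) x) g"
    using hg by (simp cong: sweedler2_cong add: H.m_assoc)
  also have "\<dots> = tH (h \<cdot> \<one>\<^bsub>H\<^esub>) g"
    by (rule antipode_right_cancel[OF module_HH _ hg(2)]) (intro linear_intros; simp add: hg)
  finally show "Xi (Psi (tH h g)) = tH h g" using hg by simp
qed (intro linear_map_comp[OF linear_Xi] linear_Psi linear_map_id)+

text \<open>Identifies \<open>S q1 \<otimes> q2\<close> as the left-invariant form with coordinate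
  \<open>q\<close>; for \<open>q\<close> in \<open>Q\<close> it therefore lies in
  \<open>NH\<close>.\<close>

lemma Psi_antipode:
  assumes "g \<in> carrier H"
  shows "Psi (sw HH (\<lambda>a b. tH (S a) b) g) = tH \<one>\<^bsub>H\<^esub> g"
proof -
  have "Psi (sw HH (\<lambda>a b. tH (S a) b) g) = sw HH (\<lambda>a b. Psi (tH (S a) b)) g"
    by (intro linear_map_of_sweedler2[OF module_HH module_HH linear_Psi] linear_intros; simp add: assms)
  also have "\<dots> = sw HH (\<lambda>a x. sw HH (\<lambda>b c. tH (S a \<cdot> b) c) x) g"
    using assms by (simp cong: sweedler2_cong)
  also have "\<dots> = tH \<one>\<^bsub>H\<^esub> g"
    by (rule antipode_left_cancel[OF module_HH _ assms]) (intro linear_intros; simp)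
  finally show ?thesis .
qed

lemma Psi_lact:
  assumes "k \<in> carrier H" "y \<in> carrier HH" shows "Psi (lact K H k y) = lact K H k (Psi y)"
proof (rule linear_map_eq_on_tensor_space[OF H_mod H_mod module_HH _ _ _ assms(2)])
  fix h g assume hg: "h \<in> carrier H" "g \<in> carrier H"
  have "lact K H k (Psi (tH h g)) = sw HH (\<lambda>a b. lact K H k (tH (h \<cdot> a) b)) g"
    using hg by (simp, intro linear_map_of_sweedler2[OF module_HH module_HH] linear_intros; simp add: assms)
  then show "Psi (lact K H k (tH h g)) = lact K H k (Psi (tH h g))"
    using hg assms by (simp cong: sweedler2_cong add: H.m_assoc)
qed (intro linear_intros linear_map_comp[OF linear_Psi] linear_Psi; simp add: assms)+

abbreviation "HQ \<equiv> sub_tensor K H H (carrier H) Q"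

lemma NH_iff: "y \<in> NH \<longleftrightarrow> y \<in> carrier HH \<and> Psi y \<in> HQ"
  by (simp add: NH_of_def ideal_rels_def Psi_def)

lemma HQ_sub: "submodule HQ K HH"
  by (rule sub_tensor_submodule) auto

lemma HQ_I: "h \<in> carrier H \<Longrightarrow> q \<in> Q \<Longrightarrow> tH h q \<in> HQ"
  unfolding sub_tensor_def by (rule lin_span_inc) auto

lemma HQ_gens: "{tH x y | x y. x \<in> carrier H \<and> y \<in> Q} \<subseteq> carrier HH"
  by auto

lemma linear_map_HQ:
  assumes "module K U" "linear_map K HH U f" "submodule N K U"
    and "\<And>h q. h \<in> carrier H \<Longrightarrow> q \<in> Q \<Longrightarrow> f (tH h q) \<in> N" and "y \<in> HQ"
  shows "f y \<in> N"
  by (rule linear_map_lin_span[OF module_HH assms(1-3) HQ_gens _ assms(5)[unfolded sub_tensor_def]])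
    (use assms(4) in auto)

lemma linear_map_HQ_zero:
  assumes "module K U" "linear_map K HH U f"
    and "\<And>h q. h \<in> carrier H \<Longrightarrow> q \<in> Q \<Longrightarrow> f (tH h q) = \<zero>\<^bsub>U\<^esub>" and "y \<in> HQ"
  shows "f y = \<zero>\<^bsub>U\<^esub>"
  using linear_map_HQ[OF assms(1,2) zero_submodule[OF assms(1)] _ assms(4)] assms(3) by auto

text \<open>In the coordinates of \<open>Psi\<close> the product is
  \<open>id \<otimes> \<epsilon>\<close>, since \<open>h g1 \<epsilon>(g2) = h g\<close>. As the
  counit vanishes on \<open>Q\<close>, this places \<open>NH\<close> inside the one-forms.\<close>

lemma mulH_counit_Psi:
  assumes "y \<in> carrier HH"
  shows "mulH y = tlift K H (\<lambda>h g. counit H g \<odot>\<^bsub>H\<^esub> h) (Psi y)"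
proof (rule linear_map_eq_on_tensor_space[OF H_mod H_mod H_mod H0.linear_mul _ _ assms])
  have bil: "bilinear K H H H (\<lambda>h g. counit H g \<odot>\<^bsub>H\<^esub> h)" by (intro linear_intros; simp)
  note lin = linear_map_tlift[OF H_mod H_mod H_mod bil]
  show "linear_map K HH H (\<lambda>y. tlift K H (\<lambda>h g. counit H g \<odot>\<^bsub>H\<^esub> h) (Psi y))"
    by (rule linear_map_comp[OF lin linear_Psi])
  fix h g assume hg: "h \<in> carrier H" "g \<in> carrier H"
  have "tlift K H (\<lambda>h g. counit H g \<odot>\<^bsub>H\<^esub> h) (Psi (tH h g))
      = sw H (\<lambda>a b. tlift K H (\<lambda>h g. counit H g \<odot>\<^bsub>H\<^esub> h) (tH (h \<cdot> a) b)) g"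
    using hg by (simp, intro linear_map_of_sweedler2[OF module_HH H_mod lin] linear_intros; simp)
  also have "\<dots> = sw H (\<lambda>a b. counit H b \<odot>\<^bsub>H\<^esub> (h \<cdot> a)) g"
    using hg by (simp cong: sweedler2_cong add: tlift_tens[OF H_mod H_mod H_mod bil])
  also have "\<dots> = h \<cdot> g"
    by (rule counit_right[OF H_mod _ hg(2)]) (intro linear_intros; simp add: hg)
  finally show "mulH (tH h g) = tlift K H (\<lambda>h g. counit H g \<odot>\<^bsub>H\<^esub> h) (Psi (tH h g))" using hg by simp
qed

lemma mulH_NH: "y \<in> NH \<Longrightarrow> mulH y = \<zero>\<^bsub>H\<^esub>"
proof -
  assume y: "y \<in> NH"
  have bil: "bilinear K H H H (\<lambda>h g. counit H g \<odot>\<^bsub>H\<^esub> h)" by (intro linear_intros; simp)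
  have "tlift K H (\<lambda>h g. counit H g \<odot>\<^bsub>H\<^esub> h) (Psi y) = \<zero>\<^bsub>H\<^esub>"
    by (rule linear_map_HQ_zero[OF H_mod linear_map_tlift[OF H_mod H_mod H_mod bil]])
      (use y in \<open>simp_all add: tlift_tens[OF H_mod H_mod H_mod bil] NH_iff\<close>)
  then show ?thesis using y mulH_counit_Psi by (simp add: NH_iff)
qed

lemma lact_NH: "k \<in> carrier H \<Longrightarrow> y \<in> NH \<Longrightarrow> lact K H k y \<in> NH"
  using linear_map_HQ[OF module_HH _ HQ_sub, of "lact K H k" "Psi y"] bilinear_right[OF H0.bilinear_lact, of k]
  by (auto simp: NH_iff Psi_lact HQ_I)

sublocale Hc: calculus K H NH
proof (rule calculus.intro)
  have "submodule {y \<in> carrier HH. Psi y \<in> HQ} K HH"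
    by (rule submodule_preimage[OF module_HH module_HH linear_Psi HQ_sub])
  moreover have "{y \<in> carrier HH. Psi y \<in> HQ} = NH" by (auto simp: NH_iff)
  ultimately show "submodule NH K (univ_forms K H)"
    by (intro H0.submodule_OmI) (auto simp: H0.univ_carrier mulH_NH NH_iff)
qed (simp_all add: lact_NH)

text \<open>For \<open>k = 1\<close> the element has \<open>Psi\<close>-image
  \<open>1 \<otimes> x\<close>; the general case is a left translate.\<close>

lemma antipode_NH:
  assumes "k \<in> carrier H" "x \<in> Q"
  shows "sw HH (\<lambda>a b. tH (k \<cdot> S a) b) x \<in> NH"
proof -
  let ?y = "sw HH (\<lambda>a b. tH (S a) b) x"
  have y: "?y \<in> carrier HH" using assms by (intro linear_intros; simp)
  then have "?y \<in> NH"
    using assms by (auto simp: NH_iff Psi_antipode HQ_I)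
  then have "lact K H k ?y \<in> NH" using assms lact_NH by simp
  also have "lact K H k ?y = sw HH (\<lambda>a b. lact K H k (tH (S a) b)) x"
    using assms by (intro linear_map_of_sweedler2[OF module_HH module_HH] linear_intros; simp)
  also have "\<dots> = sw HH (\<lambda>a b. tH (k \<cdot> S a) b) x"
    using assms by (simp cong: sweedler2_cong)
  finally show ?thesis .
qed

subsection \<open>The calculus on the bundle\<close>

definition NP_gens :: "('k, 'm, 'h) tot2 set" where "NP_gens =
    {flip B x y | x y. x \<in> NM \<and> y \<in> carrier HH}
   \<union> {flip B x y | x y. x \<in> carrier MM \<and> y \<in> NH}
   \<union> {flip B x y | x y. x \<in> carrier (univ_forms K M) \<and> y \<in> carrier (univ_forms K H)}"

lemma NP_eq: "NP = lin_span K PP NP_gens"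
  by (simp add: NP_of_def NP_gens_def)

lemma NH_closed [simp]: "y \<in> NH \<Longrightarrow> y \<in> carrier HH" by (simp add: NH_iff)

text \<open>The product of \<open>flip B x y\<close> is \<open>mulM x \<otimes> mulH y\<close>, and
  in each of the three families at least one factor vanishes.\<close>

lemma NP_gens_Om: "NP_gens \<subseteq> carrier (univ_forms K P)"
proof -
  have "mh B \<zero>\<^bsub>M\<^esub> h = \<zero>\<^bsub>P\<^esub>" if "h \<in> carrier H" for h
    using linear_map_zero[OF mods(1,2) bilinear_left[OF bilinear_mh that]] .
  moreover have "mh B m \<zero>\<^bsub>H\<^esub> = \<zero>\<^bsub>P\<^esub>" if "m \<in> carrier M" for m
    using linear_map_zero[OF H_mod mods(2) bilinear_right[OF bilinear_mh that]] .
  moreover have "mulM x = \<zero>\<^bsub>M\<^esub>" if "x \<in> NM" for x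
    using M.N_univ[OF that] by (simp add: M.univ_carrier)
  ultimately show ?thesis
    using flip_closed unfolding NP_gens_def P0.univ_carrier PP_of_def[symmetric]
    by (auto simp: mulP_flip M.N_T M.univ_carrier H0.univ_carrier mulH_NH)
qed

lemma NP_gens_PP: "NP_gens \<subseteq> carrier PP"
  using NP_gens_Om by (auto simp: P0.univ_carrier PP_of_def)

lemma NP_sub_PP: "submodule NP K PP"
  unfolding NP_eq by (intro lin_span_submodule NP_gens_PP) simp

lemma Om_sub_PP: "submodule (carrier (univ_forms K P)) K PP"
proof -
  have "submodule {x \<in> carrier PP. mulP x \<in> {\<zero>\<^bsub>P\<^esub>}} K PP"
    by (rule submodule_preimage[OF mods(3,2) _ zero_submodule]) (intro linear_intros; simp)+
  then show ?thesis by (simp add: P0.univ_carrier PP_of_def)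
qed

text \<open>A pure element \<open>m \<otimes> h\<close> acts on the two tensor factors separately
  and so preserves each of the three generating families.\<close>

lemma NP_lact_mh:
  assumes "m \<in> carrier M" "h \<in> carrier H" "x \<in> NP"
  shows "lact K P (mh B m h) x \<in> NP"
proof (rule linear_map_lin_span[OF mods(3,3) _ NP_sub_PP NP_gens_PP _ assms(3)[unfolded NP_eq]])
  show "linear_map K PP PP (lact K P (mh B m h))"
    by (intro linear_intros; simp add: assms)
  fix x assume "x \<in> NP_gens"
  then have "lact K P (mh B m h) x \<in> NP_gens"
  proof (unfold NP_gens_def, elim UnE CollectE exE conjE, goal_cases)
    case (1 x y)
    then have "lact K P (mh B m h) (flip B x y) = flip B (lact K M m x) (lact K H h y)" "lact K M m x \<in> NM"
       "lact K H h y \<in> carrier HH"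
      using assms by (simp_all add: lactP_flip M.N_T M.N_lact)
    with 1 show ?case by blast
  next
    case (2 x y)
    then have "lact K P (mh B m h) (flip B x y) = flip B (lact K M m x) (lact K H h y)" "lact K M m x \<in> carrier MM"
       "lact K H h y \<in> NH"
      using assms by (simp_all add: lactP_flip lact_NH)
    with 2 show ?case by blast
  next
    case (3 x y)
    then have "lact K P (mh B m h) (flip B x y) = flip B (lact K M m x) (lact K H h y)"
       "lact K M m x \<in> carrier (univ_forms K M)" "lact K H h y \<in> carrier (univ_forms K H)"
      using assms M.lact_univ H0.lact_univ by (simp_all add: lactP_flip M.univ_carrier H0.univ_carrier)
    with 3 show ?case by blast
  qed
  then show "lact K P (mh B m h) x \<in> NP" by (simp add: NP_eq lin_span_inc)
qed

lemma NP_lact: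
  assumes "p \<in> carrier P" "x \<in> NP"
  shows "lact K P p x \<in> NP"
proof -
  interpret PP: module K PP by simp
  have x: "x \<in> carrier PP" using PP.submoduleE(1)[OF NP_sub_PP] assms(2) by auto
  have lin: "linear_map K P PP (\<lambda>p. lact K P p x)" by (intro linear_intros; simp add: x)
  have P: "tensor_space K M H = tensor_space K M H \<Longrightarrow> p \<in> carrier (tensor_space K M H)"
    using assms(1) by (simp add: P_eq)
  from mods(1) H_mod P[OF refl] show ?thesis
  proof (induction rule: tensor_space_induct)
    case zero
    show ?case
      using linear_map_zero[OF mods(2,3) lin] submodule_zero_closed[OF mods(3) NP_sub_PP] by (simp add: P_eq)
  next
    case (add p p')
    then show ?case
      using linear_map_add[OF lin, of p p'] PP.submoduleE(5)[OF NP_sub_PP] by (simp add: P_eq)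
  next
    case (tens c m h)
    then show ?case
      using linear_map_smult[OF lin, of c "mh B m h"] PP.submoduleE(4)[OF NP_sub_PP] mh_closed[of m h]
        NP_lact_mh[OF _ _ assms(2), of m h]
      by (simp add: P_eq mh_def)
  qed
qed

sublocale Pc: calculus K P NP
proof (rule calculus.intro)
  have "NP \<subseteq> carrier (univ_forms K P)"
    unfolding NP_eq by (rule lin_span_minimal[OF NP_gens_Om Om_sub_PP])
  then show "submodule NP K (univ_forms K P)"
    using P0.submodule_OmI NP_sub_PP by (simp add: PP_of_def)
qed (simp_all add: NP_lact)

subsection \<open>Left-invariant forms\<close>

abbreviation "kerH \<equiv> H\<lparr>carrier := ker_counit K H\<rparr>"
abbreviation "O0 \<equiv> Omega0 B"
abbreviation "OM \<equiv> OmegaM B"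
abbreviation "OP \<equiv> OmegaP B"

lemma ker_sub: "submodule (ker_counit K H) K H"
proof (rule HM.submoduleI)
  have "counit H (\<zero>\<^bsub>K\<^esub> \<odot>\<^bsub>H\<^esub> \<one>\<^bsub>H\<^esub>) = \<zero>\<^bsub>K\<^esub>" by (subst counit_smult) simp_all
  then show "\<zero>\<^bsub>H\<^esub> \<in> ker_counit K H" by (simp add: ker_counit_def)
  fix a assume a: "a \<in> ker_counit K H"
  then have "counit H ((\<ominus>\<^bsub>K\<^esub> \<one>\<^bsub>K\<^esub>) \<odot>\<^bsub>H\<^esub> a) = \<zero>\<^bsub>K\<^esub>" by (subst counit_smult) (simp_all add: ker_counit_def)
  then show "\<ominus>\<^bsub>H\<^esub> a \<in> ker_counit K H" using a by (simp add: ker_counit_def HM.smult_l_minus)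
qed (auto simp: ker_counit_def)

lemma module_ker: "module K kerH"
  by (rule submodule.submodule_is_module[OF ker_sub H_mod])

lemma Q_sub_ker: "submodule Q K kerH"
proof -
  interpret k: module K kerH by (rule module_ker)
  show ?thesis
  proof (rule k.submoduleI)
    fix x assume x: "x \<in> Q"
    then have "\<ominus>\<^bsub>kerH\<^esub> x = (\<ominus>\<^bsub>K\<^esub> \<one>\<^bsub>K\<^esub>) \<odot>\<^bsub>H\<^esub> x"
      using Q_ker k.smult_l_minus[of "\<one>\<^bsub>K\<^esub>" x] k.smult_one[of x] by auto
    then show "\<ominus>\<^bsub>kerH\<^esub> x \<in> Q" using HM.submoduleE(4)[OF Q_sub] x by simp
  qed (use Q_ker HM.submoduleE[OF Q_sub] submodule_zero_closed[OF H_mod Q_sub] in auto)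
qed

lemma O0_mod [simp, linear_intros]: "module K O0"
  unfolding Omega0_def inv_forms_def by (rule module_quotient[OF module_ker Q_sub_ker])

lemma coset_kerH: "Q +>\<^bsub>kerH\<^esub> h = Q +>\<^bsub>H\<^esub> h"
  by (simp add: a_r_coset_def r_coset_def)

lemma linear_ker_proj: "linear_map K H kerH (\<lambda>h. h \<ominus>\<^bsub>H\<^esub> (counit H h \<odot>\<^bsub>H\<^esub> \<one>\<^bsub>H\<^esub>))"
proof -
  have lin: "linear_map K H H (\<lambda>h. h \<ominus>\<^bsub>H\<^esub> (counit H h \<odot>\<^bsub>H\<^esub> \<one>\<^bsub>H\<^esub>))"
    by (intro linear_intros; simp)
  have "counit H (h \<ominus>\<^bsub>H\<^esub> (counit H h \<odot>\<^bsub>H\<^esub> \<one>\<^bsub>H\<^esub>)) = \<zero>\<^bsub>K\<^esub>" if h: "h \<in> carrier H" for h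
  proof -
    have "\<ominus>\<^bsub>H\<^esub> (counit H h \<odot>\<^bsub>H\<^esub> \<one>\<^bsub>H\<^esub>) = (\<ominus>\<^bsub>K\<^esub> counit H h) \<odot>\<^bsub>H\<^esub> \<one>\<^bsub>H\<^esub>"
      using h by (simp add: HM.smult_l_minus)
    then show ?thesis using h by (simp add: a_minus_def HM.R.r_neg)
  qed
  with lin show ?thesis by (auto simp: linear_map_def ker_counit_def Pi_def)
qed

lemma linear_pi0: "linear_map K H O0 (pi0 B)"
  unfolding Omega0_def inv_forms_def pi0_def inv_proj_def coset_kerH[symmetric]
  by (rule linear_map_comp[OF linear_map_coset[OF module_ker Q_sub_ker] linear_ker_proj])

lemma linear_map_pi0 [linear_intros]: "linear_map K V H f \<Longrightarrow> linear_map K V O0 (\<lambda>x. pi0 B (f x))"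
  by (rule linear_map_comp[OF linear_pi0])

lemma pi0_closed [simp]: "h \<in> carrier H \<Longrightarrow> pi0 B h \<in> carrier O0"
  by (rule linear_map_closed[OF linear_pi0])

lemma pi0_ker: "h \<in> ker_counit K H \<Longrightarrow> pi0 B h = Q +>\<^bsub>kerH\<^esub> h"
  unfolding coset_kerH by (simp add: pi0_def inv_proj_def ker_counit_def a_minus_def)

lemma O0_cases:
  assumes "v \<in> carrier O0"
  obtains h where "h \<in> ker_counit K H" "h \<in> carrier H" "v = pi0 B h"
proof -
  obtain h where "h \<in> ker_counit K H" "v = Q +>\<^bsub>kerH\<^esub> h"
    using assms by (auto simp: Omega0_def inv_forms_def carrier_quotient)
  then show ?thesis using that[of h] by (simp add: pi0_ker ker_counit_def)
qed

lemma pi0_Q [simp]: "x \<in> Q \<Longrightarrow> pi0 B x = \<zero>\<^bsub>O0\<^esub>"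
  using coset_zero_iff[OF module_ker Q_sub_ker, of x] pi0_ker[of x] Q_ker
  by (auto simp: Omega0_def inv_forms_def zero_quotient)

lemma pi0_one [simp]: "pi0 B \<one>\<^bsub>H\<^esub> = \<zero>\<^bsub>O0\<^esub>"
  using coset_zero_iff[OF module_ker Q_sub_ker, of "\<zero>\<^bsub>H\<^esub>"] submodule_zero_closed[OF H_mod Q_sub] Q_ker
  by (auto simp: Omega0_def inv_forms_def zero_quotient pi0_def inv_proj_def coset_kerH a_minus_def H.r_neg)

text \<open>As \<open>H\<close> is the kernel of the counit plus the line of 1, maps out of
  \<Omega>0 are given by maps on \<open>H\<close> that kill \<open>Q\<close> and 1. The formula
  \<open>g\<close> of a definition need agree with \<open>f\<close> only on the kernel of the
  counit.\<close>

lemma induced_pi0: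
  assumes U: "module K U" and f: "linear_map K H U f"
    and Q: "\<And>x. x \<in> Q \<Longrightarrow> f x = \<zero>\<^bsub>U\<^esub>" and one: "f \<one>\<^bsub>H\<^esub> = \<zero>\<^bsub>U\<^esub>"
    and g: "\<And>x. x \<in> ker_counit K H \<Longrightarrow> g x = f x"
  shows "h \<in> carrier H \<Longrightarrow> induced g (pi0 B h) = f h"
    and "linear_map K O0 U (induced g)"
proof -
  interpret U: module K U by (rule U)
  have f': "linear_map K kerH U f"
    using f by (auto simp: linear_map_def ker_counit_def)
  have ind: "induced g (Q +>\<^bsub>kerH\<^esub> y) = induced f (Q +>\<^bsub>kerH\<^esub> y)" if "y \<in> ker_counit K H" for y
  proof -
    have "Q +>\<^bsub>kerH\<^esub> y \<subseteq> ker_counit K H"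
      using mem_coset_iff[OF module_ker Q_sub_ker, of y] that by auto
    then have "g ` (Q +>\<^bsub>kerH\<^esub> y) = f ` (Q +>\<^bsub>kerH\<^esub> y)" using g by (intro image_cong) auto
    then show ?thesis by (simp add: induced_def)
  qed
  have ker: "h \<ominus>\<^bsub>H\<^esub> (counit H h \<odot>\<^bsub>H\<^esub> \<one>\<^bsub>H\<^esub>) \<in> carrier kerH" if "h \<in> carrier H" for h
    using linear_map_closed[OF linear_ker_proj that] .
  show "induced g (pi0 B h) = f h" if h: "h \<in> carrier H"
  proof -
    have "induced g (pi0 B h) = f (h \<ominus>\<^bsub>H\<^esub> (counit H h \<odot>\<^bsub>H\<^esub> \<one>\<^bsub>H\<^esub>))"
      using ind[of "h \<ominus>\<^bsub>H\<^esub> (counit H h \<odot>\<^bsub>H\<^esub> \<one>\<^bsub>H\<^esub>)"] ker[OF h]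
        induced_coset[OF module_ker Q_sub_ker U f' Q ker[OF h]]
      by (simp add: pi0_def inv_proj_def coset_kerH)
    also have "\<dots> = f h"
      using h linear_map_minus[OF H_mod U f, of h "counit H h \<odot>\<^bsub>H\<^esub> \<one>\<^bsub>H\<^esub>"] linear_map_closed[OF f h]
        U.M.add.inv_one linear_map_smult[OF f, of "counit H h" "\<one>\<^bsub>H\<^esub>"]
      by (simp add: one a_minus_def)
    finally show ?thesis .
  qed
  have "linear_map K O0 U (induced f)"
    unfolding Omega0_def inv_forms_def by (rule linear_map_induced[OF module_ker Q_sub_ker U f' Q])
  then show "linear_map K O0 U (induced g)"
  proof (rule linear_map_cong[OF _ _ O0_mod])
    fix v assume "v \<in> carrier O0"
    then show "induced f v = induced g v"
      by (elim O0_cases) (simp add: pi0_ker ind)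
  qed
qed

subsection \<open>Forms on the base and on the total space\<close>

abbreviation "qM \<equiv> M.form_of"
abbreviation "q \<equiv> Pc.form_of"

lemma OM_eq: "OM = forms K M NM" and OP_eq: "OP = forms K P NP"
  by (simp_all add: OmegaM_def OmegaP_def)

lemma O_mods [simp, linear_intros]: "module K OM" "module K OP"
  by (simp_all add: OM_eq OP_eq M.module_forms Pc.module_forms)

sublocale OM: module K OM by simp
sublocale OP: module K OP by simp

lemma linear_map_qM [linear_intros]: "linear_map K V MM f \<Longrightarrow> linear_map K V OM (\<lambda>x. qM (f x))"
  unfolding OM_eq by (rule linear_map_comp[OF M.linear_form_of])

lemma linear_map_q [linear_intros]: "linear_map K V PP f \<Longrightarrow> linear_map K V OP (\<lambda>x. q (f x))"
  unfolding OP_eq PP_of_def by (rule linear_map_comp[OF Pc.linear_form_of])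

lemma qM_closed [simp]: "x \<in> carrier MM \<Longrightarrow> qM x \<in> carrier OM"
  by (simp add: OM_eq)

lemma q_closed [simp]: "x \<in> carrier PP \<Longrightarrow> q x \<in> carrier OP"
  by (simp add: OP_eq PP_of_def)

lemma q_tens_one [simp]: "p \<in> carrier P \<Longrightarrow> q (tens K P P p \<one>\<^bsub>P\<^esub>) = \<zero>\<^bsub>OP\<^esub>"
  by (simp add: OP_eq)

lemma q_mmhh_one [simp]: "m \<in> carrier M \<Longrightarrow> h \<in> carrier H \<Longrightarrow> q (mmhh B m \<one>\<^bsub>M\<^esub> h \<one>\<^bsub>H\<^esub>) = \<zero>\<^bsub>OP\<^esub>"
  using q_tens_one[of "mh B m h"] by (simp add: mmhh_def one_P)

lemma piP_q: "x \<in> carrier PP \<Longrightarrow> mulP x = \<zero>\<^bsub>P\<^esub> \<Longrightarrow> piP B x = q x"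
  using Pc.form_of_univ[of x] by (simp add: piP_def Pc.univ_carrier PP_of_def)

lemma OM_cases:
  assumes "X \<in> carrier OM"
  obtains x where "x \<in> carrier MM" "mulM x = \<zero>\<^bsub>M\<^esub>" "X = qM x"
  using assms by (auto simp: OM_eq M.univ_carrier elim: M.forms_cases)

lemma OP_cases:
  assumes "X \<in> carrier OP"
  obtains x where "x \<in> carrier PP" "mulP x = \<zero>\<^bsub>P\<^esub>" "X = q x"
  using assms by (auto simp: OP_eq Pc.univ_carrier PP_of_def elim: Pc.forms_cases)

lemma q_NP: "x \<in> NP \<Longrightarrow> q x = \<zero>\<^bsub>OP\<^esub>" by (simp add: OP_eq)

lemma q_flip_NM: "x \<in> NM \<Longrightarrow> y \<in> carrier HH \<Longrightarrow> q (flip B x y) = \<zero>\<^bsub>OP\<^esub>"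
  by (rule q_NP, unfold NP_eq NP_gens_def, rule lin_span_inc) blast

lemma q_flip_NH: "x \<in> carrier MM \<Longrightarrow> y \<in> NH \<Longrightarrow> q (flip B x y) = \<zero>\<^bsub>OP\<^esub>"
  by (rule q_NP, unfold NP_eq NP_gens_def, rule lin_span_inc) blast

lemma q_flip_Om:
  assumes "x \<in> carrier MM" "mulM x = \<zero>\<^bsub>M\<^esub>" "y \<in> carrier HH" "mulH y = \<zero>\<^bsub>H\<^esub>"
  shows "q (flip B x y) = \<zero>\<^bsub>OP\<^esub>"
  by (rule q_NP, unfold NP_eq NP_gens_def, rule lin_span_inc)
    (use assms in \<open>auto simp: M.univ_carrier H0.univ_carrier\<close>)

text \<open>\<open>y\<close> and \<open>1 \<otimes> mulH y\<close> have the same product, so their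
  difference is a one-form on \<open>H\<close>, and its tensor with the one-form \<open>x\<close> is
  a relation in \<open>NP\<close>.\<close>

lemma q_flip_mul:
  assumes x: "x \<in> carrier MM" "mulM x = \<zero>\<^bsub>M\<^esub>" and y: "y \<in> carrier HH"
  shows "q (flip B x y) = q (flip B x (tH \<one>\<^bsub>H\<^esub> (mulH y)))"
proof -
  interpret HH: module K HH by simp
  have lin: "linear_map K HH OP (\<lambda>y. q (flip B x y))" by (intro linear_intros; simp add: x)
  have "mulH (y \<ominus>\<^bsub>HH\<^esub> tH \<one>\<^bsub>H\<^esub> (mulH y)) = \<zero>\<^bsub>H\<^esub>"
    using linear_map_minus[OF module_HH H_mod H0.linear_mul, of y "tH \<one>\<^bsub>H\<^esub> (mulH y)"] y
    by (simp add: a_minus_def H.r_neg)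
  then have "q (flip B x (y \<ominus>\<^bsub>HH\<^esub> tH \<one>\<^bsub>H\<^esub> (mulH y))) = \<zero>\<^bsub>OP\<^esub>"
    using x y by (intro q_flip_Om) simp_all
  then have "q (flip B x y) \<ominus>\<^bsub>OP\<^esub> q (flip B x (tH \<one>\<^bsub>H\<^esub> (mulH y))) = \<zero>\<^bsub>OP\<^esub>"
    using linear_map_minus[OF module_HH O_mods(2) lin] y by simp
  then show ?thesis
    using x y OP.M.minus_equality[of "q (flip B x y)" "\<ominus>\<^bsub>OP\<^esub> q (flip B x (tH \<one>\<^bsub>H\<^esub> (mulH y)))"]
    by (simp add: a_minus_def)
qed

abbreviation "resid \<equiv> M.resid"

lemma linear_map_resid [linear_intros]: "linear_map K V MM f \<Longrightarrow> linear_map K V MM (\<lambda>x. resid (f x))"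
  unfolding M.resid_def by (intro linear_intros; simp)

lemma resid_closed [simp]: "x \<in> carrier MM \<Longrightarrow> resid x \<in> carrier MM"
  by (simp add: M.resid_def)

lemma mulM_resid [simp]: "x \<in> carrier MM \<Longrightarrow> mulM (resid x) = \<zero>\<^bsub>M\<^esub>"
  using linear_map_closed[OF M.linear_resid] by (simp add: M.univ_carrier)

lemma resid_Om: "x \<in> carrier MM \<Longrightarrow> mulM x = \<zero>\<^bsub>M\<^esub> \<Longrightarrow> resid x = x"
  using M.resid_univ by (simp add: M.univ_carrier)

lemma resid_tens_one [simp]: "m \<in> carrier M \<Longrightarrow> resid (tM m \<one>\<^bsub>M\<^esub>) = \<zero>\<^bsub>MM\<^esub>"
  by (simp add: M.resid_def a_minus_def M.T.M.r_neg)

lemma qM_resid [simp]: "x \<in> carrier MM \<Longrightarrow> qM (resid x) = qM x"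
  using linear_map_minus[OF mods(4) O_mods(1) M.linear_form_of[folded OM_eq], of x "tM (mulM x) \<one>\<^bsub>M\<^esub>"]
    M.form_of_tens_one[of "mulM x"] OM.M.add.inv_one
  by (simp add: M.resid_def a_minus_def OM_eq)

lemma flip_zero_left [simp]: "y \<in> carrier HH \<Longrightarrow> flip B \<zero>\<^bsub>MM\<^esub> y = \<zero>\<^bsub>PP\<^esub>"
  by (rule linear_map_zero[OF mods(4,3) bilinear_left[OF bilinear_flip]])

lemma q_zero [simp]: "q \<zero>\<^bsub>PP\<^esub> = \<zero>\<^bsub>OP\<^esub>"
  by (rule linear_map_zero[OF mods(3) O_mods(2)]) (intro linear_intros)

text \<open>With \<open>resid\<close> in the formula, \<open>x\<close> may be any element of
  \<open>M \<otimes> M\<close>, in particular a single tensor, where the definition of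
  \<open>hor\<close> speaks of one-forms only.\<close>

lemma hor_props:
  assumes h: "h \<in> carrier H"
  shows hor_qM: "x \<in> carrier MM \<Longrightarrow> hor B (qM x) h = q (flip B (resid x) (tH \<one>\<^bsub>H\<^esub> h))"
    and linear_hor_left: "linear_map K OM OP (\<lambda>X. hor B X h)"
proof -
  let ?f = "\<lambda>x. q (flip B (resid x) (tH \<one>\<^bsub>H\<^esub> h))"
    and ?g = "\<lambda>x. piP B (flip B x (tH \<one>\<^bsub>H\<^esub> h))"
  have f: "linear_map K MM OP ?f" by (intro linear_intros; simp add: h)
  have N: "?f x = \<zero>\<^bsub>OP\<^esub>" if "x \<in> NM" for x
    using that M.N_univ[OF that] by (simp add: M.univ_carrier resid_Om q_flip_NM h)
  have one: "?f (tM a \<one>\<^bsub>M\<^esub>) = \<zero>\<^bsub>OP\<^esub>" if "a \<in> carrier M" for a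
    using that h by simp
  have g: "?g x = ?f x" if "x \<in> carrier (univ_forms K M)" for x
    using that h linear_map_zero[OF mods(1,2) bilinear_left[OF bilinear_mh h]]
    by (simp add: M.univ_carrier resid_Om piP_q mulP_flip)
  show "x \<in> carrier MM \<Longrightarrow> hor B (qM x) h = ?f x"
    unfolding hor_def by (rule M.induced_form_of(1)[OF O_mods(2) f N one g])
  show "linear_map K OM OP (\<lambda>X. hor B X h)"
    unfolding hor_def OM_eq by (rule M.induced_form_of(2)[OF O_mods(2) f N one g])
qed

lemma bilinear_hor: "bilinear K OM H OP (hor B)"
proof (rule bilinearI)
  show "linear_map K OM OP (\<lambda>X. hor B X h)" if "h \<in> carrier H" for h
    by (rule linear_hor_left[OF that])
  fix X assume "X \<in> carrier OM"
  then obtain x where x: "x \<in> carrier MM" "X = qM x" by (elim OM_cases)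
  show "linear_map K H OP (hor B X)"
  proof (rule linear_map_cong[OF _ _ H_mod])
    show "linear_map K H OP (\<lambda>h. q (flip B (resid x) (tH \<one>\<^bsub>H\<^esub> h)))"
      by (intro linear_intros; simp add: x)
  qed (simp add: x hor_qM)
qed

lemmas linear_map_hor [linear_intros] =
  bilinear_left_comp[OF bilinear_hor] bilinear_right_comp[OF bilinear_hor]

lemma hor_closed [simp]: "X \<in> carrier OM \<Longrightarrow> h \<in> carrier H \<Longrightarrow> hor B X h \<in> carrier OP"
  by (rule bilinear_closed[OF bilinear_hor])

lemma linear_form_lactM [linear_intros]:
  "linear_map K V OM f \<Longrightarrow> m \<in> carrier M \<Longrightarrow> linear_map K V OM (\<lambda>x. form_lact K M NM m (f x))"
  unfolding OM_eq by (rule bilinear_right_comp[OF M.bilinear_form_lact])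

lemma linear_form_lactP [linear_intros]:
  "linear_map K V P f \<Longrightarrow> X \<in> carrier OP \<Longrightarrow> linear_map K V OP (\<lambda>x. form_lact K P NP (f x) X)"
  "linear_map K V OP f' \<Longrightarrow> p \<in> carrier P \<Longrightarrow> linear_map K V OP (\<lambda>x. form_lact K P NP p (f' x))"
  unfolding OP_eq by (rule bilinear_left_comp[OF Pc.bilinear_form_lact] bilinear_right_comp[OF Pc.bilinear_form_lact]; assumption)+

lemma form_lactP_q [simp]: "p \<in> carrier P \<Longrightarrow> x \<in> carrier PP \<Longrightarrow> form_lact K P NP p (q x) = q (lact K P p x)"
  by (simp add: PP_of_def)

lemma form_lactM_closed [simp]: "m \<in> carrier M \<Longrightarrow> X \<in> carrier OM \<Longrightarrow> form_lact K M NM m X \<in> carrier OM"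
  by (simp add: OM_eq)

lemma lact_resid:
  assumes m: "m \<in> carrier M" and x: "x \<in> carrier MM"
  shows "lact K M m (resid x) = resid (lact K M m x)"
proof -
  have "lact K M m (resid x) = lact K M m x \<ominus>\<^bsub>MM\<^esub> lact K M m (tM (mulM x) \<one>\<^bsub>M\<^esub>)"
    unfolding M.resid_def
    by (rule linear_map_minus[OF mods(4,4) bilinear_right[OF M.bilinear_lact m]]) (simp_all add: x)
  then show ?thesis using m x by (simp add: M.resid_def M.mul_lact)
qed

text \<open>Left multiplication turns the component \<open>1 \<otimes> g\<close> into
  \<open>h \<otimes> g\<close>; \<open>q_flip_mul\<close> brings it back to the shape
  \<open>1 \<otimes> h g\<close> required by \<open>hor\<close>.\<close>

lemma form_lact_hor:
  assumes "m \<in> carrier M" "h \<in> carrier H" "X \<in> carrier OM" "g \<in> carrier H"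
  shows "form_lact K P NP (mh B m h) (hor B X g) = hor B (form_lact K M NM m X) (h \<cdot> g)"
proof -
  obtain x where x: "x \<in> carrier MM" "X = qM x" using assms(3) by (elim OM_cases)
  have "form_lact K P NP (mh B m h) (hor B X g) = q (flip B (lact K M m (resid x)) (tH h g))"
    using assms x by (simp add: hor_qM lactP_flip)
  also have "\<dots> = q (flip B (lact K M m (resid x)) (tH \<one>\<^bsub>H\<^esub> (h \<cdot> g)))"
    using q_flip_mul[of "lact K M m (resid x)" "tH h g"] assms x by (simp add: M.mul_lact)
  also have "\<dots> = hor B (form_lact K M NM m X) (h \<cdot> g)"
    using assms x by (simp add: hor_qM lact_resid)
  finally show ?thesis .
qed

text \<open>From \<open>m \<otimes> n = mn \<otimes> 1 + m dn\<close>: the second summand is a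
  one-form on \<open>M\<close>, so its companion \<open>h \<otimes> g\<close> collapses to
  \<open>1 \<otimes> h g\<close>.\<close>

lemma q_mmhh_split:
  assumes "m \<in> carrier M" "n \<in> carrier M" "h \<in> carrier H" "g \<in> carrier H"
  shows "q (mmhh B m n h g) = q (mmhh B (m \<otimes>\<^bsub>M\<^esub> n) \<one>\<^bsub>M\<^esub> h g) \<oplus>\<^bsub>OP\<^esub> hor B (qM (tM m n)) (h \<cdot> g)"
proof -
  have "hor B (qM (tM m n)) (h \<cdot> g) = q (flip B (resid (tM m n)) (tH h g))"
    using q_flip_mul[of "resid (tM m n)" "tH h g"] assms by (simp add: hor_qM)
  also have "flip B (resid (tM m n)) (tH h g) = mmhh B m n h g \<ominus>\<^bsub>PP\<^esub> mmhh B (m \<otimes>\<^bsub>M\<^esub> n) \<one>\<^bsub>M\<^esub> h g"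
    using linear_map_minus[OF mods(4,3) bilinear_left[OF bilinear_flip, of "tH h g"], of "tM m n" "tM (m \<otimes>\<^bsub>M\<^esub> n) \<one>\<^bsub>M\<^esub>"] assms
    by (simp add: M.resid_def)
  also have "q \<dots> = q (mmhh B m n h g) \<ominus>\<^bsub>OP\<^esub> q (mmhh B (m \<otimes>\<^bsub>M\<^esub> n) \<one>\<^bsub>M\<^esub> h g)"
    by (rule linear_map_minus[OF mods(3) O_mods(2)]) ((intro linear_intros)?; simp add: assms)+
  finally show ?thesis
    using assms
    by (simp add: a_minus_def OP.M.a_lcomm[of _ "q (mmhh B m n h g)"] OP.M.r_neg)
qed

lemma form_lact_form_d:
  "m \<in> carrier M \<Longrightarrow> n \<in> carrier M \<Longrightarrow> form_lact K M NM m (form_d K M NM n) = qM (tM m n)"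
  by (simp add: M.form_d_form_of)

text \<open>Here the Ad-stability of \<open>Q\<close> enters: \<open>Ad r\<close> lies in the span
  of tensors with first leg in \<open>Q\<close>, on each of which \<open>f\<close> vanishes.\<close>

lemma tlift_Ad_Q_zero:
  assumes U: "module K U" and f: "bilinear K H H U f" and r: "r \<in> Q"
    and z: "\<And>x w. x \<in> Q \<Longrightarrow> w \<in> carrier H \<Longrightarrow> f x w = \<zero>\<^bsub>U\<^esub>"
  shows "tlift K U f (Ad K H r) = \<zero>\<^bsub>U\<^esub>"
  by (rule linear_map_lin_span_zero[OF module_HH U linear_map_tlift[OF H_mod H_mod U f] _ _ Ad_Q[OF r, unfolded sub_tensor_def]])
    (auto simp: tlift_tens[OF H_mod H_mod U f] z)

subsection \<open>The coaction on the left-invariant forms\<close>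

abbreviation "O0H \<equiv> tensor_space K O0 H"
abbreviation "ad \<equiv> inv_Ad K H Q"

lemma O0H_mod [simp, linear_intros]: "module K O0H" by (simp add: module_tensor_space)

lemma bilinear_pi0_tens: "bilinear K H H O0H (\<lambda>b c. tens K O0 H (pi0 B b) c)"
  by (intro linear_intros; simp)

lemma inv_Ad_props:
  shows inv_Ad_pi0: "h \<in> carrier H \<Longrightarrow> ad (pi0 B h) = tlift K O0H (\<lambda>b c. tens K O0 H (pi0 B b) c) (Ad K H h)"
    and linear_inv_Ad: "linear_map K O0 O0H ad"
proof -
  let ?f = "\<lambda>h. tlift K O0H (\<lambda>b c. tens K O0 H (pi0 B b) c) (Ad K H h)"
  have f: "linear_map K H O0H ?f"
    by (intro linear_map_tlift_arg[OF H_mod H_mod O0H_mod bilinear_pi0_tens] linear_intros)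
  have Q: "?f x = \<zero>\<^bsub>O0H\<^esub>" if "x \<in> Q" for x
    by (rule tlift_Ad_Q_zero[OF O0H_mod bilinear_pi0_tens that]) (simp add: tens_zero_left)
  \<comment> \<open>Both coproducts are evaluated at 1, so the only surviving term contains
    \<open>pi0 B 1\<close>, which is zero.\<close>
  have "?f \<one>\<^bsub>H\<^esub> = sw O0H (\<lambda>a x. sw O0H (\<lambda>b c. tens K O0 H (pi0 B b) (S a \<cdot> c)) x) \<one>\<^bsub>H\<^esub>"
    by (rule tlift_Ad[OF O0H_mod bilinear_pi0_tens]) simp
  also have "\<dots> = sw O0H (\<lambda>b c. tens K O0 H (pi0 B b) (S \<one>\<^bsub>H\<^esub> \<cdot> c)) \<one>\<^bsub>H\<^esub>"
    by (rule sweedler2_one) ((intro linear_intros)?; simp)+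
  also have "\<dots> = tens K O0 H (pi0 B \<one>\<^bsub>H\<^esub>) (S \<one>\<^bsub>H\<^esub> \<cdot> \<one>\<^bsub>H\<^esub>)"
    by (rule sweedler2_one) ((intro linear_intros)?; simp)+
  also have "\<dots> = \<zero>\<^bsub>O0H\<^esub>" by (simp add: tens_zero_left)
  finally have one: "?f \<one>\<^bsub>H\<^esub> = \<zero>\<^bsub>O0H\<^esub>" .
  have eq: "ad = induced ?f" by (rule ext) (simp add: inv_Ad_def Omega0_def pi0_def)
  show "h \<in> carrier H \<Longrightarrow> ad (pi0 B h) = ?f h"
    unfolding eq by (rule induced_pi0(1)[OF O0H_mod f Q one]) simp_all
  show "linear_map K O0 O0H ad"
    unfolding eq by (rule induced_pi0(2)[OF O0H_mod f Q one]) simp_all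
qed

lemma ad_closed [simp]: "v \<in> carrier O0 \<Longrightarrow> ad v \<in> carrier O0H"
  by (rule linear_map_closed[OF linear_inv_Ad])

text \<open>A contraction with the coaction on \<Omega>0 is computed on a representative, where the
  Sweedler rules for \<open>Ad\<close> apply.\<close>

lemma tlift_inv_Ad:
  assumes U: "module K U" and R: "bilinear K O0 H U R" and h: "h \<in> carrier H"
  shows "tlift K U R (ad (pi0 B h)) = tlift K U (\<lambda>b c. R (pi0 B b) c) (Ad K H h)"
proof -
  have "tlift K U R (ad (pi0 B h)) = tlift K U (\<lambda>b c. tlift K U R (tens K O0 H (pi0 B b) c)) (Ad K H h)"
    unfolding inv_Ad_pi0[OF h]
    by (rule linear_map_of_tlift[OF H_mod H_mod O0H_mod U linear_map_tlift[OF O0_mod H_mod U R] bilinear_pi0_tens])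
      (simp add: h)
  also have "\<dots> = tlift K U (\<lambda>b c. R (pi0 B b) c) (Ad K H h)"
    by (rule tlift_cong[OF H_mod H_mod]) (simp_all add: h tlift_tens[OF O0_mod H_mod U R])
  finally show ?thesis .
qed

subsection \<open>Maps on the forms of the total space\<close>

text \<open>The linear map on \<open>PP\<close> determined by a four-linear \<open>F\<close>; the
  lifts are nested because \<open>PP\<close> is a tensor product of two tensor products.\<close>

definition qlift :: "('k, 'c, 'z) module_scheme \<Rightarrow> ('m \<Rightarrow> 'm \<Rightarrow> 'h \<Rightarrow> 'h \<Rightarrow> 'c) \<Rightarrow> ('k, 'm, 'h) tot2 \<Rightarrow> 'c"
  where "qlift U F = tlift K U (\<lambda>p p'. tlift K U (\<lambda>m h. tlift K U (\<lambda>n g. F m n h g) p') p)"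

lemma P_carrier: "carrier P = carrier (tensor_space K M H)" by (simp add: P_eq)

lemma linear_map_P_iff: "linear_map K P U f \<longleftrightarrow> linear_map K (tensor_space K M H) U f"
  by (simp add: P_eq)

lemma linear_map_tlift_P:
  assumes "module K U" "bilinear K M H U f" shows "linear_map K P U (tlift K U f)"
  unfolding linear_map_P_iff by (rule linear_map_tlift[OF mods(1) H_mod assms])

lemma tlift_mh:
  "module K U \<Longrightarrow> bilinear K M H U f \<Longrightarrow> m \<in> carrier M \<Longrightarrow> h \<in> carrier H \<Longrightarrow> tlift K U f (mh B m h) = f m h"
  unfolding mh_def by (rule tlift_tens[OF mods(1) H_mod])

lemma linear_map_tlift_P_param:
  assumes "module K U" "module K V" "p \<in> carrier P"
    "\<And>x. x \<in> carrier V \<Longrightarrow> bilinear K M H U (f x)"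
    "\<And>m h. m \<in> carrier M \<Longrightarrow> h \<in> carrier H \<Longrightarrow> linear_map K V U (\<lambda>x. f x m h)"
  shows "linear_map K V U (\<lambda>x. tlift K U (f x) p)"
  by (rule linear_map_tlift_param[OF mods(1) H_mod assms(1,2) assms(3)[unfolded P_carrier] assms(4,5)])

context
  fixes U :: "('k, 'c, 'z) module_scheme" and F :: "'m \<Rightarrow> 'm \<Rightarrow> 'h \<Rightarrow> 'h \<Rightarrow> 'c"
  assumes U: "module K U"
    and F1: "\<And>m h. m \<in> carrier M \<Longrightarrow> h \<in> carrier H \<Longrightarrow> bilinear K M H U (\<lambda>n g. F m n h g)"
    and F2: "\<And>n g. n \<in> carrier M \<Longrightarrow> g \<in> carrier H \<Longrightarrow> bilinear K M H U (\<lambda>m h. F m n h g)"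
begin

lemma qlift_inner:
  assumes "p' \<in> carrier P" shows "bilinear K M H U (\<lambda>m h. tlift K U (\<lambda>n g. F m n h g) p')"
  by (intro bilinearI linear_map_tlift_P_param U F1 bilinear_left[OF F2] bilinear_right[OF F2] assms H_mod mods)

lemma qlift_outer: "bilinear K P P U (\<lambda>p p'. tlift K U (\<lambda>m h. tlift K U (\<lambda>n g. F m n h g) p') p)"
  by (intro bilinearI linear_map_tlift_P_param linear_map_tlift_P U F1 qlift_inner mods)

lemma linear_qlift: "linear_map K PP U (qlift U F)"
  unfolding qlift_def PP_of_def by (rule linear_map_tlift[OF mods(2,2) U qlift_outer])

lemma qlift_mmhh:
  "m \<in> carrier M \<Longrightarrow> n \<in> carrier M \<Longrightarrow> h \<in> carrier H \<Longrightarrow> g \<in> carrier H \<Longrightarrow> qlift U F (mmhh B m n h g) = F m n h g"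
  unfolding qlift_def mmhh_def
  by (simp add: tlift_tens[OF mods(2,2) U qlift_outer] tlift_mh[OF U] qlift_inner F1)

end

text \<open>Reduces well-definedness on forms of the bundle to pure data: the generators of
  \<open>NP\<close>, and \<open>m \<otimes> 1 \<otimes> h \<otimes> 1\<close>, which span the
  complement \<open>P \<otimes> 1\<close> of the one-forms.\<close>

lemma induced_q:
  assumes U: "module K U" and f: "linear_map K PP U f"
    and N: "\<And>x. x \<in> NP_gens \<Longrightarrow> f x = \<zero>\<^bsub>U\<^esub>"
    and one: "\<And>m h. m \<in> carrier M \<Longrightarrow> h \<in> carrier H \<Longrightarrow> f (mmhh B m \<one>\<^bsub>M\<^esub> h \<one>\<^bsub>H\<^esub>) = \<zero>\<^bsub>U\<^esub>"
    and g: "\<And>x. x \<in> carrier PP \<Longrightarrow> g x = f x"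
  shows "x \<in> carrier PP \<Longrightarrow> induced g (q x) = f x"
    and "linear_map K OP U (induced g)"
proof -
  have N': "f x = \<zero>\<^bsub>U\<^esub>" if "x \<in> NP" for x
    by (rule linear_map_lin_span_zero[OF mods(3) U f NP_gens_PP N that[unfolded NP_eq]])
  have one': "f (tens K P P p \<one>\<^bsub>P\<^esub>) = \<zero>\<^bsub>U\<^esub>" if "p \<in> carrier P" for p
    by (rule P_eqI[OF U linear_map_comp[OF f] linear_map_const_zero[OF U] _ that])
      ((intro linear_intros)?; simp add: one_P one flip: mmhh_def)+
  note props = Pc.induced_form_of[OF U f[unfolded PP_of_def] N' one' , of g]
  show "x \<in> carrier PP \<Longrightarrow> induced g (q x) = f x"
    using props(1)[of x] g by (simp add: PP_of_def Pc.univ_carrier)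
  show "linear_map K OP U (induced g)"
    using props(2) g by (simp add: PP_of_def Pc.univ_carrier OP_eq)
qed

lemma NP_gens_cases:
  assumes "z \<in> NP_gens"
  obtains x y where "z = flip B x y" "x \<in> carrier MM" "y \<in> carrier HH" "x \<in> NM"
  | x y where "z = flip B x y" "x \<in> carrier MM" "y \<in> carrier HH" "y \<in> NH"
  | x y where "z = flip B x y" "x \<in> carrier MM" "y \<in> carrier HH" "mulM x = \<zero>\<^bsub>M\<^esub>" "mulH y = \<zero>\<^bsub>H\<^esub>"
  using assms by (auto simp: NP_gens_def M.univ_carrier H0.univ_carrier M.N_T)

lemma mulM_NM: "x \<in> NM \<Longrightarrow> mulM x = \<zero>\<^bsub>M\<^esub>"
  using M.N_univ by (simp add: M.univ_carrier)

lemma counit_zero [simp]: "counit H \<zero>\<^bsub>H\<^esub> = \<zero>\<^bsub>K\<^esub>"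
  using ker_sub submodule_zero_closed[OF H_mod] by (auto simp: ker_counit_def)

subsubsection \<open>Projection to the forms on the base\<close>

text \<open>\<open>base_form\<close> is the horizontal component in \<open>\<Omega>\<^sup>1(M) \<otimes> H\<close> followed by the counit of \<open>H\<close>.  It
  recovers the gauge field from a connection.\<close>

definition base_pre :: "('k, 'm, 'h) tot2 \<Rightarrow> ('k, 'm, 'm) tens set"
  where "base_pre = qlift OM (\<lambda>m n h g. counit H (h \<cdot> g) \<odot>\<^bsub>OM\<^esub> qM (tM m n))"

definition base_form :: "('k, 'm, 'h) tot2 set \<Rightarrow> ('k, 'm, 'm) tens set"
  where "base_form = induced base_pre"

lemma base_pre_props:
  shows linear_base_pre: "linear_map K PP OM base_pre"
    and base_pre_mmhh: "m \<in> carrier M \<Longrightarrow> n \<in> carrier M \<Longrightarrow> h \<in> carrier H \<Longrightarrow> g \<in> carrier H \<Longrightarrow>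
      base_pre (mmhh B m n h g) = counit H (h \<cdot> g) \<odot>\<^bsub>OM\<^esub> qM (tM m n)"
  unfolding base_pre_def
  by ((rule linear_qlift qlift_mmhh; (intro linear_intros)?; simp)+)

lemma base_pre_flip:
  assumes "x \<in> carrier MM" "y \<in> carrier HH"
  shows "base_pre (flip B x y) = counit H (mulH y) \<odot>\<^bsub>OM\<^esub> qM x"
  by (rule MM_HH_eqI[OF O_mods(1) _ _ _ assms])
    ((intro linear_intros linear_map_comp[OF linear_base_pre])?; simp add: base_pre_mmhh)+

text \<open>On the relations, the first family is killed by \<open>qM\<close>, and the other two
  vanish because their component in \<open>H \<otimes> H\<close> multiplies to zero.\<close>

lemma base_form_props:
  shows base_form_q: "x \<in> carrier PP \<Longrightarrow> base_form (q x) = base_pre x"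
    and linear_base_form: "linear_map K OP OM base_form"
proof -
  have N: "base_pre z = \<zero>\<^bsub>OM\<^esub>" if "z \<in> NP_gens" for z
    using that
    by (cases rule: NP_gens_cases) (simp_all add: base_pre_flip mulH_NH flip: OM_eq)
  have one: "base_pre (mmhh B m \<one>\<^bsub>M\<^esub> h \<one>\<^bsub>H\<^esub>) = \<zero>\<^bsub>OM\<^esub>" if "m \<in> carrier M" "h \<in> carrier H" for m h
    using that M.form_of_tens_one[folded OM_eq, of m] by (simp add: base_pre_mmhh)
  show "x \<in> carrier PP \<Longrightarrow> base_form (q x) = base_pre x" "linear_map K OP OM base_form"
    unfolding base_form_def by (rule induced_q[OF O_mods(1) linear_base_pre N one]; simp)+
qed

lemma linear_map_base_form [linear_intros]:
  "linear_map K V OP f \<Longrightarrow> linear_map K V OM (\<lambda>x. base_form (f x))"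
  by (rule linear_map_comp[OF linear_base_form])

lemma base_form_closed [simp]: "X \<in> carrier OP \<Longrightarrow> base_form X \<in> carrier OM"
  by (rule linear_map_closed[OF linear_base_form])

lemma base_form_hor:
  assumes "X \<in> carrier OM" "h \<in> carrier H"
  shows "base_form (hor B X h) = counit H h \<odot>\<^bsub>OM\<^esub> X"
proof -
  obtain x where "x \<in> carrier MM" "X = qM x" using assms(1) by (elim OM_cases)
  then show ?thesis using assms by (simp add: hor_qM base_form_q base_pre_flip)
qed

subsubsection \<open>The vertical map\<close>

abbreviation "PH \<equiv> tensor_space K P H"
abbreviation "PO \<equiv> tensor_space K P O0"
abbreviation "OH \<equiv> tensor_space K OP H"

lemma tensor_mods [simp, linear_intros]: "module K PH" "module K PO" "module K OH"
  by (simp_all add: module_tensor_space)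

lemma bilinear_coactP:
  "bilinear K M H PH (\<lambda>m h. sw PH (\<lambda>a b. tens K P H (mh B m a) b) h)"
  by (intro linear_intros; simp add: tens_closed)

lemma coactP_eq: "coactP B = tlift K PH (\<lambda>m h. sw PH (\<lambda>a b. tens K P H (mh B m a) b) h)"
  by (simp add: coactP_def Let_def)

lemma linear_coactP: "linear_map K P PH (coactP B)"
  unfolding coactP_eq by (rule linear_map_tlift_P[OF tensor_mods(1) bilinear_coactP])

lemma coactP_closed [simp]: "p \<in> carrier P \<Longrightarrow> coactP B p \<in> carrier PH"
  by (rule linear_map_closed[OF linear_coactP])

lemma coactP_mh: "m \<in> carrier M \<Longrightarrow> h \<in> carrier H \<Longrightarrow>
    coactP B (mh B m h) = sw PH (\<lambda>a b. tens K P H (mh B m a) b) h"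
  unfolding coactP_eq by (rule tlift_mh[OF tensor_mods(1) bilinear_coactP])

lemma tlift_coactP:
  assumes U: "module K U" and f: "bilinear K P H U f" and mh: "m \<in> carrier M" "h \<in> carrier H"
  shows "tlift K U f (coactP B (mh B m h)) = sw U (\<lambda>a b. f (mh B m a) b) h"
proof -
  have "tlift K U f (coactP B (mh B m h)) = sw U (\<lambda>a b. tlift K U f (tens K P H (mh B m a) b)) h"
    unfolding coactP_mh[OF mh]
    by (rule tlift_sweedler2[OF mods(2) H_mod U f _ mh(2)]) (intro linear_intros; simp add: mh)
  then show ?thesis
    using mh by (simp add: tlift_tens[OF mods(2) H_mod U f] cong: sweedler2_cong)
qed

lemma ver_inner: "p \<in> carrier P \<Longrightarrow> bilinear K P H PH (\<lambda>p' h. tens K P H (p \<otimes>\<^bsub>P\<^esub> p') h)"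
  by (intro linear_intros; simp)

lemma ver_outer: "bilinear K P P PH (\<lambda>p p'. tlift K PH (\<lambda>q h. tens K P H (p \<otimes>\<^bsub>P\<^esub> q) h) (coactP B p'))"
  by (intro bilinearI linear_map_tlift_arg[OF mods(2) H_mod tensor_mods(1)] linear_coactP
      linear_map_tlift_param[OF mods(2) H_mod tensor_mods(1) mods(2)] ver_inner linear_intros)
    simp_all

lemma linear_ver: "linear_map K PP PH (ver B)"
  unfolding ver_def Let_def PP_of_def by (rule linear_map_tlift[OF mods(2,2) tensor_mods(1) ver_outer])

lemma ver_mmhh:
  assumes "m \<in> carrier M" "n \<in> carrier M" "h \<in> carrier H" "g \<in> carrier H"
  shows "ver B (mmhh B m n h g) = sw PH (\<lambda>a b. tens K P H (mh B (m \<otimes>\<^bsub>M\<^esub> n) (h \<cdot> a)) b) g"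
proof -
  have "ver B (mmhh B m n h g) = tlift K PH (\<lambda>q k. tens K P H (mh B m h \<otimes>\<^bsub>P\<^esub> q) k) (coactP B (mh B n g))"
    unfolding ver_def Let_def mmhh_def
    by (rule tlift_tens[OF mods(2,2) tensor_mods(1) ver_outer]) (simp_all add: assms)
  also have "\<dots> = sw PH (\<lambda>a b. tens K P H (mh B m h \<otimes>\<^bsub>P\<^esub> mh B n a) b) g"
    by (rule tlift_coactP[OF tensor_mods(1) ver_inner]) (simp_all add: assms)
  finally show ?thesis using assms by (simp cong: sweedler2_cong)
qed

definition ver_pre :: "('k, 'm, 'h) tot2 \<Rightarrow> ('k, ('k, 'm, 'h) tot, 'h set) tens"
  where "ver_pre x = tlift K PO (\<lambda>p h. tens K P O0 p (pi0 B h)) (ver B x)"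

lemma bilinear_tens_pi0: "bilinear K P H PO (\<lambda>p h. tens K P O0 p (pi0 B h))"
  by (intro linear_intros; simp)

lemma linear_ver_pre: "linear_map K PP PO ver_pre"
  unfolding ver_pre_def
  by (rule linear_map_tlift_arg[OF mods(2) H_mod tensor_mods(2) bilinear_tens_pi0 linear_ver])

lemma ver_pre_mmhh:
  assumes "m \<in> carrier M" "n \<in> carrier M" "h \<in> carrier H" "g \<in> carrier H"
  shows "ver_pre (mmhh B m n h g) = sw PO (\<lambda>a b. tens K P O0 (mh B (m \<otimes>\<^bsub>M\<^esub> n) (h \<cdot> a)) (pi0 B b)) g"
proof -
  have "ver_pre (mmhh B m n h g) = sw PO (\<lambda>a b. tlift K PO (\<lambda>p h. tens K P O0 p (pi0 B h))
      (tens K P H (mh B (m \<otimes>\<^bsub>M\<^esub> n) (h \<cdot> a)) b)) g"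
    unfolding ver_pre_def ver_mmhh[OF assms]
    by (rule tlift_sweedler2[OF mods(2) H_mod tensor_mods(2) bilinear_tens_pi0 _ assms(4)])
      (intro linear_intros; simp add: assms)
  then show ?thesis
    using assms
    by (simp add: tlift_tens[OF mods(2) H_mod tensor_mods(2) bilinear_tens_pi0] cong: sweedler2_cong)
qed

definition vert :: "'m \<Rightarrow> ('k, 'h, 'h) tens \<Rightarrow> ('k, ('k, 'm, 'h) tot, 'h set) tens"
  where "vert m = tlift K PO (\<lambda>h g. tens K P O0 (mh B m h) (pi0 B g))"

lemma vert_inner: "m \<in> carrier M \<Longrightarrow> bilinear K H H PO (\<lambda>h g. tens K P O0 (mh B m h) (pi0 B g))"
  by (intro linear_intros; simp)

lemma bilinear_vert: "bilinear K M HH PO vert"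
  unfolding vert_def
  by (intro bilinearI linear_map_tlift linear_map_tlift_param[OF H_mod H_mod] vert_inner linear_intros) simp_all

lemma vert_tens [simp]:
  "m \<in> carrier M \<Longrightarrow> h \<in> carrier H \<Longrightarrow> g \<in> carrier H \<Longrightarrow> vert m (tH h g) = tens K P O0 (mh B m h) (pi0 B g)"
  unfolding vert_def by (rule tlift_tens[OF H_mod H_mod tensor_mods(2) vert_inner])

lemma Psi_closed [simp]: "y \<in> carrier HH \<Longrightarrow> Psi y \<in> carrier HH"
  by (rule linear_map_closed[OF linear_Psi])

text \<open>Since \<open>ver\<close> sends \<open>m \<otimes> n \<otimes> h \<otimes> g\<close> to
  \<open>mn \<otimes> h g1 \<otimes> g2\<close>, its action on \<open>H \<otimes> H\<close> is
  \<open>Psi\<close>. Vanishing on relations is then immediate: either \<open>mulM x = 0\<close>, or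
  \<open>Psi y\<close> lies in \<open>HQ\<close>.\<close>

lemma ver_pre_flip:
  assumes "x \<in> carrier MM" "y \<in> carrier HH"
  shows "ver_pre (flip B x y) = vert (mulM x) (Psi y)"
proof (rule MM_HH_eqI[OF tensor_mods(2) _ _ _ assms])
  show "bilinear K MM HH PO (\<lambda>x y. ver_pre (flip B x y))"
    by (intro linear_intros linear_map_comp[OF linear_ver_pre]; simp)
  show "bilinear K MM HH PO (\<lambda>x y. vert (mulM x) (Psi y))"
    by (intro bilinearI bilinear_left_comp[OF bilinear_vert] bilinear_right_comp[OF bilinear_vert]
        linear_Psi linear_intros; simp)
  fix m n h g assume A: "m \<in> carrier M" "n \<in> carrier M" "h \<in> carrier H" "g \<in> carrier H"
  have "vert (m \<otimes>\<^bsub>M\<^esub> n) (sw HH (\<lambda>a b. tH (h \<cdot> a) b) g)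
     = sw PO (\<lambda>a b. vert (m \<otimes>\<^bsub>M\<^esub> n) (tH (h \<cdot> a) b)) g"
    by (rule linear_map_of_sweedler2[OF module_HH tensor_mods(2) bilinear_right[OF bilinear_vert]])
      ((intro linear_intros)?; simp add: A)+
  then show "ver_pre (flip B (tM m n) (tH h g)) = vert (mulM (tM m n)) (Psi (tH h g))"
    using A by (simp add: ver_pre_mmhh cong: sweedler2_cong)
qed

lemma verN_props:
  shows verN_q: "x \<in> carrier PP \<Longrightarrow> verN B (q x) = ver_pre x"
    and linear_verN: "linear_map K OP PO (verN B)"
proof -
  have vert0: "vert \<zero>\<^bsub>M\<^esub> z = \<zero>\<^bsub>PO\<^esub>" if "z \<in> carrier HH" for z
    by (rule bilinear_zero_left[OF mods(1) tensor_mods(2) bilinear_vert that])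
  have vertQ: "vert m z = \<zero>\<^bsub>PO\<^esub>" if "m \<in> carrier M" "z \<in> HQ" for m z
    by (rule linear_map_HQ_zero[OF tensor_mods(2) bilinear_right[OF bilinear_vert that(1)] _ that(2)])
      (simp add: that tens_zero_right)
  have N: "ver_pre z = \<zero>\<^bsub>PO\<^esub>" if "z \<in> NP_gens" for z
    using that
    by (cases rule: NP_gens_cases) (simp_all add: ver_pre_flip mulM_NM vert0 vertQ NH_iff)
  have one: "ver_pre (mmhh B m \<one>\<^bsub>M\<^esub> h \<one>\<^bsub>H\<^esub>) = \<zero>\<^bsub>PO\<^esub>" if "m \<in> carrier M" "h \<in> carrier H" for m h
  proof -
    have "ver_pre (mmhh B m \<one>\<^bsub>M\<^esub> h \<one>\<^bsub>H\<^esub>)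
      = tens K P O0 (mh B (m \<otimes>\<^bsub>M\<^esub> \<one>\<^bsub>M\<^esub>) (h \<cdot> \<one>\<^bsub>H\<^esub>)) (pi0 B \<one>\<^bsub>H\<^esub>)"
      using that by (simp only: ver_pre_mmhh M.A.one_closed H.one_closed)
        (rule sweedler2_one[OF tensor_mods(2)], intro linear_intros; simp)
    then show ?thesis using that by (simp add: tens_zero_right)
  qed
  have eq: "verN B = induced ver_pre" by (rule ext) (simp add: verN_def ver_pre_def[abs_def])
  show "x \<in> carrier PP \<Longrightarrow> verN B (q x) = ver_pre x" "linear_map K OP PO (verN B)"
    unfolding eq by (rule induced_q[OF tensor_mods(2) linear_ver_pre N one]; simp)+
qed

lemma verN_closed [simp]: "X \<in> carrier OP \<Longrightarrow> verN B X \<in> carrier PO"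
  by (rule linear_map_closed[OF linear_verN])

lemma verN_hor:
  assumes "X \<in> carrier OM" "h \<in> carrier H" shows "verN B (hor B X h) = \<zero>\<^bsub>PO\<^esub>"
proof -
  obtain x where "x \<in> carrier MM" "X = qM x" using assms(1) by (elim OM_cases)
  then show ?thesis
    using assms bilinear_zero_left[OF mods(1) tensor_mods(2) bilinear_vert] linear_map_closed[OF linear_Psi]
    by (simp add: hor_qM verN_q ver_pre_flip del: Psi_tens)
qed

subsubsection \<open>The coaction on forms\<close>

text \<open>The formula inside \<open>coactForms\<close> with the class of \<open>a db\<close>
  written as the extended quotient map at \<open>a \<otimes> b\<close>, which is linear in each
  argument by syntax alone.\<close>

definition coact_pre :: "('k, 'm, 'h) tot2 \<Rightarrow> ('k, ('k, 'm, 'h) tot2 set, 'h) tens"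
  where "coact_pre = tlift K OH (\<lambda>p p'. tlift K OH (\<lambda>a h. tlift K OH (\<lambda>b g.
        tens K OP H (q (tens K P P a b)) (h \<cdot> g)) (coactP B p')) (coactP B p))"

lemma coact1: "a \<in> carrier P \<Longrightarrow> h \<in> carrier H \<Longrightarrow>
    bilinear K P H OH (\<lambda>b g. tens K OP H (q (tens K P P a b)) (h \<cdot> g))"
  by (intro linear_intros; simp)

lemma coact2: "p' \<in> carrier P \<Longrightarrow> bilinear K P H OH (\<lambda>a h. tlift K OH (\<lambda>b g.
        tens K OP H (q (tens K P P a b)) (h \<cdot> g)) (coactP B p'))"
  by (intro bilinearI linear_map_tlift_param[OF mods(2) H_mod tensor_mods(3)] coact1 linear_intros) simp_all

lemma coact3: "bilinear K P P OH (\<lambda>p p'. tlift K OH (\<lambda>a h. tlift K OH (\<lambda>b g.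
        tens K OP H (q (tens K P P a b)) (h \<cdot> g)) (coactP B p')) (coactP B p))"
  by (intro bilinearI linear_map_tlift_param[OF mods(2) H_mod tensor_mods(3)] coact2 coact1 linear_coactP
      linear_map_tlift_arg[OF mods(2) H_mod tensor_mods(3)]) simp_all

lemma linear_coact_pre: "linear_map K PP OH coact_pre"
  unfolding coact_pre_def PP_of_def by (rule linear_map_tlift[OF mods(2,2) tensor_mods(3) coact3])

lemma coact_pre_mmhh:
  assumes "m \<in> carrier M" "n \<in> carrier M" "h \<in> carrier H" "g \<in> carrier H"
  shows "coact_pre (mmhh B m n h g)
    = sw OH (\<lambda>a b. sw OH (\<lambda>c d. tens K OP H (q (mmhh B m n a c)) (b \<cdot> d)) g) h"
proof -
  have "coact_pre (mmhh B m n h g) = tlift K OH (\<lambda>a h. tlift K OH (\<lambda>b g.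
        tens K OP H (q (tens K P P a b)) (h \<cdot> g)) (coactP B (mh B n g))) (coactP B (mh B m h))"
    unfolding coact_pre_def mmhh_def
    by (rule tlift_tens[OF mods(2,2) tensor_mods(3) coact3]) (simp_all add: assms)
  also have "\<dots> = sw OH (\<lambda>a b. tlift K OH (\<lambda>c d.
        tens K OP H (q (tens K P P (mh B m a) c)) (b \<cdot> d)) (coactP B (mh B n g))) h"
    by (rule tlift_coactP[OF tensor_mods(3) coact2]) (simp_all add: assms)
  also have "\<dots> = sw OH (\<lambda>a b. sw OH (\<lambda>c d.
        tens K OP H (q (tens K P P (mh B m a) (mh B n c))) (b \<cdot> d)) g) h"
    by (rule sweedler2_cong[OF refl assms(3)], rule tlift_coactP[OF tensor_mods(3) coact1]) (simp_all add: assms)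
  finally show ?thesis by (simp add: mmhh_def)
qed

text \<open>\<open>a db\<close> equals \<open>a \<otimes> b - ab \<otimes> 1\<close>, and
  \<open>q\<close> kills the second term.\<close>

lemma piP_lact_d:
  assumes "a \<in> carrier P" "b \<in> carrier P"
  shows "piP B (lact K P a (univ_d K P b)) = q (tens K P P a b)"
proof -
  have d: "univ_d K P b = tens K P P \<one>\<^bsub>P\<^esub> b \<ominus>\<^bsub>PP\<^esub> tens K P P b \<one>\<^bsub>P\<^esub>"
    by (simp add: univ_d_def PP_of_def)
  have mul: "mulP (univ_d K P b) = \<zero>\<^bsub>P\<^esub>" and cl: "univ_d K P b \<in> carrier PP"
    using linear_map_closed[OF Pc.linear_resid, of "tens K P P \<one>\<^bsub>P\<^esub> b"] assms(2)
    by (simp_all add: univ_d_def Pc.resid_def Pc.univ_carrier PP_of_def)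
  have "piP B (lact K P a (univ_d K P b)) = q (lact K P a (univ_d K P b))"
    using mul cl assms(1) by (intro piP_q) (simp_all add: P0.mul_lact PP_of_def)
  also have "\<dots> = q (lact K P a (tens K P P \<one>\<^bsub>P\<^esub> b)) \<ominus>\<^bsub>OP\<^esub> q (lact K P a (tens K P P b \<one>\<^bsub>P\<^esub>))"
    unfolding d
    by (rule linear_map_minus[OF mods(3) O_mods(2)]) ((intro linear_intros)?; simp add: assms)+
  also have "\<dots> = q (tens K P P a b)"
    using assms linear_map_zero[OF O_mods(2,2) linear_map_neg[OF O_mods(2) linear_map_id]]
    by (simp add: a_minus_def flip: OP_eq)
  finally show ?thesis .
qed

text \<open>The diagonal coaction on \<open>H \<otimes> H\<close>, followed by the class of \<open>x \<otimes> _\<close> in the first factor.\<close>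

definition diag_coact :: "('k, 'm, 'm) tens \<Rightarrow> ('k, 'h, 'h) tens \<Rightarrow> ('k, ('k, 'm, 'h) tot2 set, 'h) tens"
  where "diag_coact x = tlift K OH (\<lambda>h g. sw OH (\<lambda>a b. sw OH (\<lambda>c d.
    tens K OP H (q (flip B x (tH a c))) (b \<cdot> d)) g) h)"

lemma diag_coact_inner: "x \<in> carrier MM \<Longrightarrow> bilinear K H H OH (\<lambda>h g. sw OH (\<lambda>a b. sw OH (\<lambda>c d.
    tens K OP H (q (flip B x (tH a c))) (b \<cdot> d)) g) h)"
  by (intro linear_intros; simp)

lemma bilinear_diag_coact: "bilinear K MM HH OH diag_coact"
  unfolding diag_coact_def
  by (intro bilinearI linear_map_tlift linear_map_tlift_param[OF H_mod H_mod] diag_coact_inner) ((intro linear_intros)?; simp)+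

lemma diag_coact_tens: "x \<in> carrier MM \<Longrightarrow> h \<in> carrier H \<Longrightarrow> g \<in> carrier H \<Longrightarrow>
    diag_coact x (tH h g) = sw OH (\<lambda>a b. sw OH (\<lambda>c d. tens K OP H (q (flip B x (tH a c))) (b \<cdot> d)) g) h"
  unfolding diag_coact_def by (rule tlift_tens[OF H_mod H_mod tensor_mods(3) diag_coact_inner])

lemma coact_pre_flip:
  assumes "x \<in> carrier MM" "y \<in> carrier HH"
  shows "coact_pre (flip B x y) = diag_coact x y"
proof (rule MM_HH_eqI[OF tensor_mods(3) _ _ _ assms])
  show "bilinear K MM HH OH (\<lambda>x y. coact_pre (flip B x y))"
    by (intro linear_intros linear_map_comp[OF linear_coact_pre]; simp)
  show "bilinear K MM HH OH (\<lambda>x y. diag_coact x y)" by (simp add: bilinear_diag_coact)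
qed (simp add: coact_pre_mmhh diag_coact_tens cong: sweedler2_cong)

lemma diag_coact_NM:
  assumes "x \<in> NM" "y \<in> carrier HH" shows "diag_coact x y = \<zero>\<^bsub>OH\<^esub>"
proof (rule linear_map_eq_on_tensor_space[OF H_mod H_mod tensor_mods(3) bilinear_right[OF bilinear_diag_coact]
      linear_map_const_zero _ assms(2)])
  fix h g assume "h \<in> carrier H" "g \<in> carrier H"
  then show "diag_coact x (tH h g) = \<zero>\<^bsub>OH\<^esub>"
    using assms by (simp add: diag_coact_tens M.N_T q_flip_NM tens_zero_left sweedler2_zero cong: sweedler2_cong)
qed (simp_all add: M.N_T assms)

text \<open>When \<open>x\<close> is a one-form, the class of
  \<open>x \<otimes> a \<otimes> c\<close> depends only on \<open>a \<cdot> c\<close>; by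
  multiplicativity of the coproduct the diagonal coaction then sees only the product of
  \<open>y\<close>.\<close>

lemma diag_coact_Om:
  assumes "x \<in> carrier MM" "mulM x = \<zero>\<^bsub>M\<^esub>" "y \<in> carrier HH"
  shows "diag_coact x y = sw OH (\<lambda>u v. tens K OP H (q (flip B x (tH \<one>\<^bsub>H\<^esub> u))) v) (mulH y)"
proof (rule linear_map_eq_on_tensor_space[OF H_mod H_mod tensor_mods(3) bilinear_right[OF bilinear_diag_coact assms(1)]
      _ _ assms(3)])
  show "linear_map K HH OH (\<lambda>y. sw OH (\<lambda>u v. tens K OP H (q (flip B x (tH \<one>\<^bsub>H\<^esub> u))) v) (mulH y))"
    by (intro linear_intros; simp add: assms)
  fix h g assume hg: "h \<in> carrier H" "g \<in> carrier H"
  have "sw OH (\<lambda>u v. tens K OP H (q (flip B x (tH \<one>\<^bsub>H\<^esub> u))) v) (h \<cdot> g) = sw OH (\<lambda>a b. sw OH (\<lambda>c d.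
     tens K OP H (q (flip B x (tH \<one>\<^bsub>H\<^esub> (a \<cdot> c)))) (b \<cdot> d)) g) h"
    by (rule sweedler2_mult[OF tensor_mods(3)]) ((intro linear_intros)?; simp add: hg assms)+
  also have "\<dots> = diag_coact x (tH h g)"
  proof -
    have "q (flip B x (tH \<one>\<^bsub>H\<^esub> (a \<cdot> c))) = q (flip B x (tH a c))"
      if "a \<in> carrier H" "c \<in> carrier H" for a c
      using q_flip_mul[OF assms(1,2), of "tH a c"] that by simp
    then show ?thesis using hg assms by (simp add: diag_coact_tens cong: sweedler2_cong)
  qed
  finally show "diag_coact x (tH h g) = sw OH (\<lambda>u v. tens K OP H (q (flip B x (tH \<one>\<^bsub>H\<^esub> u))) v) (mulH (tH h g))"
    using hg by simp
qed

text \<open>The decisive relation for the coaction on forms. On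
  \<open>h \<cdot> S r1 \<otimes> r2\<close> with \<open>r\<close> in \<open>Q\<close>, the part
  from \<open>r\<close> becomes a contraction with \<open>Ad r\<close>, whose first legs lie in
  \<open>Q\<close> by Ad-stability; such a leg \<open>s\<close> then enters as
  \<open>k \<cdot> S s1 \<otimes> s2\<close>, which is in \<open>NH\<close>.\<close>

lemma diag_coact_NH:
  assumes x: "x \<in> carrier MM" and y: "y \<in> NH" shows "diag_coact x y = \<zero>\<^bsub>OH\<^esub>"
proof -
  note C = bilinear_right[OF bilinear_diag_coact x]
  have "diag_coact x (Xi z) = \<zero>\<^bsub>OH\<^esub>" if "z \<in> HQ" for z
  proof (rule linear_map_HQ_zero[OF tensor_mods(3) linear_map_comp[OF C linear_Xi] _ that])
    fix h r assume h: "h \<in> carrier H" and r: "r \<in> Q"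
    have "diag_coact x (Xi (tH h r)) = sw OH (\<lambda>a b. diag_coact x (tH (h \<cdot> S a) b)) r"
      using h r by (simp, intro linear_map_of_sweedler2[OF module_HH tensor_mods(3) C] linear_intros; simp)
    also have "\<dots> = sw OH (\<lambda>a b. sw OH (\<lambda>k l. sw OH (\<lambda>c d.
        tens K OP H (q (flip B x (tH k c))) (l \<cdot> d)) b) (h \<cdot> S a)) r"
      using h r x by (simp add: diag_coact_tens cong: sweedler2_cong)
    also have "\<dots> = sw OH (\<lambda>a b. sw OH (\<lambda>k l. sw OH (\<lambda>k' l'. sw OH (\<lambda>c d.
        tens K OP H (q (flip B x (tH (k \<cdot> k') c))) (l \<cdot> l' \<cdot> d)) b) (S a)) h) r"
      by (rule sweedler2_cong[OF refl], simp add: r, rule sweedler2_mult[OF tensor_mods(3)])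
        ((intro linear_intros)?; simp add: h r x)+
    \<comment> \<open>Summing over the legs \<open>k\<close>, \<open>l\<close> of \<open>h\<close>
      last leaves, for fixed \<open>k\<close> and \<open>l\<close>, exactly the expression treated
      by \<open>antipode_form_coaction\<close>.\<close>
    also have "\<dots> = sw OH (\<lambda>k l. sw OH (\<lambda>a b. sw OH (\<lambda>k' l'. sw OH (\<lambda>c d.
        tens K OP H (q (flip B x (tH (k \<cdot> k') c))) (l \<cdot> l' \<cdot> d)) b) (S a)) r) h"
      by (rule sweedler2_swap[OF tensor_mods(3)]) ((intro linear_intros)?; simp add: h r x)+
    also have "\<dots> = sw OH (\<lambda>k l. \<zero>\<^bsub>OH\<^esub>) h"
    proof (rule sweedler2_cong[OF refl h])
      fix k l assume kl: "k \<in> carrier H" "l \<in> carrier H"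
      let ?Y = "\<lambda>k' c. q (flip B x (tH (k \<cdot> k') c))"
      let ?R = "\<lambda>v w. tens K OP H v (l \<cdot> w)"
      have Y: "bilinear K H H OP ?Y" by (intro linear_intros; simp add: kl x)
      have R: "bilinear K OP H OH ?R" by (intro linear_intros; simp add: kl)
      have "sw OH (\<lambda>a b. sw OH (\<lambda>k' l'. sw OH (\<lambda>c d. ?R (?Y k' c) (l' \<cdot> d)) b) (S a)) r
         = tlift K OH (\<lambda>s w. ?R (sw OP (\<lambda>a c. ?Y (S a) c) s) w) (Ad K H r)"
        by (rule antipode_form_coaction[OF O_mods(2) tensor_mods(3) Y R]) (simp add: r)
      also have "\<dots> = \<zero>\<^bsub>OH\<^esub>"
      proof (rule tlift_Ad_Q_zero[OF tensor_mods(3) _ r])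
        show "bilinear K H H OH (\<lambda>s w. ?R (sw OP (\<lambda>a c. ?Y (S a) c) s) w)"
          by (intro linear_intros; simp add: kl x)
        fix s w assume s: "s \<in> Q" and w: "w \<in> carrier H"
        have "sw OP (\<lambda>a c. ?Y (S a) c) s = q (flip B x (sw HH (\<lambda>a c. tH (k \<cdot> S a) c) s))"
          by (rule linear_map_of_sweedler2[OF module_HH O_mods(2), symmetric, of "\<lambda>y. q (flip B x y)"])
            ((intro linear_intros)?; simp add: kl x s)+
        also have "\<dots> = \<zero>\<^bsub>OP\<^esub>" by (rule q_flip_NH[OF x antipode_NH[OF kl(1) s]])
        finally show "?R (sw OP (\<lambda>a c. ?Y (S a) c) s) w = \<zero>\<^bsub>OH\<^esub>"
          using kl w by (simp add: tens_zero_left)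
      qed
      finally show "sw OH (\<lambda>a b. sw OH (\<lambda>k' l'. sw OH (\<lambda>c d.
        tens K OP H (q (flip B x (tH (k \<cdot> k') c))) (l \<cdot> l' \<cdot> d)) b) (S a)) r = \<zero>\<^bsub>OH\<^esub>"
        using kl r x by (simp add: H.m_assoc cong: sweedler2_cong)
    qed
    also have "\<dots> = \<zero>\<^bsub>OH\<^esub>" by (rule sweedler2_zero[OF tensor_mods(3) h])
    finally show "diag_coact x (Xi (tH h r)) = \<zero>\<^bsub>OH\<^esub>" .
  qed
  from this[of "Psi y"] show ?thesis using y by (simp add: NH_iff Xi_Psi)
qed

lemma coactForms_props:
  shows coactForms_q: "x \<in> carrier PP \<Longrightarrow> coactForms B (q x) = coact_pre x"
    and linear_coactForms: "linear_map K OP OH (coactForms B)"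
proof -
  define F where "F = tlift K OH (\<lambda>p p'. tlift K OH (\<lambda>a h. tlift K OH (\<lambda>b g.
        tens K OP H (piP B (lact K P a (univ_d K P b))) (h \<cdot> g)) (coactP B p')) (coactP B p))"
  \<comment> \<open>\<open>tlift_cong\<close> exchanges \<open>piP\<close> of \<open>a db\<close>
    for \<open>q\<close> under the lifts, so that bilinearity has to be proved only for the formula
    with \<open>q\<close>.\<close>
  have F: "F x = coact_pre x" if "x \<in> carrier PP" for x
    unfolding F_def coact_pre_def
    by (intro tlift_cong[OF mods(2,2)] tlift_cong[OF mods(2) H_mod])
      (use that in \<open>simp_all add: piP_lact_d PP_of_def\<close>)
  have N: "coact_pre z = \<zero>\<^bsub>OH\<^esub>" if "z \<in> NP_gens" for z
    using that
  proof (cases rule: NP_gens_cases)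
    case (3 x y)
    have "sw OH (\<lambda>u v. tens K OP H (q (flip B x (tH \<one>\<^bsub>H\<^esub> u))) v) \<zero>\<^bsub>H\<^esub> = \<zero>\<^bsub>OH\<^esub>"
      by (rule linear_map_zero[OF H_mod tensor_mods(3)]) (intro linear_intros; simp add: 3)
    then show ?thesis using 3 by (simp add: coact_pre_flip diag_coact_Om)
  qed (simp_all add: coact_pre_flip diag_coact_NM diag_coact_NH)
  have one: "coact_pre (mmhh B m \<one>\<^bsub>M\<^esub> h \<one>\<^bsub>H\<^esub>) = \<zero>\<^bsub>OH\<^esub>" if mh: "m \<in> carrier M" "h \<in> carrier H" for m h
  proof -
    have "coact_pre (mmhh B m \<one>\<^bsub>M\<^esub> h \<one>\<^bsub>H\<^esub>)
       = sw OH (\<lambda>a b. sw OH (\<lambda>c d. tens K OP H (q (mmhh B m \<one>\<^bsub>M\<^esub> a c)) (b \<cdot> d)) \<one>\<^bsub>H\<^esub>) h"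
      using mh by (simp add: coact_pre_mmhh)
    also have "\<dots> = sw OH (\<lambda>a b. \<zero>\<^bsub>OH\<^esub>) h"
    proof (rule sweedler2_cong[OF refl mh(2)])
      fix a b assume ab: "a \<in> carrier H" "b \<in> carrier H"
      have "sw OH (\<lambda>c d. tens K OP H (q (mmhh B m \<one>\<^bsub>M\<^esub> a c)) (b \<cdot> d)) \<one>\<^bsub>H\<^esub>
          = tens K OP H (q (mmhh B m \<one>\<^bsub>M\<^esub> a \<one>\<^bsub>H\<^esub>)) (b \<cdot> \<one>\<^bsub>H\<^esub>)"
        by (rule sweedler2_one[OF tensor_mods(3)]) (intro linear_intros; simp add: mh ab)
      then show "sw OH (\<lambda>c d. tens K OP H (q (mmhh B m \<one>\<^bsub>M\<^esub> a c)) (b \<cdot> d)) \<one>\<^bsub>H\<^esub> = \<zero>\<^bsub>OH\<^esub>"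
        using mh ab by (simp add: tens_zero_left)
    qed
    finally show ?thesis using mh by (simp add: sweedler2_zero)
  qed
  have eq: "coactForms B = induced F" by (rule ext) (simp add: coactForms_def Let_def F_def)
  show "x \<in> carrier PP \<Longrightarrow> coactForms B (q x) = coact_pre x" "linear_map K OP OH (coactForms B)"
    unfolding eq by (rule induced_q[OF tensor_mods(3) linear_coact_pre N one F]; simp)+
qed

text \<open>The component of \<open>hor B X h\<close> in \<open>H \<otimes> H\<close> is
  \<open>1 \<otimes> h\<close> with product \<open>h\<close>, so the coaction is the coproduct of
  \<open>h\<close> with \<open>X\<close> untouched: this is the cofree coaction.\<close>

lemma coactForms_hor:
  assumes "X \<in> carrier OM" "h \<in> carrier H"
  shows "coactForms B (hor B X h) = sw OH (\<lambda>u v. tens K OP H (hor B X u) v) h"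
proof -
  obtain x where x: "x \<in> carrier MM" "X = qM x" using assms(1) by (elim OM_cases)
  have "coactForms B (hor B X h) = sw OH (\<lambda>u v. tens K OP H (q (flip B (resid x) (tH \<one>\<^bsub>H\<^esub> u))) v) h"
    using assms x by (simp add: hor_qM coactForms_q coact_pre_flip diag_coact_Om)
  then show ?thesis using assms x by (simp add: hor_qM cong: sweedler2_cong)
qed

text \<open>Passing to the quotient by \<open>N\<close> turns membership into an equation, to which
  the test on pure tensors applies.\<close>

lemma PP_in_submodule:
  assumes U: "module K U" and N: "submodule N K U" and f: "linear_map K PP U f" and x: "x \<in> carrier PP"
    and mem: "\<And>m n h g. m \<in> carrier M \<Longrightarrow> n \<in> carrier M \<Longrightarrow> h \<in> carrier H \<Longrightarrow> g \<in> carrier H \<Longrightarrow>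
      f (mmhh B m n h g) \<in> N"
  shows "f x \<in> N"
proof -
  let ?Q = "quotient_module K U N"
  note Q = module_quotient[OF U N]
  have "N +>\<^bsub>U\<^esub> f x = \<zero>\<^bsub>?Q\<^esub>"
    by (rule PP_eqI[OF Q linear_map_comp[OF linear_map_coset[OF U N] f] linear_map_const_zero[OF Q] _ x])
      (simp add: zero_quotient coset_zero_iff[OF U N] linear_map_closed[OF f] mem)
  then show ?thesis using coset_zero_iff[OF U N] linear_map_closed[OF f x] by (simp add: zero_quotient)
qed

subsection \<open>The reference connection\<close>

lemma embH_form_of:
  assumes "y \<in> carrier HH"
  shows "embH B (Hc.form_of y) = q (flip B (tM \<one>\<^bsub>M\<^esub> \<one>\<^bsub>M\<^esub>) y)"
  unfolding embH_def
proof (rule Hc.induced_form_of(1)[OF O_mods(2) _ _ _ _ assms])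
  show "linear_map K HH OP (\<lambda>y. q (flip B (tM \<one>\<^bsub>M\<^esub> \<one>\<^bsub>M\<^esub>) y))" by (intro linear_intros; simp)
  show "piP B (flip B (tM \<one>\<^bsub>M\<^esub> \<one>\<^bsub>M\<^esub>) y) = q (flip B (tM \<one>\<^bsub>M\<^esub> \<one>\<^bsub>M\<^esub>) y)" if "y \<in> carrier (univ_forms K H)" for y
    using that bilinear_zero_right[OF H_mod mods(2) bilinear_mh]
    by (intro piP_q) (simp_all add: H0.univ_carrier mulP_flip)
qed (simp_all add: q_flip_NH)

definition ref_pre :: "'h \<Rightarrow> ('k, 'm, 'h) tot2"
  where "ref_pre h = sw PP (\<lambda>a b. mmhh B \<one>\<^bsub>M\<^esub> \<one>\<^bsub>M\<^esub> (S a) b) h"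

lemma bilinear_ref: "bilinear K H H PP (\<lambda>a b. mmhh B \<one>\<^bsub>M\<^esub> \<one>\<^bsub>M\<^esub> (S a) b)"
  by (intro linear_intros; simp)

lemma linear_ref_pre [linear_intros]: "linear_map K V H f \<Longrightarrow> linear_map K V PP (\<lambda>x. ref_pre (f x))"
  unfolding ref_pre_def by (intro linear_intros; simp)

lemma ref_pre_closed [simp]: "h \<in> carrier H \<Longrightarrow> ref_pre h \<in> carrier PP"
  unfolding ref_pre_def by (intro linear_intros; simp)

lemma linear_map_of_ref_pre:
  assumes "module K U" "linear_map K PP U f" "h \<in> carrier H"
  shows "f (ref_pre h) = sw U (\<lambda>a b. f (mmhh B \<one>\<^bsub>M\<^esub> \<one>\<^bsub>M\<^esub> (S a) b)) h"
  unfolding ref_pre_def by (rule linear_map_of_sweedler2[OF mods(3) assms(1,2) bilinear_ref assms(3)])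

lemma ref_pre_flip:
  assumes h: "h \<in> carrier H"
  shows "ref_pre h = flip B (tM \<one>\<^bsub>M\<^esub> \<one>\<^bsub>M\<^esub>) (sw HH (\<lambda>a b. tH (S a) b) h)"
proof -
  have "flip B (tM \<one>\<^bsub>M\<^esub> \<one>\<^bsub>M\<^esub>) (sw HH (\<lambda>a b. tH (S a) b) h)
    = sw PP (\<lambda>a b. flip B (tM \<one>\<^bsub>M\<^esub> \<one>\<^bsub>M\<^esub>) (tH (S a) b)) h"
    by (rule linear_map_of_sweedler2[OF module_HH mods(3) bilinear_right[OF bilinear_flip]])
      ((intro linear_intros)?; simp add: h)+
  then show ?thesis using h by (simp add: ref_pre_def cong: sweedler2_cong)
qed

lemma omega_ref_props:
  shows omega_ref_pi0: "h \<in> carrier H \<Longrightarrow> omega_ref B (pi0 B h) = q (ref_pre h)"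
    and linear_omega_ref: "linear_map K O0 OP (omega_ref B)"
proof -
  let ?y = "\<lambda>h. sw HH (\<lambda>a b. tH (S a) b) h"
  let ?g = "\<lambda>h. embH B (form_proj K H NH (?y h))"
  have y: "?y h \<in> carrier HH" if "h \<in> carrier H" for h using that by (intro linear_intros; simp)
  have f: "linear_map K H OP (\<lambda>h. q (ref_pre h))" by (intro linear_intros)
  have Q: "q (ref_pre x) = \<zero>\<^bsub>OP\<^esub>" if "x \<in> Q" for x
    using antipode_NH[OF H.one_closed that] that
    by (simp add: ref_pre_flip q_flip_NH cong: sweedler2_cong)
  have one: "q (ref_pre \<one>\<^bsub>H\<^esub>) = \<zero>\<^bsub>OP\<^esub>"
    by (simp add: ref_pre_def sweedler2_one[OF mods(3) bilinear_ref])
  have g: "?g x = q (ref_pre x)" if "x \<in> ker_counit K H" for x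
  proof -
    have x: "x \<in> carrier H" "counit H x = \<zero>\<^bsub>K\<^esub>" using that by (auto simp: ker_counit_def)
    \<comment> \<open>With zero counit, \<open>S x1 \<otimes> x2\<close> has product zero and is a
      one-form, so its class is given by the extended quotient map.\<close>
    have "mulH (?y x) = sw H (\<lambda>a b. mulH (tH (S a) b)) x"
      by (rule linear_map_of_sweedler2[OF module_HH H_mod H0.linear_mul]) ((intro linear_intros)?; simp add: x)+
    also have "\<dots> = sw H (\<lambda>a b. S a \<cdot> b) x"
      using x by (simp cong: sweedler2_cong)
    also have "\<dots> = \<zero>\<^bsub>H\<^esub>"
      using antipode_left[OF H_mod linear_map_id x(1)] x by simp
    finally have "form_proj K H NH (?y x) = Hc.form_of (?y x)"
      using y[OF x(1)] by (intro Hc.form_of_univ[symmetric]) (simp add: H0.univ_carrier)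
    then show ?thesis using x y by (simp add: embH_form_of ref_pre_flip)
  qed
  have eq: "omega_ref B = induced ?g" by (rule ext) (simp add: omega_ref_def Let_def)
  show "h \<in> carrier H \<Longrightarrow> omega_ref B (pi0 B h) = q (ref_pre h)" "linear_map K O0 OP (omega_ref B)"
    unfolding eq by (rule induced_pi0[OF O_mods(2) f Q one g]; simp)+
qed

lemma linear_map_omega_ref [linear_intros]:
  "linear_map K V O0 f \<Longrightarrow> linear_map K V OP (\<lambda>x. omega_ref B (f x))"
  by (rule linear_map_comp[OF linear_omega_ref])

lemma omega_ref_closed [simp]: "v \<in> carrier O0 \<Longrightarrow> omega_ref B v \<in> carrier OP"
  by (rule linear_map_closed[OF linear_omega_ref])

text \<open>The vertical map takes \<open>S h1 \<otimes> h2\<close> to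
  \<open>S h1 h2 \<otimes> h3\<close>, which contracts to \<open>1 \<otimes> h\<close>.\<close>

lemma verN_omega_ref:
  assumes "v \<in> carrier O0" shows "verN B (omega_ref B v) = tens K P O0 \<one>\<^bsub>P\<^esub> v"
proof -
  obtain h where h: "h \<in> carrier H" "v = pi0 B h" using assms by (elim O0_cases)
  have "verN B (omega_ref B v) = ver_pre (ref_pre h)" using h by (simp add: omega_ref_pi0 verN_q)
  also have "\<dots> = sw PO (\<lambda>a b. ver_pre (mmhh B \<one>\<^bsub>M\<^esub> \<one>\<^bsub>M\<^esub> (S a) b)) h"
    by (rule linear_map_of_ref_pre[OF tensor_mods(2) linear_ver_pre h(1)])
  also have "\<dots> = sw PO (\<lambda>a b. sw PO (\<lambda>c d. tens K P O0 (mh B \<one>\<^bsub>M\<^esub> (S a \<cdot> c)) (pi0 B d)) b) h"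
    using h by (simp add: ver_pre_mmhh cong: sweedler2_cong)
  also have "\<dots> = tens K P O0 (mh B \<one>\<^bsub>M\<^esub> \<one>\<^bsub>H\<^esub>) (pi0 B h)"
    by (rule antipode_left_cancel[OF tensor_mods(2) _ h(1)]) (intro linear_intros; simp)
  finally show ?thesis using h by (simp add: one_P)
qed

text \<open>An instance of \<open>antipode_form_coaction\<close>, with \<open>Y\<close> the class of
  \<open>1 \<otimes> 1 \<otimes> k \<otimes> c\<close>.\<close>

lemma coactForms_omega_ref:
  assumes "v \<in> carrier O0"
  shows "coactForms B (omega_ref B v) = tlift K OH (\<lambda>u h. tens K OP H (omega_ref B u) h) (ad v)"
proof -
  obtain h where h: "h \<in> carrier H" "v = pi0 B h" using assms by (elim O0_cases)
  let ?Y = "\<lambda>k c. q (mmhh B \<one>\<^bsub>M\<^esub> \<one>\<^bsub>M\<^esub> k c)"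
  have Y: "bilinear K H H OP ?Y" by (intro linear_intros; simp)
  have "coactForms B (omega_ref B v) = coact_pre (ref_pre h)" using h by (simp add: omega_ref_pi0 coactForms_q)
  also have "\<dots> = sw OH (\<lambda>a b. coact_pre (mmhh B \<one>\<^bsub>M\<^esub> \<one>\<^bsub>M\<^esub> (S a) b)) h"
    by (rule linear_map_of_ref_pre[OF tensor_mods(3) linear_coact_pre h(1)])
  also have "\<dots> = sw OH (\<lambda>a b. sw OH (\<lambda>k l. sw OH (\<lambda>c d. tens K OP H (?Y k c) (l \<cdot> d)) b) (S a)) h"
    using h by (simp add: coact_pre_mmhh cong: sweedler2_cong)
  also have "\<dots> = tlift K OH (\<lambda>s w. tens K OP H (sw OP (\<lambda>a c. ?Y (S a) c) s) w) (Ad K H h)"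
    by (rule antipode_form_coaction[OF O_mods(2) tensor_mods(3) Y bilinear_tens[OF O_mods(2) H_mod] h(1)])
  also have "\<dots> = tlift K OH (\<lambda>s w. tens K OP H (omega_ref B (pi0 B s)) w) (Ad K H h)"
  proof (rule tlift_cong[OF H_mod H_mod])
    fix s w assume s: "s \<in> carrier H"
    have "q (ref_pre s) = sw OP (\<lambda>a c. ?Y (S a) c) s"
      by (rule linear_map_of_ref_pre[OF O_mods(2) _ s]) (intro linear_intros)
    then show "tens K OP H (sw OP (\<lambda>a c. ?Y (S a) c) s) w = tens K OP H (omega_ref B (pi0 B s)) w"
      using s by (simp add: omega_ref_pi0)
  qed (simp add: h)
  also have "\<dots> = tlift K OH (\<lambda>u h. tens K OP H (omega_ref B u) h) (ad v)"
    unfolding h(2) by (rule tlift_inv_Ad[OF tensor_mods(3) _ h(1), symmetric]) (intro linear_intros; simp)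
  finally show ?thesis .
qed

text \<open>The component of the reference connection in \<open>M \<otimes> M\<close> is
  \<open>1 \<otimes> 1\<close>, whose class is that of \<open>d1 = 0\<close>.\<close>

lemma base_form_omega_ref:
  assumes "v \<in> carrier O0" shows "base_form (omega_ref B v) = \<zero>\<^bsub>OM\<^esub>"
proof -
  obtain h where h: "h \<in> carrier H" "v = pi0 B h" using assms by (elim O0_cases)
  have "base_form (omega_ref B v) = sw OM (\<lambda>a b. base_pre (mmhh B \<one>\<^bsub>M\<^esub> \<one>\<^bsub>M\<^esub> (S a) b)) h"
    using h linear_map_of_ref_pre[OF O_mods(1) linear_base_pre h(1)] by (simp add: omega_ref_pi0 base_form_q)
  also have "\<dots> = sw OM (\<lambda>a b. \<zero>\<^bsub>OM\<^esub>) h"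
    using h M.form_of_tens_one[folded OM_eq, of "\<one>\<^bsub>M\<^esub>"] by (simp add: base_pre_mmhh cong: sweedler2_cong)
  finally show ?thesis using h by (simp add: sweedler2_zero)
qed

subsection \<open>Gauge fields\<close>

lemma ract_lact_flip:
  assumes "x \<in> carrier MM" "k \<in> carrier H" "c \<in> carrier H"
  shows "ract K P (lact K P (mh B \<one>\<^bsub>M\<^esub> k) (flip B x (tH \<one>\<^bsub>H\<^esub> \<one>\<^bsub>H\<^esub>))) (mh B \<one>\<^bsub>M\<^esub> c) = flip B x (tH k c)"
proof -
  have bil: "bilinear K P P PP (\<lambda>b d. tens K P P b (d \<otimes>\<^bsub>P\<^esub> mh B \<one>\<^bsub>M\<^esub> c))"
    by (intro linear_intros; simp add: assms)
  have r: "ract K P z (mh B \<one>\<^bsub>M\<^esub> c) = tlift K PP (\<lambda>b d. tens K P P b (d \<otimes>\<^bsub>P\<^esub> mh B \<one>\<^bsub>M\<^esub> c)) z" for z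
    by (simp add: ract_def PP_of_def)
  have lin: "linear_map K PP PP (tlift K PP (\<lambda>b d. tens K P P b (d \<otimes>\<^bsub>P\<^esub> mh B \<one>\<^bsub>M\<^esub> c)))"
    using linear_map_tlift[OF mods(2,2,3) bil] by (simp add: PP_of_def)
  show ?thesis unfolding r
  proof (rule linear_map_eq_on_tensor_space[OF mods(1,1,3) _ _ _ assms(1)])
    show "linear_map K MM PP (\<lambda>x. tlift K PP (\<lambda>b d. tens K P P b (d \<otimes>\<^bsub>P\<^esub> mh B \<one>\<^bsub>M\<^esub> c))
        (lact K P (mh B \<one>\<^bsub>M\<^esub> k) (flip B x (tH \<one>\<^bsub>H\<^esub> \<one>\<^bsub>H\<^esub>))))"
      by (intro linear_map_comp[OF lin] linear_intros; simp add: assms)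
    show "linear_map K MM PP (\<lambda>x. flip B x (tH k c))" by (intro linear_intros; simp add: assms)
    fix m n assume mn: "m \<in> carrier M" "n \<in> carrier M"
    then have "lact K P (mh B \<one>\<^bsub>M\<^esub> k) (flip B (tM m n) (tH \<one>\<^bsub>H\<^esub> \<one>\<^bsub>H\<^esub>)) = tens K P P (mh B m k) (mh B n \<one>\<^bsub>H\<^esub>)"
      using assms by (simp, simp add: mmhh_def)
    then show "tlift K PP (\<lambda>b d. tens K P P b (d \<otimes>\<^bsub>P\<^esub> mh B \<one>\<^bsub>M\<^esub> c))
        (lact K P (mh B \<one>\<^bsub>M\<^esub> k) (flip B (tM m n) (tH \<one>\<^bsub>H\<^esub> \<one>\<^bsub>H\<^esub>))) = flip B (tM m n) (tH k c)"
      using assms mn by (simp add: tlift_tens[OF mods(2,2,3) bil], simp add: mmhh_def)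
  qed
qed

text \<open>The gauge term expressed through the coaction on \<Omega>0, hence directly on classes
  instead of representatives.\<close>

definition gauge_map :: "('k, 'm, 'h) gauge \<Rightarrow> ('k, 'm, 'h) conn"
  where "gauge_map A v = tlift K OP (\<lambda>w h. hor B (A w) h) (ad v)"

context
  fixes A :: "('k, 'm, 'h) gauge"
  assumes A: "linear_map K O0 OM A"
begin

lemma A_lin: "linear_map K V O0 f \<Longrightarrow> linear_map K V OM (\<lambda>x. A (f x))"
  by (rule linear_map_comp[OF A])

lemma A_closed: "v \<in> carrier O0 \<Longrightarrow> A v \<in> carrier OM"
  by (rule linear_map_closed[OF A])

lemma bilinear_hor_A: "bilinear K O0 H OP (\<lambda>w h. hor B (A w) h)"
  by (intro linear_intros A_lin; simp add: A_closed)

lemma bilinear_hor_A_pi0: "bilinear K H H OP (\<lambda>b u. hor B (A (pi0 B b)) u)"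
  by (intro linear_intros A_lin; simp add: A_closed)

lemma linear_gauge_map: "linear_map K O0 OP (gauge_map A)"
  unfolding gauge_map_def
  by (rule linear_map_tlift_arg[OF O0_mod H_mod O_mods(2) bilinear_hor_A linear_inv_Ad])

lemma linear_map_gauge_map:
  "linear_map K V O0 f \<Longrightarrow> linear_map K V OP (\<lambda>x. gauge_map A (f x))"
  by (rule linear_map_comp[OF linear_gauge_map])

lemma gauge_map_closed: "v \<in> carrier O0 \<Longrightarrow> gauge_map A v \<in> carrier OP"
  by (rule linear_map_closed[OF linear_gauge_map])

lemma gauge_map_Ad:
  "h \<in> carrier H \<Longrightarrow> gauge_map A (pi0 B h) = tlift K OP (\<lambda>b u. hor B (A (pi0 B b)) u) (Ad K H h)"
  unfolding gauge_map_def by (rule tlift_inv_Ad[OF O_mods(2) bilinear_hor_A])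

lemma gauge_map_pi0:
  "h \<in> carrier H \<Longrightarrow> gauge_map A (pi0 B h)
    = sw OP (\<lambda>a x. sw OP (\<lambda>b c. hor B (A (pi0 B b)) (S a \<cdot> c)) x) h"
  unfolding gauge_map_Ad by (rule tlift_Ad[OF O_mods(2) bilinear_hor_A_pi0])

text \<open>Multiplying the lift of \<open>A(\<pi> h2)\<close> by \<open>S h1\<close> and
  \<open>h3\<close> yields the component \<open>S h1 \<otimes> h3\<close> in
  \<open>H \<otimes> H\<close>. Next to a one-form on \<open>M\<close> this collapses to
  \<open>1 \<otimes> S h1 h3\<close>, so the legs are exactly those of \<open>Ad h\<close>.\<close>

lemma gauge_term_eq:
  assumes h: "h \<in> carrier H" shows "gauge_term B A h = gauge_map A (pi0 B h)"
proof -
  let ?g = "\<lambda>k c x. piP B (ract K P (lact K P (mh B \<one>\<^bsub>M\<^esub> k) (flip B x (tH \<one>\<^bsub>H\<^esub> \<one>\<^bsub>H\<^esub>))) (mh B \<one>\<^bsub>M\<^esub> c))"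
  have inner: "induced (?g k c) X = hor B X (k \<cdot> c)"
    if kc: "k \<in> carrier H" "c \<in> carrier H" and X: "X \<in> carrier OM" for k c X
  proof -
    obtain x where x: "x \<in> carrier MM" "X = qM x" using X by (elim OM_cases)
    have "induced (?g k c) (qM x) = q (flip B (resid x) (tH k c))"
    proof (rule M.induced_form_of(1)[OF O_mods(2) _ _ _ _ x(1)])
      show "linear_map K MM OP (\<lambda>x. q (flip B (resid x) (tH k c)))" by (intro linear_intros; simp add: kc)
      show "q (flip B (resid x) (tH k c)) = \<zero>\<^bsub>OP\<^esub>" if "x \<in> NM" for x
        using that kc by (simp add: resid_Om mulM_NM M.N_T q_flip_NM)
      show "?g k c x = q (flip B (resid x) (tH k c))" if "x \<in> carrier (univ_forms K M)" for x
        using that kc bilinear_zero_left[OF mods(1,2) bilinear_mh]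
        by (simp add: M.univ_carrier ract_lact_flip resid_Om piP_q mulP_flip)
    qed (simp add: kc)
    then show ?thesis
      using x kc q_flip_mul[of "resid x" "tH k c"] by (simp add: hor_qM)
  qed
  show ?thesis
    unfolding gauge_map_pi0[OF h] gauge_term_def sweedler3_def Let_def
    using h by (simp add: A_closed inner cong: sweedler2_cong)
qed

lemma linear_map_of_gauge_map:
  assumes "module K U" "linear_map K OP U f" "h \<in> carrier H"
  shows "f (gauge_map A (pi0 B h)) = tlift K U (\<lambda>b u. f (hor B (A (pi0 B b)) u)) (Ad K H h)"
  unfolding gauge_map_Ad[OF assms(3)]
  by (rule linear_map_of_tlift[OF H_mod H_mod O_mods(2) assms(1,2) bilinear_hor_A_pi0]) (simp add: assms)

lemma verN_gauge_map:
  assumes "v \<in> carrier O0" shows "verN B (gauge_map A v) = \<zero>\<^bsub>PO\<^esub>"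
proof -
  obtain h where h: "h \<in> carrier H" "v = pi0 B h" using assms by (elim O0_cases)
  have "verN B (gauge_map A v) = tlift K PO (\<lambda>b u. \<zero>\<^bsub>PO\<^esub>) (Ad K H h)"
    unfolding h(2) linear_map_of_gauge_map[OF tensor_mods(2) linear_verN h(1)]
    by (rule tlift_cong[OF H_mod H_mod]) (simp_all add: A_closed h verN_hor)
  then show ?thesis using h tlift_zero[OF H_mod H_mod tensor_mods(2)] by simp
qed

text \<open>The coaction on horizontal forms acts on the second leg of \<open>Ad\<close> by the
  coproduct; \<open>Ad_comodule\<close> rewrites this as a second application of \<open>Ad\<close>
  to the first leg, which is the gauge map again.\<close>

lemma coactForms_gauge_map:
  assumes "v \<in> carrier O0"
  shows "coactForms B (gauge_map A v) = tlift K OH (\<lambda>u h. tens K OP H (gauge_map A u) h) (ad v)"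
proof -
  obtain h where h: "h \<in> carrier H" "v = pi0 B h" using assms by (elim O0_cases)
  let ?G = "\<lambda>b u w. tens K OP H (hor B (A (pi0 B b)) u) w"
  have "coactForms B (gauge_map A v) = tlift K OH (\<lambda>b u. sw OH (?G b) u) (Ad K H h)"
    unfolding h(2) linear_map_of_gauge_map[OF tensor_mods(3) linear_coactForms h(1)]
    by (rule tlift_cong[OF H_mod H_mod]) (simp_all add: A_closed h coactForms_hor)
  also have "\<dots> = tlift K OH (\<lambda>s w. tlift K OH (\<lambda>b u. ?G b u w) (Ad K H s)) (Ad K H h)"
    by (rule Ad_comodule[OF tensor_mods(3) h(1)]) (intro linear_intros A_lin; simp add: A_closed)+
  also have "\<dots> = tlift K OH (\<lambda>s w. tens K OP H (gauge_map A (pi0 B s)) w) (Ad K H h)"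
  proof (rule tlift_cong[OF H_mod H_mod])
    fix s w assume sw: "s \<in> carrier H" "w \<in> carrier H"
    show "tlift K OH (\<lambda>b u. ?G b u w) (Ad K H s) = tens K OP H (gauge_map A (pi0 B s)) w"
      by (rule linear_map_of_gauge_map[OF tensor_mods(3) _ sw(1), symmetric, of "\<lambda>X. tens K OP H X w"])
        (intro linear_intros A_lin; simp add: A_closed sw)
  qed (simp add: A_closed h)
  also have "\<dots> = tlift K OH (\<lambda>u h. tens K OP H (gauge_map A u) h) (ad v)"
    unfolding h(2) by (rule tlift_inv_Ad[OF tensor_mods(3) _ h(1), symmetric]) (intro linear_intros linear_map_gauge_map; simp add: gauge_map_closed)
  finally show ?thesis .
qed

text \<open>The counit of \<open>S h1 h3\<close> is \<open>\<epsilon>(h1) \<epsilon>(h3)\<close>,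
  and the counit axioms on both sides reduce the middle leg to \<open>h\<close>.\<close>

lemma base_form_gauge_map:
  assumes "v \<in> carrier O0" shows "base_form (gauge_map A v) = A v"
proof -
  obtain h where h: "h \<in> carrier H" "v = pi0 B h" using assms by (elim O0_cases)
  have "base_form (gauge_map A v) = tlift K OM (\<lambda>b u. counit H u \<odot>\<^bsub>OM\<^esub> A (pi0 B b)) (Ad K H h)"
    unfolding h(2) linear_map_of_gauge_map[OF O_mods(1) linear_base_form h(1)]
    by (rule tlift_cong[OF H_mod H_mod]) (simp_all add: A_closed h base_form_hor)
  also have "\<dots> = sw OM (\<lambda>a x. sw OM (\<lambda>b c. counit H (S a \<cdot> c) \<odot>\<^bsub>OM\<^esub> A (pi0 B b)) x) h"
    by (rule tlift_Ad[OF O_mods(1) _ h(1)]) (intro linear_intros A_lin; simp add: A_closed)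
  also have "\<dots> = sw OM (\<lambda>a x. counit H a \<odot>\<^bsub>OM\<^esub> A (pi0 B x)) h"
  proof (rule sweedler2_cong[OF refl h(1)])
    fix a x assume ax: "a \<in> carrier H" "x \<in> carrier H"
    have "sw OM (\<lambda>b c. counit H (S a \<cdot> c) \<odot>\<^bsub>OM\<^esub> A (pi0 B b)) x
      = sw OM (\<lambda>b c. counit H c \<odot>\<^bsub>OM\<^esub> (counit H a \<odot>\<^bsub>OM\<^esub> A (pi0 B b))) x"
      using ax by (simp add: A_closed OM.smult_assoc1[symmetric] HM.R.m_comm cong: sweedler2_cong)
    also have "\<dots> = counit H a \<odot>\<^bsub>OM\<^esub> A (pi0 B x)"
      by (rule counit_right[OF O_mods(1) _ ax(2)]) (intro linear_intros A_lin; simp add: A_closed ax)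
    finally show "sw OM (\<lambda>b c. counit H (S a \<cdot> c) \<odot>\<^bsub>OM\<^esub> A (pi0 B b)) x
      = counit H a \<odot>\<^bsub>OM\<^esub> A (pi0 B x)" .
  qed
  also have "\<dots> = A (pi0 B h)"
    by (rule counit_left[OF O_mods(1) _ h(1)]) (intro linear_intros A_lin; simp add: A_closed)
  finally show ?thesis using h by simp
qed

end

subsection \<open>The projection of a connection\<close>

lemma bilinear_Pi:
  assumes "linear_map K O0 OP \<omega>"
  shows "bilinear K P O0 OP (\<lambda>p v. form_lact K P NP p (\<omega> v))"
  by (intro linear_intros linear_map_comp[OF assms]; simp add: linear_map_closed[OF assms])

lemma linear_Pi_proj:
  assumes "linear_map K O0 OP \<omega>" shows "linear_map K OP OP (Pi_proj B \<omega>)"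
  unfolding Pi_proj_def
  by (rule linear_map_tlift_arg[OF mods(2) O0_mod O_mods(2) bilinear_Pi[OF assms] linear_verN])

lemma Pi_proj_mmhh:
  assumes \<omega>: "linear_map K O0 OP \<omega>"
    and mn: "m \<in> carrier M" "n \<in> carrier M" and hg: "h \<in> carrier H" "g \<in> carrier H"
  shows "Pi_proj B \<omega> (q (mmhh B m n h g))
    = sw OP (\<lambda>a b. form_lact K P NP (mh B (m \<otimes>\<^bsub>M\<^esub> n) (h \<cdot> a)) (\<omega> (pi0 B b))) g"
proof -
  have "Pi_proj B \<omega> (q (mmhh B m n h g)) = sw OP (\<lambda>a b. tlift K OP (\<lambda>p v. form_lact K P NP p (\<omega> v))
      (tens K P O0 (mh B (m \<otimes>\<^bsub>M\<^esub> n) (h \<cdot> a)) (pi0 B b))) g"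
    using mn hg unfolding Pi_proj_def
    by (simp add: verN_q ver_pre_mmhh, intro tlift_sweedler2[OF mods(2) O0_mod O_mods(2) bilinear_Pi[OF \<omega>]] linear_intros;
        simp)
  then show ?thesis
    using mn hg by (simp add: tlift_tens[OF mods(2) O0_mod O_mods(2) bilinear_Pi[OF \<omega>]] cong: sweedler2_cong)
qed

lemma Pi_proj_cong:
  assumes "\<And>v. v \<in> carrier O0 \<Longrightarrow> \<omega> v = \<omega>' v" "X \<in> carrier OP"
  shows "Pi_proj B \<omega> X = Pi_proj B \<omega>' X"
  unfolding Pi_proj_def by (rule tlift_cong[OF mods(2) O0_mod]) (simp_all add: assms)

text \<open>The component in \<open>H \<otimes> H\<close> is \<open>h g1 S(g2) \<otimes> g3\<close>,
  which contracts to \<open>h \<otimes> g\<close>; the two base components are merged by the product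
  in \<open>ver\<close>.\<close>

lemma Pi_proj_omega_ref:
  assumes mn: "m \<in> carrier M" "n \<in> carrier M" and hg: "h \<in> carrier H" "g \<in> carrier H"
  shows "Pi_proj B (omega_ref B) (q (mmhh B m n h g)) = q (mmhh B (m \<otimes>\<^bsub>M\<^esub> n) \<one>\<^bsub>M\<^esub> h g)"
proof -
  let ?k = "m \<otimes>\<^bsub>M\<^esub> n"
  have k: "?k \<in> carrier M" using mn by simp
  have "Pi_proj B (omega_ref B) (q (mmhh B m n h g))
      = sw OP (\<lambda>a b. q (lact K P (mh B ?k (h \<cdot> a)) (ref_pre b))) g"
    unfolding Pi_proj_mmhh[OF linear_omega_ref mn hg]
    using mn hg by (simp add: omega_ref_pi0 cong: sweedler2_cong)
  also have "\<dots> = sw OP (\<lambda>a b. sw OP (\<lambda>c d. q (mmhh B ?k \<one>\<^bsub>M\<^esub> (h \<cdot> (a \<cdot> S c)) d)) b) g"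
  proof (rule sweedler2_cong[OF refl hg(2)])
    fix a b assume ab: "a \<in> carrier H" "b \<in> carrier H"
    have "q (lact K P (mh B ?k (h \<cdot> a)) (ref_pre b))
      = sw OP (\<lambda>c d. q (lact K P (mh B ?k (h \<cdot> a)) (mmhh B \<one>\<^bsub>M\<^esub> \<one>\<^bsub>M\<^esub> (S c) d))) b"
      by (rule linear_map_of_ref_pre[OF O_mods(2) _ ab(2)]) (intro linear_intros; simp add: k hg ab)
    then show "q (lact K P (mh B ?k (h \<cdot> a)) (ref_pre b))
      = sw OP (\<lambda>c d. q (mmhh B ?k \<one>\<^bsub>M\<^esub> (h \<cdot> (a \<cdot> S c)) d)) b"
      using k hg ab by (simp add: H.m_assoc cong: sweedler2_cong)
  qed
  also have "\<dots> = q (mmhh B ?k \<one>\<^bsub>M\<^esub> (h \<cdot> \<one>\<^bsub>H\<^esub>) g)"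
    by (rule antipode_right_cancel[OF O_mods(2) _ hg(2)]) (intro linear_intros; simp add: k hg)
  finally show ?thesis using hg by simp
qed

section \<open>Horizontal component of a form\<close>

lemma bilinear_hor_base: "bilinear K OP H OP (\<lambda>Y u. hor B (base_form Y) u)"
  by (intro linear_intros; simp)

text \<open>In a cofree comodule \<open>V \<otimes> H\<close> an element is recovered by applying
  its coaction and then the counit to the inner copy of \<open>H\<close>. Here
  \<open>base_form\<close> plays the role of that counit, which defines the projection on all
  forms.\<close>

definition hor_part :: "('k, 'm, 'h) tot2 set \<Rightarrow> ('k, 'm, 'h) tot2 set"
  where "hor_part X = tlift K OP (\<lambda>Y u. hor B (base_form Y) u) (coactForms B X)"

lemma linear_hor_part: "linear_map K OP OP hor_part"
  unfolding hor_part_def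
  by (rule linear_map_tlift_arg[OF O_mods(2) H_mod O_mods(2) bilinear_hor_base linear_coactForms])

lemma hor_part_mmhh:
  assumes mn: "m \<in> carrier M" "n \<in> carrier M" and hg: "h \<in> carrier H" "g \<in> carrier H"
  shows "hor_part (q (mmhh B m n h g)) = hor B (qM (tM m n)) (h \<cdot> g)"
proof -
  let ?X = "qM (tM m n)" and ?t = "tlift K OP (\<lambda>Y u. hor B (base_form Y) u)"
  have X: "?X \<in> carrier OM" using mn by simp
  note tl = linear_map_tlift[OF O_mods(2) H_mod O_mods(2) bilinear_hor_base]
    and tt = tlift_tens[OF O_mods(2) H_mod O_mods(2) bilinear_hor_base]
  have "hor_part (q (mmhh B m n h g))
     = ?t (sw OH (\<lambda>a b. sw OH (\<lambda>c d. tens K OP H (q (mmhh B m n a c)) (b \<cdot> d)) g) h)"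
    using mn hg by (simp add: hor_part_def coactForms_q coact_pre_mmhh)
  also have "\<dots> = sw OP (\<lambda>a b. ?t (sw OH (\<lambda>c d. tens K OP H (q (mmhh B m n a c)) (b \<cdot> d)) g)) h"
    by (rule linear_map_of_sweedler2[OF tensor_mods(3) O_mods(2) tl _ hg(1)]) (intro linear_intros; simp add: mn hg)
  also have "\<dots> = sw OP (\<lambda>a b. sw OP (\<lambda>c d. counit H (a \<cdot> c) \<odot>\<^bsub>OP\<^esub> hor B ?X (b \<cdot> d)) g) h"
  proof (rule sweedler2_cong[OF refl hg(1)])
    fix a b assume ab: "a \<in> carrier H" "b \<in> carrier H"
    have "?t (sw OH (\<lambda>c d. tens K OP H (q (mmhh B m n a c)) (b \<cdot> d)) g)
       = sw OP (\<lambda>c d. ?t (tens K OP H (q (mmhh B m n a c)) (b \<cdot> d))) g"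
      by (rule linear_map_of_sweedler2[OF tensor_mods(3) O_mods(2) tl _ hg(2)]) (intro linear_intros; simp add: mn ab)
    then show "?t (sw OH (\<lambda>c d. tens K OP H (q (mmhh B m n a c)) (b \<cdot> d)) g)
      = sw OP (\<lambda>c d. counit H (a \<cdot> c) \<odot>\<^bsub>OP\<^esub> hor B ?X (b \<cdot> d)) g"
      using mn hg ab X
      by (simp add: tt base_form_q base_pre_mmhh linear_map_smult[OF linear_hor_left] cong: sweedler2_cong)
  qed
  \<comment> \<open>The two sums combine into the coproduct of \<open>h \<cdot> g\<close>, whose
    first leg is then absorbed by the counit.\<close>
  also have "\<dots> = sw OP (\<lambda>u v. counit H u \<odot>\<^bsub>OP\<^esub> hor B ?X v) (h \<cdot> g)"
    by (rule sweedler2_mult[OF O_mods(2) _ hg, symmetric]) (intro linear_intros; simp add: X)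
  also have "\<dots> = hor B ?X (h \<cdot> g)"
    by (rule counit_left[OF O_mods(2)]) ((intro linear_intros)?; simp add: X hg)+
  finally show ?thesis .
qed

section \<open>Decomposition of forms and of connections\<close>

lemma form_decomposition:
  assumes "X \<in> carrier OP"
  shows "X = Pi_proj B (omega_ref B) X \<oplus>\<^bsub>OP\<^esub> hor_part X"
proof -
  obtain z where z: "z \<in> carrier PP" "X = q z" using assms by (elim OP_cases)
  have "q z = Pi_proj B (omega_ref B) (q z) \<oplus>\<^bsub>OP\<^esub> hor_part (q z)"
  proof (rule PP_eqI[OF O_mods(2) _ _ _ z(1)])
    show "linear_map K PP OP (\<lambda>z. Pi_proj B (omega_ref B) (q z) \<oplus>\<^bsub>OP\<^esub> hor_part (q z))"
      by (intro linear_intros linear_map_comp[OF linear_Pi_proj[OF linear_omega_ref]] linear_map_comp[OF linear_hor_part])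
    fix m n h g assume A: "m \<in> carrier M" "n \<in> carrier M" "h \<in> carrier H" "g \<in> carrier H"
    show "q (mmhh B m n h g) = Pi_proj B (omega_ref B) (q (mmhh B m n h g)) \<oplus>\<^bsub>OP\<^esub> hor_part (q (mmhh B m n h g))"
      unfolding Pi_proj_omega_ref[OF A] hor_part_mmhh[OF A] by (rule q_mmhh_split[OF A])
  qed (intro linear_map_q linear_map_id)
  then show ?thesis using z by simp
qed

lemma form_lact_one:
  assumes "X \<in> carrier OP" shows "form_lact K P NP \<one>\<^bsub>P\<^esub> X = X"
proof -
  obtain z where z: "z \<in> carrier PP" "X = q z" using assms by (elim OP_cases)
  have "lact K P \<one>\<^bsub>P\<^esub> z = z"
    by (rule PP_eqI[OF mods(3) _ _ _ z(1)]) ((intro linear_intros)?; simp add: one_P)+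
  then show ?thesis using z by simp
qed

lemma connection_linear: "connection B \<omega> \<Longrightarrow> linear_map K O0 OP \<omega>"
  by (simp add: connection_def Let_def)

text \<open>The form decomposition is applied to \<open>\<omega> v\<close>. Its first summand sees
  only \<open>verN B (\<omega> v)\<close>, which the vertical condition prescribes; its second sees
  only the coaction, which equivariance moves onto \<open>v\<close>.\<close>

lemma connection_decomposition:
  assumes \<omega>: "connection B \<omega>" and v: "v \<in> carrier O0"
  shows "\<omega> v = omega_ref B v \<oplus>\<^bsub>OP\<^esub> gauge_map (\<lambda>u. base_form (\<omega> u)) v"
proof -
  note lin = connection_linear[OF \<omega>]
  have cl: "\<omega> v \<in> carrier OP" using linear_map_closed[OF lin v] .
  have "Pi_proj B (omega_ref B) (\<omega> v) = form_lact K P NP \<one>\<^bsub>P\<^esub> (omega_ref B v)"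
    using \<omega> v
    by (simp add: Pi_proj_def connection_def Let_def
        tlift_tens[OF mods(2) O0_mod O_mods(2) bilinear_Pi[OF linear_omega_ref]] one_P)
  moreover have "hor_part (\<omega> v) = gauge_map (\<lambda>u. base_form (\<omega> u)) v"
  proof -
    have bil: "bilinear K O0 H OH (\<lambda>u h. tens K OP H (\<omega> u) h)"
      by (intro linear_intros linear_map_comp[OF lin]; simp add: linear_map_closed[OF lin])
    have "hor_part (\<omega> v) = tlift K OP (\<lambda>Y u. hor B (base_form Y) u)
        (tlift K OH (\<lambda>u h. tens K OP H (\<omega> u) h) (ad v))"
      using \<omega> v by (simp add: hor_part_def connection_def Let_def)
    also have "\<dots> = tlift K OP (\<lambda>u h. tlift K OP (\<lambda>Y u. hor B (base_form Y) u) (tens K OP H (\<omega> u) h)) (ad v)"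
      by (rule linear_map_of_tlift[OF O0_mod H_mod tensor_mods(3) O_mods(2)
            linear_map_tlift[OF O_mods(2) H_mod O_mods(2) bilinear_hor_base] bil]) (simp add: v)
    also have "\<dots> = gauge_map (\<lambda>u. base_form (\<omega> u)) v"
      unfolding gauge_map_def
      by (rule tlift_cong[OF O0_mod H_mod])
        (simp_all add: v tlift_tens[OF O_mods(2) H_mod O_mods(2) bilinear_hor_base] linear_map_closed[OF lin])
    finally show ?thesis .
  qed
  ultimately show ?thesis using form_decomposition[OF cl] v by (simp add: form_lact_one)
qed

section \<open>Connections built from gauge fields\<close>

definition gauge_connection :: "('k, 'm, 'h) gauge \<Rightarrow> ('k, 'm, 'h) conn"
  where "gauge_connection A = restrict (\<lambda>v. omega_ref B v \<oplus>\<^bsub>OP\<^esub> gauge_map A v) (carrier O0)"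

lemma connection_cong:
  assumes \<omega>: "connection B \<omega>" and eq: "\<And>v. v \<in> carrier O0 \<Longrightarrow> \<omega> v = \<omega>' v"
  shows "connection B \<omega>'"
  unfolding connection_def Let_def
proof (intro conjI ballI)
  show "linear_map K O0 OP \<omega>'"
    by (rule linear_map_cong[OF connection_linear[OF \<omega>] eq O0_mod])
  fix v assume v: "v \<in> carrier O0"
  have "tlift K OH (\<lambda>u h. tens K OP H (\<omega>' u) h) (ad v) = tlift K OH (\<lambda>u h. tens K OP H (\<omega> u) h) (ad v)"
    by (rule tlift_cong[OF O0_mod H_mod]) (simp_all only: eq v ad_closed)
  also have "\<dots> = coactForms B (\<omega> v)"
    using \<omega> v unfolding connection_def Let_def by blast
  finally show "tlift K OH (\<lambda>u h. tens K OP H (\<omega>' u) h) (ad v) = coactForms B (\<omega>' v)"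
    unfolding eq[OF v] .
  have "verN B (\<omega> v) = tens K P O0 \<one>\<^bsub>P\<^esub> v"
    using \<omega> v unfolding connection_def Let_def by blast
  then show "verN B (\<omega>' v) = tens K P O0 \<one>\<^bsub>P\<^esub> v" unfolding eq[OF v] .
qed

lemma gauge_fields_linear: "A \<in> gauge_fields B \<Longrightarrow> linear_map K O0 OM A"
  by (simp add: gauge_fields_def)

context
  fixes A assumes A: "linear_map K O0 OM A"
begin

lemma linear_gauge_sum: "linear_map K O0 OP (\<lambda>v. omega_ref B v \<oplus>\<^bsub>OP\<^esub> gauge_map A v)"
  by (intro linear_intros linear_gauge_map[OF A] linear_omega_ref)

text \<open>Both conditions are compatible with adding the gauge map: the reference connection
  satisfies them, while the gauge map is equivariant and killed by \<open>verN\<close>.\<close>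

lemma connection_gauge_sum: "connection B (\<lambda>v. omega_ref B v \<oplus>\<^bsub>OP\<^esub> gauge_map A v)"
  unfolding connection_def Let_def
proof (intro conjI ballI)
  interpret PO: module K PO by simp
  show "linear_map K O0 OP (\<lambda>v. omega_ref B v \<oplus>\<^bsub>OP\<^esub> gauge_map A v)" by (rule linear_gauge_sum)
  fix v assume v: "v \<in> carrier O0"
  note [simp] = gauge_map_closed[OF A]
  show "verN B (omega_ref B v \<oplus>\<^bsub>OP\<^esub> gauge_map A v) = tens K P O0 \<one>\<^bsub>P\<^esub> v"
    using v by (simp add: linear_map_add[OF linear_verN] verN_omega_ref verN_gauge_map[OF A] tens_closed)
  have b1: "bilinear K O0 H OH (\<lambda>u h. tens K OP H (omega_ref B u) h)"
    by (intro linear_intros; simp)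
  have b2: "bilinear K O0 H OH (\<lambda>u h. tens K OP H (gauge_map A u) h)"
    by (intro linear_intros linear_gauge_map[OF A]; simp)
  have b3: "bilinear K O0 H OH (\<lambda>u h. tens K OP H (omega_ref B u \<oplus>\<^bsub>OP\<^esub> gauge_map A u) h)"
    by (intro linear_intros linear_gauge_map[OF A]; simp)
  note tl = linear_map_tlift[OF O0_mod H_mod tensor_mods(3)]
    and tt = tlift_tens[OF O0_mod H_mod tensor_mods(3)]
  have "tlift K OH (\<lambda>u h. tens K OP H (omega_ref B u \<oplus>\<^bsub>OP\<^esub> gauge_map A u) h) (ad v)
      = tlift K OH (\<lambda>u h. tens K OP H (omega_ref B u) h) (ad v)
        \<oplus>\<^bsub>OH\<^esub> tlift K OH (\<lambda>u h. tens K OP H (gauge_map A u) h) (ad v)"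
    by (rule linear_map_eq_on_tensor_space[OF O0_mod H_mod tensor_mods(3) tl[OF b3]
          linear_map_plus[OF tensor_mods(3) tl[OF b1] tl[OF b2]]])
      (simp_all add: v tt[OF b1] tt[OF b2] tt[OF b3]
        linear_map_add[OF bilinear_left[OF bilinear_tens[OF O_mods(2) H_mod]]])
  also have "\<dots> = coactForms B (omega_ref B v \<oplus>\<^bsub>OP\<^esub> gauge_map A v)"
    using v by (simp add: linear_map_add[OF linear_coactForms] coactForms_omega_ref coactForms_gauge_map[OF A])
  finally show "tlift K OH (\<lambda>u h. tens K OP H (omega_ref B u \<oplus>\<^bsub>OP\<^esub> gauge_map A u) h) (ad v)
      = coactForms B (omega_ref B v \<oplus>\<^bsub>OP\<^esub> gauge_map A v)" .
qed

lemma base_form_gauge_sum: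
  assumes "v \<in> carrier O0" shows "base_form (omega_ref B v \<oplus>\<^bsub>OP\<^esub> gauge_map A v) = A v"
  using assms linear_map_closed[OF A assms]
  by (simp add: linear_map_add[OF linear_base_form] gauge_map_closed[OF A] base_form_omega_ref base_form_gauge_map[OF A])

text \<open>The legs are \<open>g1 S(g2)\<close>, \<open>A(\<pi> g3)\<close>, \<open>g4\<close>. The
  first two contract, which is why no antipode survives in the formula for the projection.\<close>

lemma form_lact_gauge_map:
  assumes m: "m \<in> carrier M" and hg: "h \<in> carrier H" "g \<in> carrier H"
  shows "sw OP (\<lambda>a b. form_lact K P NP (mh B m (h \<cdot> a)) (gauge_map A (pi0 B b))) g
    = sw OP (\<lambda>a b. hor B (form_lact K M NM m (A (pi0 B a))) (h \<cdot> b)) g"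
proof -
  let ?L = "\<lambda>b u. hor B (form_lact K M NM m (A (pi0 B b))) (h \<cdot> u)"
  note A' = A_lin[OF A] A_closed[OF A]
  have "sw OP (\<lambda>a b. form_lact K P NP (mh B m (h \<cdot> a)) (gauge_map A (pi0 B b))) g
    = sw OP (\<lambda>a b. sw OP (\<lambda>k x. sw OP (\<lambda>c d. ?L c (a \<cdot> S k \<cdot> d)) x) b) g"
  proof (rule sweedler2_cong[OF refl hg(2)])
    fix a b assume ab: "a \<in> carrier H" "b \<in> carrier H"
    have "form_lact K P NP (mh B m (h \<cdot> a)) (gauge_map A (pi0 B b))
      = tlift K OP (\<lambda>c u. form_lact K P NP (mh B m (h \<cdot> a)) (hor B (A (pi0 B c)) u)) (Ad K H b)"
      by (rule linear_map_of_gauge_map[OF A O_mods(2) _ ab(2)]) (intro linear_intros; simp add: m hg ab)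
    also have "\<dots> = tlift K OP (\<lambda>c u. ?L c (a \<cdot> u)) (Ad K H b)"
      by (rule tlift_cong[OF H_mod H_mod]) (simp_all add: m hg ab A' form_lact_hor H.m_assoc)
    also have "\<dots> = sw OP (\<lambda>k x. sw OP (\<lambda>c d. ?L c (a \<cdot> (S k \<cdot> d))) x) b"
      by (rule tlift_Ad[OF O_mods(2) _ ab(2)]) (intro linear_intros A'; simp add: m hg ab A')
    finally show "form_lact K P NP (mh B m (h \<cdot> a)) (gauge_map A (pi0 B b))
      = sw OP (\<lambda>k x. sw OP (\<lambda>c d. ?L c (a \<cdot> S k \<cdot> d)) x) b"
      using ab by (simp add: H.m_assoc cong: sweedler2_cong)
  qed
  also have "\<dots> = sw OP (\<lambda>c d. ?L c (\<one>\<^bsub>H\<^esub> \<cdot> d)) g"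
    by (rule antipode_right_cancel[OF O_mods(2) _ hg(2)]) (intro linear_intros A'; simp add: m hg A')
  finally show ?thesis using hg by (simp cong: sweedler2_cong)
qed

text \<open>The form and its projection share the vertical part
  \<open>mn \<otimes> 1 \<otimes> h \<otimes> g\<close>, which cancels. The gauge contribution to
  the projection remains with a minus sign, next to the horizontal part of the form.\<close>

lemma Pi_proj_gauge:
  assumes mn: "m \<in> carrier M" "n \<in> carrier M" and hg: "h \<in> carrier H" "g \<in> carrier H"
  shows "q (mmhh B m n h g) \<ominus>\<^bsub>OP\<^esub> Pi_proj B (\<lambda>v. omega_ref B v \<oplus>\<^bsub>OP\<^esub> gauge_map A v) (q (mmhh B m n h g))
    = (\<ominus>\<^bsub>OP\<^esub> sw OP (\<lambda>a b. hor B (form_lact K M NM (m \<otimes>\<^bsub>M\<^esub> n) (A (pi0 B a))) (h \<cdot> b)) g)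
      \<oplus>\<^bsub>OP\<^esub> hor B (form_lact K M NM m (form_d K M NM n)) (h \<cdot> g)"
proof -
  let ?k = "m \<otimes>\<^bsub>M\<^esub> n" and ?l = "\<lambda>a X. form_lact K P NP (mh B (m \<otimes>\<^bsub>M\<^esub> n) (h \<cdot> a)) X"
  let ?G = "sw OP (\<lambda>a b. hor B (form_lact K M NM ?k (A (pi0 B a))) (h \<cdot> b)) g"
  let ?V = "q (mmhh B ?k \<one>\<^bsub>M\<^esub> h g)" and ?D = "hor B (form_lact K M NM m (form_d K M NM n)) (h \<cdot> g)"
  have k: "?k \<in> carrier M" using mn by simp
  have b1: "bilinear K H H OP (\<lambda>a b. ?l a (omega_ref B (pi0 B b)))"
    by (intro linear_intros; simp add: k hg)
  have b2: "bilinear K H H OP (\<lambda>a b. ?l a (gauge_map A (pi0 B b)))"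
    by (intro linear_intros linear_map_gauge_map[OF A]; simp add: k hg gauge_map_closed[OF A])
  have b3: "bilinear K H H OP (\<lambda>a b. ?l a (omega_ref B (pi0 B b) \<oplus>\<^bsub>OP\<^esub> gauge_map A (pi0 B b)))"
    by (intro linear_intros linear_map_gauge_map[OF A]; simp add: k hg gauge_map_closed[OF A])
  have G: "?G \<in> carrier OP"
    by (intro linear_intros A_lin[OF A]; simp add: k hg A_closed[OF A])
  have V: "?V \<in> carrier OP" and D: "?D \<in> carrier OP"
    using mn hg by (simp_all add: form_lact_form_d)
  note tl = linear_map_tlift[OF H_mod H_mod O_mods(2)] and tt = tlift_tens[OF H_mod H_mod O_mods(2)]
  have "Pi_proj B (\<lambda>v. omega_ref B v \<oplus>\<^bsub>OP\<^esub> gauge_map A v) (q (mmhh B m n h g))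
     = sw OP (\<lambda>a b. ?l a (omega_ref B (pi0 B b) \<oplus>\<^bsub>OP\<^esub> gauge_map A (pi0 B b))) g"
    by (rule Pi_proj_mmhh[OF linear_gauge_sum mn hg])
  also have "\<dots> = sw OP (\<lambda>a b. ?l a (omega_ref B (pi0 B b))) g \<oplus>\<^bsub>OP\<^esub> sw OP (\<lambda>a b. ?l a (gauge_map A (pi0 B b))) g"
    unfolding sweedler2_def
    by (rule linear_map_eq_on_tensor_space[OF H_mod H_mod O_mods(2) tl[OF b3]
          linear_map_plus[OF O_mods(2) tl[OF b1] tl[OF b2]] _ comult_closed[OF hg(2)]])
      (simp add: tt[OF b1] tt[OF b2] tt[OF b3] k hg gauge_map_closed[OF A]
        linear_map_add[OF bilinear_right[OF Pc.bilinear_form_lact[folded OP_eq]]])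
  also have "\<dots> = ?V \<oplus>\<^bsub>OP\<^esub> ?G"
    using Pi_proj_mmhh[OF linear_omega_ref mn hg] Pi_proj_omega_ref[OF mn hg] form_lact_gauge_map[OF k hg] by simp
  finally have "Pi_proj B (\<lambda>v. omega_ref B v \<oplus>\<^bsub>OP\<^esub> gauge_map A v) (q (mmhh B m n h g)) = ?V \<oplus>\<^bsub>OP\<^esub> ?G" .
  moreover have "q (mmhh B m n h g) = ?V \<oplus>\<^bsub>OP\<^esub> ?D"
    using q_mmhh_split[OF mn hg] mn by (simp add: form_lact_form_d)
  ultimately show ?thesis using OP.M.add_minus_add_cancel[OF V D G] by simp
qed

end

subsection \<open>Horizontal forms\<close>

lemma hor_forms_submodule: "submodule (hor_forms B) K OP"
  unfolding hor_forms_def by (rule lin_span_submodule) auto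

lemma hor_in_hor_forms: "X \<in> carrier OM \<Longrightarrow> h \<in> carrier H \<Longrightarrow> hor B X h \<in> hor_forms B"
  unfolding hor_forms_def by (rule lin_span_inc) blast

lemma gauge_formula_hor:
  assumes A: "linear_map K O0 OM A"
    and mn: "m \<in> carrier M" "n \<in> carrier M" and hg: "h \<in> carrier H" "g \<in> carrier H"
  shows "(\<ominus>\<^bsub>OP\<^esub> sw OP (\<lambda>a b. hor B (form_lact K M NM (m \<otimes>\<^bsub>M\<^esub> n) (A (pi0 B a))) (h \<cdot> b)) g)
      \<oplus>\<^bsub>OP\<^esub> hor B (form_lact K M NM m (form_d K M NM n)) (h \<cdot> g) \<in> hor_forms B"
proof -
  have "sw OP (\<lambda>a b. hor B (form_lact K M NM (m \<otimes>\<^bsub>M\<^esub> n) (A (pi0 B a))) (h \<cdot> b)) g \<in> hor_forms B"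
    by (rule sweedler2_in_submodule[OF O_mods(2) hor_forms_submodule])
      ((intro linear_intros A_lin[OF A] hor_in_hor_forms)?; simp add: mn hg A_closed[OF A])+
  moreover have "hor B (form_lact K M NM m (form_d K M NM n)) (h \<cdot> g) \<in> hor_forms B"
    using mn hg by (intro hor_in_hor_forms) (simp_all add: form_lact_form_d)
  ultimately show ?thesis
    using OP.submoduleE(3,5)[OF hor_forms_submodule] by simp
qed

text \<open>Stated for the extended quotient map on all of \<open>PP\<close>, so that it can be
  tested on pure tensors although these need not be forms.\<close>

lemma vertical_complement_hor:
  assumes A: "linear_map K O0 OM A" and z: "z \<in> carrier PP"
  shows "q z \<ominus>\<^bsub>OP\<^esub> Pi_proj B (\<lambda>v. omega_ref B v \<oplus>\<^bsub>OP\<^esub> gauge_map A v) (q z) \<in> hor_forms B"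
  by (rule PP_in_submodule[OF O_mods(2) hor_forms_submodule _ z])
    ((intro linear_intros linear_map_comp[OF linear_Pi_proj[OF linear_gauge_sum[OF A]]])?;
      simp add: Pi_proj_gauge[OF A] gauge_formula_hor[OF A])+

lemma connection_strong:
  assumes \<omega>: "connection B \<omega>" shows "strong B \<omega>"
  unfolding strong_def Let_def
proof
  fix p assume p: "p \<in> carrier P"
  \<comment> \<open>The field of \<open>\<omega>\<close> puts it in gauge form, and
    \<open>?z\<close> represents \<open>dp\<close> under the extended quotient map.\<close>
  let ?A = "\<lambda>u. base_form (\<omega> u)" and ?z = "tens K P P \<one>\<^bsub>P\<^esub> p"
  have A: "linear_map K O0 OM ?A" by (intro linear_intros connection_linear[OF \<omega>])
  have z: "?z \<in> carrier PP" using p by simp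
  have "Pi_proj B \<omega> (q ?z) = Pi_proj B (\<lambda>v. omega_ref B v \<oplus>\<^bsub>OP\<^esub> gauge_map ?A v) (q ?z)"
    by (rule Pi_proj_cong[OF connection_decomposition[OF \<omega>] q_closed[OF z]])
  then show "form_d K P NP p \<ominus>\<^bsub>OP\<^esub> Pi_proj B \<omega> (form_d K P NP p) \<in> hor_forms B"
    using vertical_complement_hor[OF A z] p by (simp add: Pc.form_d_form_of)
qed

text \<open>The inverse composes a connection with \<open>base_form\<close>. One composite is the
  identity because \<open>base_form\<close> kills the reference connection and recovers
  \<open>A\<close>, the other by \<open>connection_decomposition\<close>.\<close>

lemma gauge_connection_bij: "bij_betw gauge_connection (gauge_fields B) (connections B)"
proof (rule bij_betw_byWitness[where f' = "\<lambda>\<omega>. restrict (\<lambda>v. base_form (\<omega> v)) (carrier O0)"])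
  \<comment> \<open>Restriction makes the recovered field extensional; the gauge map reads the field
    on \<Omega>0 only and does not notice it.\<close>
  have gauge_cong: "gauge_map (restrict A (carrier O0)) v = gauge_map A v" if "v \<in> carrier O0" for A v
    unfolding gauge_map_def by (rule tlift_cong[OF O0_mod H_mod]) (simp_all add: that)
  show "\<forall>A\<in>gauge_fields B. restrict (\<lambda>v. base_form (gauge_connection A v)) (carrier O0) = A"
    by (auto simp: gauge_connection_def gauge_fields_def base_form_gauge_sum intro!: extensionalityI[of _ "carrier O0"])
  show "\<forall>\<omega>\<in>connections B. gauge_connection (restrict (\<lambda>v. base_form (\<omega> v)) (carrier O0)) = \<omega>"
    by (auto simp: gauge_connection_def connections_def gauge_cong connection_decomposition[symmetric]
        intro!: extensionalityI[of _ "carrier O0"])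
  show "gauge_connection ` gauge_fields B \<subseteq> connections B"
  proof clarify
    fix A assume A: "A \<in> gauge_fields B"
    have "connection B (gauge_connection A)"
      by (rule connection_cong[OF connection_gauge_sum[OF gauge_fields_linear[OF A]]])
        (simp add: gauge_connection_def)
    then show "gauge_connection A \<in> connections B" by (simp add: gauge_connection_def connections_def)
  qed
  show "(\<lambda>\<omega>. restrict (\<lambda>v. base_form (\<omega> v)) (carrier O0)) ` connections B \<subseteq> gauge_fields B"
  proof (clarsimp simp: gauge_fields_def connections_def)
    fix \<omega> assume "connection B \<omega>"
    then have "linear_map K O0 OM (\<lambda>v. base_form (\<omega> v))" by (intro linear_intros connection_linear)
    then show "linear_map K O0 OM (restrict (\<lambda>v. base_form (\<omega> v)) (carrier O0))"
      by (rule linear_map_cong) simp_all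
  qed
qed

lemma gauge_connection_pi0:
  assumes "A \<in> gauge_fields B" "v \<in> ker_counit K H"
  shows "gauge_connection A (pi0 B v) = omega_ref B (pi0 B v) \<oplus>\<^bsub>OP\<^esub> gauge_term B A v"
  using assms by (simp add: gauge_connection_def ker_counit_def gauge_term_eq[OF gauge_fields_linear])

text \<open>The tensors are assumed to lie in the one-forms only as a sum. There \<open>piP\<close>
  agrees with the extended map \<open>q\<close>, and linearity of \<open>q\<close> distributes the
  formula over the single terms.\<close>

lemma gauge_connection_projection:
  fixes r :: nat
  assumes A: "A \<in> gauge_fields B"
    and m: "m \<in> {..<r} \<rightarrow> carrier M" and n: "n \<in> {..<r} \<rightarrow> carrier M"
    and h: "h \<in> {..<r} \<rightarrow> carrier H" and g: "g \<in> {..<r} \<rightarrow> carrier H"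
    and Om: "(\<Oplus>\<^bsub>PP\<^esub>i\<in>{..<r}. mmhh B (m i) (n i) (h i) (g i)) \<in> carrier (univ_forms K P)"
  defines "X \<equiv> piP B (\<Oplus>\<^bsub>PP\<^esub>i\<in>{..<r}. mmhh B (m i) (n i) (h i) (g i))"
  defines "Y \<equiv> X \<ominus>\<^bsub>OP\<^esub> Pi_proj B (gauge_connection A) X"
  shows "Y = (\<Oplus>\<^bsub>OP\<^esub>i\<in>{..<r}.
      (\<ominus>\<^bsub>OP\<^esub> sw OP (\<lambda>a b. hor B (form_lact K M NM (m i \<otimes>\<^bsub>M\<^esub> n i) (A (pi0 B a))) (h i \<cdot> b)) (g i))
      \<oplus>\<^bsub>OP\<^esub> hor B (form_lact K M NM (m i) (form_d K M NM (n i))) (h i \<cdot> g i))"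
    and "Y \<in> hor_forms B"
proof -
  let ?z = "\<Oplus>\<^bsub>PP\<^esub>i\<in>{..<r}. mmhh B (m i) (n i) (h i) (g i)"
    and ?\<omega> = "\<lambda>v. omega_ref B v \<oplus>\<^bsub>OP\<^esub> gauge_map A v"
  let ?D = "\<lambda>z. q z \<ominus>\<^bsub>OP\<^esub> Pi_proj B ?\<omega> (q z)"
  note A' = gauge_fields_linear[OF A]
  have z: "?z \<in> carrier PP" and X: "X = q ?z"
    using Om by (simp_all add: X_def piP_q Pc.univ_carrier PP_of_def)
  have "Pi_proj B (gauge_connection A) (q ?z) = Pi_proj B ?\<omega> (q ?z)"
    by (rule Pi_proj_cong) (simp_all add: gauge_connection_def z)
  then have Y: "Y = ?D ?z" by (simp add: Y_def X)
  show "Y \<in> hor_forms B" unfolding Y by (rule vertical_complement_hor[OF A' z])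
  have "?D ?z = (\<Oplus>\<^bsub>OP\<^esub>i\<in>{..<r}. ?D (mmhh B (m i) (n i) (h i) (g i)))"
    by (rule linear_map_finsum[OF mods(3) O_mods(2)])
      ((intro linear_intros linear_map_comp[OF linear_Pi_proj[OF linear_gauge_sum[OF A']]])?;
        use m n h g in \<open>auto simp: Pi_def\<close>)+
  also have "\<dots> = (\<Oplus>\<^bsub>OP\<^esub>i\<in>{..<r}.
      (\<ominus>\<^bsub>OP\<^esub> sw OP (\<lambda>a b. hor B (form_lact K M NM (m i \<otimes>\<^bsub>M\<^esub> n i) (A (pi0 B a))) (h i \<cdot> b)) (g i))
      \<oplus>\<^bsub>OP\<^esub> hor B (form_lact K M NM (m i) (form_d K M NM (n i))) (h i \<cdot> g i))"
    by (rule finsum_cong_all, rule Pi_proj_gauge[OF A']) (use m n h g in auto)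
  finally show "Y = \<dots>" unfolding Y .
qed

end

theorem theorem3p3:
  fixes B :: "('k, 'm, 'h) bundle_data"
  assumes "tensor_bundle B"
  shows "\<exists>\<Psi>. bij_betw \<Psi> (gauge_fields B) (connections B) \<and>
    (\<forall>A\<in>gauge_fields B.
      (\<forall>v\<in>ker_counit (K_of B) (H_of B).
        \<Psi> A (pi0 B v) = omega_ref B (pi0 B v) \<oplus>\<^bsub>OmegaP B\<^esub> gauge_term B A v) \<and>
      (\<forall>(r::nat) m n h g.
        m \<in> {..<r} \<rightarrow> carrier (M_of B) \<and> n \<in> {..<r} \<rightarrow> carrier (M_of B) \<and>
        h \<in> {..<r} \<rightarrow> carrier (H_of B) \<and> g \<in> {..<r} \<rightarrow> carrier (H_of B) \<and>
        (\<Oplus>\<^bsub>PP_of B\<^esub>i\<in>{..<r}. mmhh B (m i) (n i) (h i) (g i))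
          \<in> carrier (univ_forms (K_of B) (P_of B)) \<longrightarrow>
        (let X = piP B (\<Oplus>\<^bsub>PP_of B\<^esub>i\<in>{..<r}. mmhh B (m i) (n i) (h i) (g i));
             Y = X \<ominus>\<^bsub>OmegaP B\<^esub> Pi_proj B (\<Psi> A) X
         in Y = (\<Oplus>\<^bsub>OmegaP B\<^esub>i\<in>{..<r}.
              (\<ominus>\<^bsub>OmegaP B\<^esub> sweedler2 (K_of B) (H_of B) (OmegaP B)
                 (\<lambda>a b. hor B (form_lact (K_of B) (M_of B) (NM_of B)
                                 (m i \<otimes>\<^bsub>M_of B\<^esub> n i) (A (pi0 B a)))
                              (h i \<otimes>\<^bsub>H_of B\<^esub> b)) (g i))
              \<oplus>\<^bsub>OmegaP B\<^esub>
              hor B (form_lact (K_of B) (M_of B) (NM_of B) (m i)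
                      (form_d (K_of B) (M_of B) (NM_of B) (n i)))
                    (h i \<otimes>\<^bsub>H_of B\<^esub> g i)) \<and>
            Y \<in> hor_forms B))) \<and>
    (\<forall>\<omega>. connection B \<omega> \<longrightarrow> strong B \<omega>)"
proof -
  interpret trivial_bundle B by unfold_locales (rule assms)
  show ?thesis
    unfolding Let_def
    by (intro exI[of _ gauge_connection] conjI ballI allI impI gauge_connection_bij gauge_connection_pi0
        connection_strong; (elim conjE)?)
      (assumption | rule gauge_connection_projection)+
qed

end
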